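(* Fix a constant $\epsilon\in(0,1/4)$, and let $\lambda=4$ and $\gamma=1+4\epsilon$. In the dynamic $b$-matching setting (defined in the context), one can maintain, in $O(\log n)$ amortized update time, a fractional $b$-matching $w:E\to[0,1]$ in the current graph $G=(V,E)$ such that: (1) $W_v\le c_v/\gamma$ for all nodes $v\in V$; (2) $w(u,v)=1$ for each edge $(u,v)\in E$ with $W_u<c_u/\lambda$ and $W_v<c_v/\lambda$. Further, the size of a maximum $b$-matching in $G$ is at most $O(1)$ times $\sum_{e\in E}w(e)$.
   Context: Dynamic $b$-matching: a simple graph $G=(V,E)$ with $|V|=n$ nodes, each node $v$ having capacity $c_v\in\{1,\dots,n\}$; $V$ and the capacities are fixed, initially $E=\emptyset$, and each update inserts or deletes one edge. A $b$-matching is a subset $E'\subseteq E$ in which each node $v$ is incident to at most $c_v$ edges of $E'$. A fractional $b$-matching is a function $w:E\to[0,1]$ with $W_v=\sum_{u:(u,v)\in E}w(u,v)\le c_v$ for every $v$. Amortized update time $T$ means total time $O(t\cdot T)$ over any $t$ updates starting from the empty graph. *)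

theory Defs
  imports Complex_Main
begin

section \<open>Graphs, b-matchings, fractional b-matchings\<close>

text \<open>Nodes are \<open>0, \<dots>, n - 1\<close>; an edge is the set of its two endpoints.\<close>

type_synonym edge = "nat set"

definition b_matching :: "nat \<Rightarrow> (nat \<Rightarrow> nat) \<Rightarrow> edge set \<Rightarrow> edge set \<Rightarrow> bool" where
  "b_matching n c E M \<longleftrightarrow> M \<subseteq> E \<and> (\<forall>v<n. card {e \<in> M. v \<in> e} \<le> c v)"

definition max_b_matching_size :: "nat \<Rightarrow> (nat \<Rightarrow> nat) \<Rightarrow> edge set \<Rightarrow> nat" where
  "max_b_matching_size n c E = Max (card ` {M. b_matching n c E M})"

definition node_weight :: "edge set \<Rightarrow> (edge \<Rightarrow> real) \<Rightarrow> nat \<Rightarrow> real" where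
  "node_weight E w v = (\<Sum>u | {u, v} \<in> E. w {u, v})"

definition fractional_b_matching ::
    "nat \<Rightarrow> (nat \<Rightarrow> nat) \<Rightarrow> edge set \<Rightarrow> (edge \<Rightarrow> real) \<Rightarrow> bool" where
  "fractional_b_matching n c E w \<longleftrightarrow>
     (\<forall>e\<in>E. 0 \<le> w e \<and> w e \<le> 1) \<and> (\<forall>v<n. node_weight E w v \<le> real (c v))"


section \<open>Update sequences\<close>

datatype update = Insert nat nat | Delete nat nat

fun apply_update :: "update \<Rightarrow> edge set \<Rightarrow> edge set" where
  "apply_update (Insert u v) E = insert {u, v} E"
| "apply_update (Delete u v) E = E - {{u, v}}"

fun valid_update :: "nat \<Rightarrow> edge set \<Rightarrow> update \<Rightarrow> bool" where
  "valid_update n E (Insert u v) \<longleftrightarrow> u < n \<and> v < n \<and> u \<noteq> v \<and> {u, v} \<notin> E"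
| "valid_update n E (Delete u v) \<longleftrightarrow> u < n \<and> v < n \<and> u \<noteq> v \<and> {u, v} \<in> E"

definition graph_after :: "update list \<Rightarrow> edge set" where
  "graph_after us = fold apply_update us {}"

definition valid_updates :: "nat \<Rightarrow> update list \<Rightarrow> bool" where
  "valid_updates n us \<longleftrightarrow>
     (\<forall>i<length us. valid_update n (graph_after (take i us)) (us ! i))"


section \<open>The machine: a word RAM with word length \<open>b\<close>\<close>

text \<open>
  Programs are while programs over finitely many named, randomly accessible arrays of
  words; a scalar variable is cell 0 of an array.  Interleaving the arrays turns this into
  an ordinary RAM with a single memory, with constant-factor overhead.  Every
  arithmetic result and every literal is reduced modulo \<open>2 ^ b\<close>.  As usual on \<open>nat\<close>,
  subtraction is truncated at 0 and division by 0 yields 0.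
\<close>

datatype binop = Plus | Minus | Times | Divide | Modulo | Less | Equal

datatype expr =
    Const nat
  | Read string expr
  | Bin binop expr expr

datatype com =
    Skip
  | Write string expr expr  \<comment> \<open>\<open>Write a i e\<close> stands for \<open>a[i] := e\<close>\<close>
  | Seq com com
  | Cond expr com com
  | While expr com

type_synonym memory = "string \<Rightarrow> nat \<Rightarrow> nat"

definition put :: "string \<Rightarrow> nat \<Rightarrow> nat \<Rightarrow> memory \<Rightarrow> memory" where
  "put a i x m = m(a := (m a)(i := x))"

fun apply_binop :: "binop \<Rightarrow> nat \<Rightarrow> nat \<Rightarrow> nat" where
  "apply_binop Plus x y = x + y"
| "apply_binop Minus x y = x - y"
| "apply_binop Times x y = x * y"
| "apply_binop Divide x y = x div y"
| "apply_binop Modulo x y = x mod y"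
| "apply_binop Less x y = (if x < y then 1 else 0)"
| "apply_binop Equal x y = (if x = y then 1 else 0)"

fun eval :: "nat \<Rightarrow> memory \<Rightarrow> expr \<Rightarrow> nat" where
  "eval b m (Const k) = k mod 2 ^ b"
| "eval b m (Read a i) = m a (eval b m i)"
| "eval b m (Bin f x y) = apply_binop f (eval b m x) (eval b m y) mod 2 ^ b"

fun expr_time :: "expr \<Rightarrow> nat" where
  "expr_time (Const k) = 1"
| "expr_time (Read a i) = 1 + expr_time i"
| "expr_time (Bin f x y) = 1 + expr_time x + expr_time y"

text \<open>\<open>exec b p m t m'\<close>: on memory \<open>m\<close>, program \<open>p\<close> halts after \<open>t\<close> steps with memory \<open>m'\<close>.\<close>

inductive exec :: "nat \<Rightarrow> com \<Rightarrow> memory \<Rightarrow> nat \<Rightarrow> memory \<Rightarrow> bool" for b :: nat where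
  exec_Skip: "exec b Skip m 1 m"
| exec_Write: "exec b (Write a i e) m (1 + expr_time i + expr_time e)
      (put a (eval b m i) (eval b m e) m)"
| exec_Seq: "exec b p m t1 m1 \<Longrightarrow> exec b q m1 t2 m2 \<Longrightarrow> exec b (Seq p q) m (t1 + t2) m2"
| exec_Cond_true: "eval b m e \<noteq> 0 \<Longrightarrow> exec b p m t m1 \<Longrightarrow>
      exec b (Cond e p q) m (1 + expr_time e + t) m1"
| exec_Cond_false: "eval b m e = 0 \<Longrightarrow> exec b q m t m1 \<Longrightarrow>
      exec b (Cond e p q) m (1 + expr_time e + t) m1"
| exec_While_false: "eval b m e = 0 \<Longrightarrow> exec b (While e p) m (1 + expr_time e) m"
| exec_While_true: "eval b m e \<noteq> 0 \<Longrightarrow> exec b p m t1 m1 \<Longrightarrow> exec b (While e p) m1 t2 m2 \<Longrightarrow>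
      exec b (While e p) m (1 + expr_time e + t1 + t2) m2"

inductive_cases exec_SkipE: "exec b Skip m t m'"
  and exec_WriteE: "exec b (Write a i e) m t m'"
  and exec_SeqE: "exec b (Seq p q) m t m'"
  and exec_CondE: "exec b (Cond e p q) m t m'"
  and exec_WhileE: "exec b (While e p) m t m'"

lemma exec_deterministic:
  "exec b p m t m1 \<Longrightarrow> exec b p m t' m1' \<Longrightarrow> t' = t \<and> m1' = m1"
proof (induction arbitrary: t' m1' rule: exec.induct)
  case exec_Skip
  then show ?case by (auto elim: exec_SkipE)
next
  case exec_Write
  then show ?case by (auto elim: exec_WriteE)
next
  case (exec_Seq p m t1 m1 q t2 m2)
  from exec_Seq.prems obtain s1 k1 s2 where
    1: "exec b p m s1 k1" "exec b q k1 s2 m1'" "t' = s1 + s2"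
    by (auto elim: exec_SeqE)
  from exec_Seq.IH(1)[OF 1(1)] exec_Seq.IH(2)[of s2 m1'] 1(2,3) show ?case by simp
next
  case (exec_Cond_true m e p t m1 q)
  from exec_Cond_true.prems exec_Cond_true.hyps(1) obtain s where
    1: "exec b p m s m1'" "t' = 1 + expr_time e + s"
    by (auto elim: exec_CondE)
  from exec_Cond_true.IH[OF 1(1)] 1(2) show ?case by simp
next
  case (exec_Cond_false m e q t m1 p)
  from exec_Cond_false.prems exec_Cond_false.hyps(1) obtain s where
    1: "exec b q m s m1'" "t' = 1 + expr_time e + s"
    by (auto elim: exec_CondE)
  from exec_Cond_false.IH[OF 1(1)] 1(2) show ?case by simp
next
  case (exec_While_false m e p)
  from exec_While_false.prems exec_While_false.hyps show ?case
    by (auto elim: exec_WhileE)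
next
  case (exec_While_true m e p t1 m1 t2 m2)
  from exec_While_true.prems exec_While_true.hyps(1) obtain s1 k1 s2 where
    1: "exec b p m s1 k1" "exec b (While e p) k1 s2 m1'" "t' = 1 + expr_time e + s1 + s2"
    by (cases rule: exec.cases) auto
  from exec_While_true.IH(1)[OF 1(1)] exec_While_true.IH(2)[of s2 m1'] 1(2,3) show ?case by simp
qed


section \<open>Running a dynamic algorithm\<close>

text \<open>
  Initially the memory holds \<open>n\<close> and the capacities and is zero elsewhere.  There is no
  preprocessing phase, so all computation is charged to the updates.
\<close>

definition initial_memory :: "nat \<Rightarrow> (nat \<Rightarrow> nat) \<Rightarrow> memory" where
  "initial_memory n c =
     (\<lambda>a i. if a = ''n'' \<and> i = 0 then n else if a = ''c'' \<and> i < n then c i else 0)"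

fun deliver :: "update \<Rightarrow> memory \<Rightarrow> memory" where
  "deliver (Insert u v) m = put ''v'' 0 v (put ''u'' 0 u (put ''op'' 0 1 m))"
| "deliver (Delete u v) m = put ''v'' 0 v (put ''u'' 0 u (put ''op'' 0 0 m))"

text \<open>
  The updates are delivered one at a time, and the program is run to completion after
  each of them; \<open>t\<close> is the total time.
\<close>

fun run :: "nat \<Rightarrow> com \<Rightarrow> memory \<Rightarrow> update list \<Rightarrow> nat \<Rightarrow> memory \<Rightarrow> bool" where
  "run b p m [] t m' \<longleftrightarrow> t = 0 \<and> m' = m"
| "run b p m (x # xs) t m' \<longleftrightarrow>
     (\<exists>t1 m1 t2. exec b p (deliver x m) t1 m1 \<and> run b p m1 xs t2 m' \<and> t = t1 + t2)"

lemma run_deterministic: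
  "run b p m us t m1 \<Longrightarrow> run b p m us t' m1' \<Longrightarrow> t' = t \<and> m1' = m1"
proof (induction us arbitrary: m t t')
  case Nil
  then show ?case by simp
next
  case (Cons x xs)
  obtain s1 k1 s2 where 1: "exec b p (deliver x m) s1 k1" "run b p k1 xs s2 m1" "t = s1 + s2"
    using Cons.prems(1) by auto
  obtain s1' k1' s2' where 2: "exec b p (deliver x m) s1' k1'" "run b p k1' xs s2' m1'"
      "t' = s1' + s2'"
    using Cons.prems(2) by auto
  have "s1' = s1 \<and> k1' = k1"
    by (rule exec_deterministic[OF 1(1) 2(1)])
  moreover from this have "s2' = s2 \<and> m1' = m1"
    using Cons.IH[OF 1(2)] 2(2) by simp
  ultimately show ?case
    using 1(3) 2(3) by simp
qed

text \<open>
  The weight of the edge \<open>{u, v}\<close> with \<open>u < v\<close> is kept in memory explicitly, as a numerator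
  and a denominator word at index \<open>u * n + v\<close>.
\<close>

definition stored_weight :: "nat \<Rightarrow> memory \<Rightarrow> edge \<Rightarrow> real" where
  "stored_weight n m e =
     real (m ''num'' (Min e * n + Max e)) / real (m ''den'' (Min e * n + Max e))"

end

theory Submission
  imports Defs
begin

text \<open>
  The algorithm does not depend on \<open>\<epsilon>\<close>: it keeps every load \<open>W v\<close> at most \<open>c v / 2\<close>.
  Each node \<open>v\<close> has a level \<open>l v\<close>, and an edge at level \<open>i\<close> has weight \<open>(3 / 4) ^ i\<close>, where \<open>i\<close> is
  between \<open>max (l u - 1) (l v - 1)\<close> and \<open>max (l u) (l v)\<close>.  A node with \<open>W v > c v / 2\<close> pushes its
  lowest edges up one at a time and raises its level when none is left; a node with
  \<open>W v < c v / 4\<close> and positive level takes all edges it alone holds up down by one level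
  and then lowers its own level.  Once no node can move, an edge whose endpoints both have
  \<open>W < c / 4\<close> is at level 0, so it has weight 1.

  The work is paid for by the potential
  \<open>65 \<Sum> (L - i) + 384 \<Sum> (4 / 3) ^ l v * max 0 (3 / 8 * c v - W v) - \<Sum> l v + |stack|\<close>, the first
  sum over ordered edges and the second over nodes of positive level.  Moving an edge up frees
  edge potential and costs at most \<open>384 / 3\<close> at the far endpoint.  While a node lowers its edges
  it remains below \<open>c v / 3 < 3 / 8 * c v\<close>, so the decrement of its level frees
  \<open>4 * (4 / 3) ^ l v * c v\<close>, more than the cost of scanning its at most \<open>(4 / 3) ^ l v * c v / 4\<close>
  edges of that level.  At rest, nodes of positive level have
  an edge, so \<open>\<Sum> l v \<le> 2 L |E|\<close>.  An insertion deposits \<open>O(L) = O(log n)\<close> and a deletion \<open>O(1)\<close>.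
\<close>

section \<open>Executions without overflow\<close>

text \<open>The tolerance of one level for edges lets a node shift its edges one by one while a
  single invariant holds throughout; no half-finished level change has to be described. The
  threshold \<open>3 / 8\<close> is squeezed from both sides by the ratio \<open>3 / 4\<close>:
  moving an edge up keeps at least \<open>3 / 4\<close> of a load above \<open>1 / 2\<close>, and
  \<open>3 / 4\<close> of \<open>1 / 2\<close> is \<open>3 / 8\<close>; moving edges down multiplies
  a load below \<open>1 / 4\<close> by at most \<open>4 / 3\<close>, which gives
  \<open>1 / 3\<close>, with a gap of \<open>1 / 24\<close>. Since lowering a level keeps at most
  \<open>3 / 4\<close> of the growth factor, \<open>384 / 24 / 4 = 4\<close> units per growth and
  capacity are freed. Each edge is counted twice with 65, and \<open>130 = 384 / 3 + 1 + 1\<close>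
  covers the far endpoint, one push and one unit for time. The level term pays for level increases,
  which free no other potential. The energy has two uses: its decrease bounds the time, and its
  lower bound makes the loops halt. All stored numbers are polynomial in \<open>n\<close>, because
  the common denominator \<open>4 ^ top_level n\<close> is; overflow is therefore excluded by
  counting degrees of expressions.\<close>

fun ev :: "memory \<Rightarrow> expr \<Rightarrow> nat" where
  "ev m (Const k) = k"
| "ev m (Read a i) = m a (ev m i)"
| "ev m (Bin f x y) = apply_binop f (ev m x) (ev m y)"

text \<open>Over a memory with cells below \<open>R\<close>, an expression of degree \<open>d\<close> has value below \<open>R ^ d\<close>.
  Bounding all cells therefore rules out overflow inside expressions.\<close>

fun degree :: "expr \<Rightarrow> nat" where
  "degree (Bin f x y) = degree x + degree y"
| "degree _ = 1"

fun modest :: "expr \<Rightarrow> bool" where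
  "modest (Const k) \<longleftrightarrow> k \<le> 64"
| "modest (Read a i) \<longleftrightarrow> modest i \<and> degree i \<le> 16"
| "modest (Bin f x y) \<longleftrightarrow> modest x \<and> modest y"

definition bounded :: "nat \<Rightarrow> memory \<Rightarrow> bool" where
  "bounded R m \<longleftrightarrow> (\<forall>a i. m a i < R)"

text \<open>Truncated subtraction cannot increase its first argument, so such an expression never
  exceeds a cell or a literal. Writing its value needs no overflow check.\<close>

fun is_copy :: "expr \<Rightarrow> bool" where
  "is_copy (Const k) = True"
| "is_copy (Read a i) = True"
| "is_copy (Bin f x y) \<longleftrightarrow> f = Minus \<and> is_copy x"

fun straight :: "com \<Rightarrow> bool" where
  "straight Skip = True"
| "straight (Write a i e) \<longleftrightarrow> modest i \<and> degree i \<le> 16 \<and> modest e \<and> degree e \<le> 16"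
| "straight (Seq p q) \<longleftrightarrow> straight p \<and> straight q"
| "straight (Cond e p q) \<longleftrightarrow> modest e \<and> degree e \<le> 16 \<and> straight p \<and> straight q"
| "straight (While e p) = False"

fun result :: "com \<Rightarrow> memory \<Rightarrow> memory" where
  "result (Write a i e) m = put a (ev m i) (ev m e) m"
| "result (Seq p q) m = result q (result p m)"
| "result (Cond e p q) m = (if ev m e \<noteq> 0 then result p m else result q m)"
| "result _ m = m"

text \<open>The remaining side condition of loop-free code: written values stay below
  \<open>R\<close>. Intermediate values may be larger and are controlled by
  \<open>degree\<close>.\<close>

fun fits :: "nat \<Rightarrow> com \<Rightarrow> memory \<Rightarrow> bool" where
  "fits R (Write a i e) m \<longleftrightarrow> is_copy e \<or> ev m e < R"
| "fits R (Seq p q) m \<longleftrightarrow> fits R p m \<and> fits R q (result p m)"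
| "fits R (Cond e p q) m \<longleftrightarrow> (if ev m e \<noteq> 0 then fits R p m else fits R q m)"
| "fits R _ m = True"

fun max_time :: "com \<Rightarrow> nat" where
  "max_time (Write a i e) = 1 + expr_time i + expr_time e"
| "max_time (Seq p q) = max_time p + max_time q"
| "max_time (Cond e p q) = 1 + expr_time e + max (max_time p) (max_time q)"
| "max_time _ = 1"

fun writes :: "com \<Rightarrow> string set" where
  "writes (Write a i e) = {a}"
| "writes (Seq p q) = writes p \<union> writes q"
| "writes (Cond e p q) = writes p \<union> writes q"
| "writes (While e p) = writes p"
| "writes Skip = {}"

lemma result_frame: "A \<notin> writes p \<Longrightarrow> result p m A = m A"
  by (induction p arbitrary: m) (auto simp: put_def)

text \<open>The exponent 16 is the largest degree that \<open>modest\<close> and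
  \<open>straight\<close> admit, and 64 is the largest literal.\<close>

locale word_ram =
  fixes b R :: nat
  assumes R_gt: "64 < R" and R_pow: "R ^ 16 \<le> 2 ^ b"
begin

lemma ev_less: "bounded R m \<Longrightarrow> modest e \<Longrightarrow> ev m e < R ^ degree e"
proof (induction e)
  case (Const k)
  then show ?case using R_gt by simp
next
  case (Read a i)
  then show ?case by (simp add: bounded_def)
next
  case (Bin f x y)
  let ?X = "R ^ degree x" and ?Y = "R ^ degree y"
  have x: "ev m x < ?X" and y: "ev m y < ?Y" using Bin by simp_all
  have pos: "0 < degree e" for e by (induction e) simp_all
  have big: "2 \<le> R ^ degree e" for e
    using R_gt pos[of e] self_le_power[of R "degree e"] by linarith
  have le: "?X \<le> ?X * ?Y" using big[of y] by simp
  \<comment> \<open>Both factors are at least 2, so their sum is at most their product. This permits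
    one rule for all operators: degrees add up.\<close>
  have "ev m x + ev m y < ?X * ?Y"
  proof -
    have "?X + ?Y \<le> ?X * ?Y" using big[of x] big[of y]
      by (metis add_mult_distrib mult_le_mono1 mult_le_mono2 mult_2 nat_le_linear add_le_mono
          order.trans mult_2_right)
    then show ?thesis using x y by linarith
  qed
  moreover have "ev m x * ev m y < ?X * ?Y" using x y by (simp add: mult_strict_mono')
  moreover have "ev m x - ev m y < ?X * ?Y" using x le by linarith
  moreover have "ev m x div ev m y < ?X * ?Y" using x le by (meson div_le_dividend order.strict_trans1 order.strict_trans2)
  moreover have "ev m x mod ev m y < ?X * ?Y" using x le by (meson mod_less_eq_dividend order.strict_trans1 order.strict_trans2)
  moreover have "1 < ?X * ?Y" using big[of x] le by linarith
  ultimately show ?case using R_gt by (cases f) (simp_all add: power_add)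
qed

lemma eval_eq_ev: "bounded R m \<Longrightarrow> modest e \<Longrightarrow> degree e \<le> 16 \<Longrightarrow> eval b m e = ev m e"
proof (induction e)
  case (Const k)
  then have "k < R ^ 16" using R_gt self_le_power[of R 16] by (simp add: order.strict_trans2)
  then show ?case using Const R_pow by simp
next
  case (Read a i)
  then show ?case by simp
next
  case (Bin f x y)
  have "ev m (Bin f x y) < R ^ degree (Bin f x y)" by (rule ev_less) (use Bin in auto)
  also have "\<dots> \<le> R ^ 16" using Bin.prems(3) R_gt by (intro power_increasing) auto
  also note R_pow
  finally show ?case using Bin by simp
qed

lemma bounded_put: "bounded R m \<Longrightarrow> x < R \<Longrightarrow> bounded R (put a i x m)"
  by (simp add: bounded_def put_def)

lemma ev_copy: "bounded R m \<Longrightarrow> modest e \<Longrightarrow> is_copy e \<Longrightarrow> ev m e < R"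
  using R_gt by (induction e) (auto simp: bounded_def less_imp_diff_less)

section \<open>Total correctness with time bounds\<close>

definition ok :: "com \<Rightarrow> memory \<Rightarrow> (nat \<Rightarrow> memory \<Rightarrow> bool) \<Rightarrow> bool" where
  "ok p m Q \<longleftrightarrow> (\<exists>t m'. exec b p m t m' \<and> bounded R m' \<and> Q t m')"

lemma ok_weaken: "ok p m Q \<Longrightarrow> (\<And>t m'. bounded R m' \<Longrightarrow> Q t m' \<Longrightarrow> Q' t m') \<Longrightarrow> ok p m Q'"
  unfolding ok_def by blast

text \<open>Loop-free code is verified by computing \<open>result\<close>, \<open>fits\<close> and
  \<open>max_time\<close>, without reasoning about the big-step relation.\<close>

lemma ok_straight:
  "straight p \<Longrightarrow> bounded R m \<Longrightarrow> fits R p m \<Longrightarrow>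
    ok p m (\<lambda>t m'. t \<le> max_time p \<and> m' = result p m)"
proof (induction p arbitrary: m)
  case Skip
  then show ?case by (auto simp: ok_def intro: exec_Skip)
next
  case (Write a i e)
  then have "ev m e < R" by (auto intro: ev_copy)
  with Write show ?case
    using exec_Write[of b a i e m] by (auto simp: ok_def eval_eq_ev bounded_put)
next
  case (Seq p q)
  then have "bounded R (result p m)" by (auto simp: ok_def)
  with Seq obtain t1 t2 where "exec b p m t1 (result p m)" "t1 \<le> max_time p"
    "exec b q (result p m) t2 (result q (result p m))" "t2 \<le> max_time q"
    "bounded R (result q (result p m))"
    by (fastforce simp: ok_def)
  then show ?case by (fastforce simp: ok_def intro: exec_Seq)
next
  case (Cond e p q)
  then have e: "eval b m e = ev m e" by (simp add: eval_eq_ev)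
  show ?case
  proof (cases "ev m e = 0")
    case True
    with Cond obtain t where "exec b q m t (result q m)" "t \<le> max_time q" "bounded R (result q m)"
      by (fastforce simp: ok_def)
    moreover from this have "exec b (Cond e p q) m (1 + expr_time e + t) (result q m)"
      using True e by (intro exec_Cond_false) auto
    ultimately show ?thesis using True by (force simp: ok_def)
  next
    case False
    with Cond obtain t where "exec b p m t (result p m)" "t \<le> max_time p" "bounded R (result p m)"
      by (fastforce simp: ok_def)
    moreover from this have "exec b (Cond e p q) m (1 + expr_time e + t) (result p m)"
      using False e by (intro exec_Cond_true) auto
    ultimately show ?thesis using False by (force simp: ok_def)
  qed
next
  case (While e p)
  then show ?case by simp
qed

lemma ok_Cond:
  assumes "bounded R m" "modest e" "degree e \<le> 16"
    and "ev m e \<noteq> 0 \<Longrightarrow> ok p m (\<lambda>t m'. Q (1 + expr_time e + t) m')"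
    and "ev m e = 0 \<Longrightarrow> ok q m (\<lambda>t m'. Q (1 + expr_time e + t) m')"
  shows "ok (Cond e p q) m Q"
  using assms eval_eq_ev[of m e] unfolding ok_def
  by (cases "ev m e = 0") (metis exec_Cond_false, metis exec_Cond_true)

text \<open>Termination and running time come from one quantity: each round lowers \<open>f\<close>
  by at least its own cost, and \<open>B\<close> bounds \<open>f\<close> from below. The extra
  summand in the conclusion is the final, failing test.\<close>

lemma ok_While:
  fixes f :: "memory \<Rightarrow> real"
  assumes e: "modest e" "degree e \<le> 16"
    and step: "\<And>m. bounded R m \<Longrightarrow> I m \<Longrightarrow> ev m e \<noteq> 0 \<Longrightarrow>
      ok p m (\<lambda>t m'. I m' \<and> real (1 + expr_time e + t) + f m' \<le> f m)"
    and lower: "\<And>m. I m \<Longrightarrow> B \<le> f m"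
    and m: "bounded R m" "I m"
  shows "ok (While e p) m (\<lambda>t m'. I m' \<and> ev m' e = 0 \<and> real t + f m' \<le> f m + real (1 + expr_time e))"
  using m
proof (induction "nat \<lceil>f m - B\<rceil>" arbitrary: m rule: less_induct)
  case less
  have ev: "eval b m e = ev m e" using less.prems e by (simp add: eval_eq_ev)
  show ?case
  proof (cases "ev m e = 0")
    case True
    then show ?thesis using ev less.prems exec_While_false[of b m e p] by (fastforce simp: ok_def)
  next
    case False
    with step less.prems obtain t1 m1 where 1: "exec b p m t1 m1" "bounded R m1" "I m1"
      and dec: "real (1 + expr_time e + t1) + f m1 \<le> f m"
      unfolding ok_def by blast
    \<comment> \<open>A round costs at least one step, so the rounded distance to \<open>B\<close>
      drops strictly.\<close>
    have "nat \<lceil>f m1 - B\<rceil> < nat \<lceil>f m - B\<rceil>"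
      using dec lower[OF 1(3)] lower[OF less.prems(2)] by simp linarith
    from less.hyps[OF this 1(2,3)] obtain t2 m2 where 2: "exec b (While e p) m1 t2 m2"
      "bounded R m2" "I m2" "ev m2 e = 0" "real t2 + f m2 \<le> f m1 + real (1 + expr_time e)"
      unfolding ok_def by blast
    have "exec b (While e p) m (1 + expr_time e + t1 + t2) m2"
      using False ev 1(1) 2(1) by (intro exec_While_true) auto
    then show ?thesis using 2 dec unfolding ok_def by (intro exI conjI) auto
  qed
qed

end

section \<open>Levels, loads and the potential\<close>

definition log_bound :: "nat \<Rightarrow> nat" where
  "log_bound n = (LEAST k. 2 * n \<le> 2 ^ k)"

text \<open>Three levels multiply a weight by \<open>27 / 64 < 1 / 2\<close>, so at the top level
  \<open>n\<close> edges together weigh at most \<open>1 / 2\<close>.\<close>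

definition top_level :: "nat \<Rightarrow> nat" where
  "top_level n = 3 * log_bound n"

text \<open>This is \<open>4 ^ top_level n\<close>, the common denominator of all weights up to the
  top level.\<close>

definition unit_weight :: "nat \<Rightarrow> nat" where
  "unit_weight n = 64 ^ log_bound n"

text \<open>Edges carry an index \<open>q\<close>: 0 if the edge is absent, and its level plus 1 otherwise.
  All loads are kept as integer multiples of \<open>1 / unit_weight n\<close>.\<close>

definition scaled_weight :: "nat \<Rightarrow> nat \<Rightarrow> nat" where
  "scaled_weight n q = (if q = 0 then 0 else 3 ^ (q - 1) * 4 ^ (top_level n + 1 - q))"

definition wt :: "nat \<Rightarrow> real" where
  "wt q = (if q = 0 then 0 else (3 / 4) ^ (q - 1))"

definition load :: "nat \<Rightarrow> (nat \<Rightarrow> nat \<Rightarrow> nat) \<Rightarrow> nat \<Rightarrow> real" where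
  "load n q x = (\<Sum>y<n. wt (q x y))"

lemma log_bound_ge: "2 * n \<le> 2 ^ log_bound n"
proof -
  have "2 * n \<le> 2 ^ (2 * n)" using less_exp[of "2 * n"] by linarith
  then show ?thesis unfolding log_bound_def by (rule LeastI)
qed

lemma log_bound_le: "2 * n \<le> 2 ^ k \<Longrightarrow> log_bound n \<le> k"
  unfolding log_bound_def by (rule Least_le)

lemma log_bound_less: "0 < n \<Longrightarrow> 2 ^ log_bound n < 4 * n"
proof (cases "log_bound n")
  case (Suc k)
  then have "\<not> 2 * n \<le> 2 ^ k" using log_bound_le[of n k] by linarith
  then show ?thesis using Suc by simp
qed simp

lemma unit_weight_eq: "unit_weight n = 4 ^ top_level n"
proof -
  have "(64 :: nat) = 4 ^ 3" by simp
  then show ?thesis unfolding unit_weight_def top_level_def by (simp only: power_mult)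
qed

lemma scaled_weight_eq:
  assumes "q \<le> top_level n + 1"
  shows "real (scaled_weight n q) = real (unit_weight n) * wt q"
proof (cases q)
  case (Suc i)
  then have "(4 :: real) ^ top_level n = 4 ^ (top_level n - i) * 4 ^ i"
    using assms by (simp flip: power_add)
  then show ?thesis using Suc
    by (simp add: scaled_weight_def wt_def unit_weight_eq power_divide)
qed (simp add: scaled_weight_def wt_def)

text \<open>The division is exact, since a factor 4 is left below the top. The program fills its
  weight table by this recurrence.\<close>

lemma scaled_weight_Suc:
  assumes "1 \<le> q" "q \<le> top_level n"
  shows "scaled_weight n (Suc q) = scaled_weight n q * 3 div 4"
proof -
  obtain i where q: "q = Suc i" using assms by (cases q) auto
  have "top_level n - i = Suc (top_level n - q)" using assms q by linarith
  then have "4 ^ (top_level n - i) = 4 * (4 ^ (top_level n - q) :: nat)" by simp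
  then show ?thesis by (simp add: scaled_weight_def q)
qed

lemma scaled_weight_1: "scaled_weight n 1 = unit_weight n"
  by (simp add: scaled_weight_def unit_weight_eq)

lemma wt_le_1: "wt q \<le> 1"
  by (simp add: wt_def power_le_one)

lemma scaled_weight_le: "q \<le> top_level n + 1 \<Longrightarrow> scaled_weight n q \<le> unit_weight n"
proof -
  assume q: "q \<le> top_level n + 1"
  have "real (unit_weight n) * wt q \<le> real (unit_weight n) * 1" by (intro mult_left_mono wt_le_1) auto
  then show ?thesis using scaled_weight_eq[OF q] by simp
qed

lemma wt_nonneg: "0 \<le> wt q"
  by (simp add: wt_def)

lemma wt_antimono: "1 \<le> i \<Longrightarrow> i \<le> j \<Longrightarrow> wt j \<le> wt i"
  by (simp add: wt_def power_decreasing)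

lemma wt_Suc: "1 \<le> i \<Longrightarrow> wt (Suc i) = 3 / 4 * wt i"
  by (cases i) (simp_all add: wt_def)

text \<open>This stops the climb: a node whose edges all sit at the top index has load at most
  \<open>1 / 2\<close>, and capacities are at least 1, so it is not overloaded.\<close>

lemma wt_top: "real n * wt (top_level n + 1) \<le> 1 / 2"
proof -
  have "(3 / 4 :: real) ^ top_level n = (27 / 64) ^ log_bound n"
    by (simp add: top_level_def power_mult power_divide)
  also have "\<dots> \<le> (1 / 2) ^ log_bound n" by (intro power_mono) auto
  finally have "wt (top_level n + 1) \<le> 1 / 2 ^ log_bound n" by (simp add: wt_def power_divide)
  then have "wt (top_level n + 1) * 2 ^ log_bound n \<le> 1" by (simp add: field_simps)
  moreover have "real (2 * n) \<le> 2 ^ log_bound n"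
    using log_bound_ge[of n] of_nat_mono[of "2 * n" "2 ^ log_bound n", where 'a = real] by simp
  then have "wt (top_level n + 1) * real (2 * n) \<le> wt (top_level n + 1) * 2 ^ log_bound n"
    by (intro mult_left_mono wt_nonneg)
  ultimately show ?thesis by (simp add: field_simps)
qed

section \<open>Changing the index of one edge: support and loads\<close>

definition set_arc :: "(nat \<Rightarrow> nat \<Rightarrow> nat) \<Rightarrow> nat \<Rightarrow> nat \<Rightarrow> nat \<Rightarrow> nat \<Rightarrow> nat \<Rightarrow> nat" where
  "set_arc q x y j = q(x := (q x)(y := j))"

definition set_edge :: "(nat \<Rightarrow> nat \<Rightarrow> nat) \<Rightarrow> nat \<Rightarrow> nat \<Rightarrow> nat \<Rightarrow> nat \<Rightarrow> nat \<Rightarrow> nat" where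
  "set_edge q x y j = set_arc (set_arc q x y j) y x j"

lemma set_edge_apply:
  "set_edge q x y j u v = (if u = x \<and> v = y \<or> u = y \<and> v = x then j else q u v)"
  by (simp add: set_edge_def set_arc_def)

definition support :: "(nat \<Rightarrow> nat \<Rightarrow> nat) \<Rightarrow> edge set" where
  "support q = {{x, y} | x y. q x y \<noteq> 0}"

lemma support_set_edge_other:
  "e \<noteq> {x, y} \<Longrightarrow> e \<in> support (set_edge q x y j) \<longleftrightarrow> e \<in> support q"
proof -
  assume e: "e \<noteq> {x, y}"
  have "set_edge q x y j u v = q u v" if "e = {u, v}" for u v
    using that e unfolding set_edge_apply by (metis insert_commute)
  then show ?thesis unfolding support_def mem_Collect_eq by metis
qed

lemma support_insert_edge:
  assumes "j \<noteq> 0"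
  shows "support (set_edge q x y j) = insert {x, y} (support q)"
proof -
  have "{x, y} \<in> support (set_edge q x y j)"
    unfolding support_def using assms
    by (intro CollectI exI[of _ x] exI[of _ y]) (simp add: set_edge_apply)
  then have "e \<in> support (set_edge q x y j) \<longleftrightarrow> e \<in> insert {x, y} (support q)" for e
    using support_set_edge_other[of e x y q j] by (cases "e = {x, y}") auto
  then show ?thesis by (rule set_eqI)
qed

lemma support_set_edge:
  assumes "q x y \<noteq> 0" "j \<noteq> 0"
  shows "support (set_edge q x y j) = support q"
proof -
  have "{x, y} \<in> support q" using assms(1) unfolding support_def by blast
  then show ?thesis using support_insert_edge[OF assms(2), of q x y] by (simp add: insert_absorb)
qed

lemma support_delete_edge: "support (set_edge q x y 0) = support q - {{x, y}}"
proof -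
  have "{x, y} \<notin> support (set_edge q x y 0)"
    unfolding support_def mem_Collect_eq doubleton_eq_iff set_edge_apply by metis
  then have "e \<in> support (set_edge q x y 0) \<longleftrightarrow> e \<in> support q - {{x, y}}" for e
    using support_set_edge_other[of e x y q 0] by (cases "e = {x, y}") auto
  then show ?thesis by (rule set_eqI)
qed

lemma sum_fun_upd:
  fixes f :: "nat \<Rightarrow> 'a" and h :: "'a \<Rightarrow> real"
  assumes "y < n"
  shows "(\<Sum>z<n. h ((f(y := j)) z)) = (\<Sum>z<n. h (f z)) + (h j - h (f y))"
proof -
  have "(\<Sum>z<n. h ((f(y := j)) z)) - (\<Sum>z<n. h (f z)) = (\<Sum>z<n. if z = y then h j - h (f y) else 0)"
    unfolding sum_subtractf[symmetric] by (intro sum.cong) auto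
  also have "\<dots> = h j - h (f y)" using assms by simp
  finally show ?thesis by simp
qed

lemma load_set_arc:
  "x < n \<Longrightarrow> y < n \<Longrightarrow>
    load n (set_arc q x y j) v = load n q v + (if v = x then wt j - wt (q x y) else 0)"
  using sum_fun_upd[of y n wt "q x" j] by (simp add: load_def set_arc_def)

lemma load_set_edge:
  assumes "x < n" "y < n" "x \<noteq> y"
  shows "load n (set_edge q x y j) v = load n q v +
    (if v = x then wt j - wt (q x y) else if v = y then wt j - wt (q y x) else 0)"
  using assms by (simp add: set_edge_def load_set_arc) (simp add: set_arc_def)

lemma wt_le_load: "y < n \<Longrightarrow> wt (q x y) \<le> load n q x"
  unfolding load_def by (rule member_le_sum) (simp_all add: wt_nonneg)

text \<open>Turns a bound on the load into a bound on the length of a scan.\<close>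

lemma card_wt_le_load: "real (card {y. y < n \<and> q x y = j}) * wt j \<le> load n q x"
proof -
  have "(\<Sum>y | y < n \<and> q x y = j. wt (q x y)) \<le> load n q x"
    unfolding load_def by (rule sum_mono2) (auto simp: wt_nonneg)
  moreover have "(\<Sum>y | y < n \<and> q x y = j. wt (q x y)) = (\<Sum>y | y < n \<and> q x y = j. wt j)"
    by (rule sum.cong) auto
  ultimately show ?thesis by simp
qed

section \<open>The potential and its change under each move\<close>

definition edge_potential :: "nat \<Rightarrow> nat \<Rightarrow> real" where
  "edge_potential n q = (if q = 0 then 0 else real (top_level n) + 1 - real q)"

text \<open>Proportional to the inverse weight, so that \<open>growth i * wt i\<close> is the
  constant \<open>4 / 3\<close> for positive \<open>i\<close>: a change of load by one edge costs
  the same at each level. Nodes of level 0 cannot be lowered and store nothing, hence the value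
  0.\<close>

definition growth :: "nat \<Rightarrow> real" where
  "growth i = (if i = 0 then 0 else (4 / 3) ^ i)"

definition node_potential :: "nat \<Rightarrow> nat \<Rightarrow> real \<Rightarrow> real" where
  "node_potential i k W = growth i * max 0 (3 / 8 * real k - W)"

definition potential ::
    "nat \<Rightarrow> (nat \<Rightarrow> nat) \<Rightarrow> (nat \<Rightarrow> nat \<Rightarrow> nat) \<Rightarrow> (nat \<Rightarrow> nat) \<Rightarrow> nat \<Rightarrow> real" where
  "potential n c q l s = 65 * (\<Sum>x<n. \<Sum>y<n. edge_potential n (q x y))
     + 384 * (\<Sum>x<n. node_potential (l x) (c x) (load n q x)) - (\<Sum>x<n. real (l x)) + real s"

text \<open>Indices exceed levels by one. An edge of index \<open>l x\<close> may thus be raised,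
  and one of index \<open>l x + 1\<close> with a lower other endpoint may be lowered to
  \<open>l x\<close>, while \<open>x\<close> keeps its level. The bound
  \<open>l y \<le> q x y\<close> follows by symmetry.\<close>

definition well_leveled :: "nat \<Rightarrow> (nat \<Rightarrow> nat \<Rightarrow> nat) \<Rightarrow> (nat \<Rightarrow> nat) \<Rightarrow> bool" where
  "well_leveled n q l \<longleftrightarrow> (\<forall>x<n. l x \<le> top_level n \<and> q x x = 0) \<and>
     (\<forall>x<n. \<forall>y<n. q x y = q y x \<and>
        (q x y \<noteq> 0 \<longrightarrow> l x \<le> q x y \<and> q x y \<le> max (l x) (l y) + 1))"

definition calm :: "nat \<Rightarrow> real \<Rightarrow> nat \<Rightarrow> bool" where
  "calm k W i \<longleftrightarrow> W \<le> real k / 2 \<and> (i = 0 \<or> real k / 4 \<le> W)"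

lemma growth_nonneg: "0 \<le> growth i"
  by (simp add: growth_def)

lemma growth_mono: "i \<le> j \<Longrightarrow> growth i \<le> growth j"
  by (simp add: growth_def power_increasing)

lemma growth_wt: "1 \<le> i \<Longrightarrow> growth i * wt i = 4 / 3"
  by (cases i) (simp_all add: growth_def wt_def flip: power_mult_distrib)

lemma node_potential_nonneg: "0 \<le> node_potential i k W"
  by (simp add: node_potential_def growth_nonneg)

lemma node_potential_antimono: "W \<le> W' \<Longrightarrow> node_potential i k W' \<le> node_potential i k W"
  unfolding node_potential_def by (intro mult_left_mono growth_nonneg) auto

lemma node_potential_Lipschitz:
  "0 \<le> d \<Longrightarrow> node_potential i k (W - d) \<le> node_potential i k W + growth i * d"
  unfolding node_potential_def distrib_left[symmetric] by (intro mult_left_mono growth_nonneg) auto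

lemma well_leveledD:
  assumes "well_leveled n q l" "x < n" "y < n"
  shows "q x y = q y x" "q x y \<noteq> 0 \<Longrightarrow> l x \<le> q x y" "q x y \<noteq> 0 \<Longrightarrow> l y \<le> q x y"
    "q x y \<le> max (l x) (l y) + 1" "l x \<le> top_level n" "q x x = 0"
proof -
  show sym: "q x y = q y x" and "q x x = 0" and "l x \<le> top_level n"
    using assms unfolding well_leveled_def by blast+
  show "l x \<le> q x y" if "q x y \<noteq> 0" using assms that unfolding well_leveled_def by blast
  show "l y \<le> q x y" if "q x y \<noteq> 0" using assms that sym unfolding well_leveled_def by metis
  show "q x y \<le> max (l x) (l y) + 1"
    using assms unfolding well_leveled_def by (cases "q x y = 0") auto
qed

lemma well_leveled_le:
  assumes "well_leveled n q l" "x < n" "y < n"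
  shows "q x y \<le> top_level n + 1"
  using well_leveledD(4)[OF assms] well_leveledD(5)[OF assms] well_leveledD(5)[OF assms(1,3,2)]
  by simp

lemma well_leveled_set_edge:
  assumes wl: "well_leveled n q l" and "x < n" "y < n" "x \<noteq> y"
    and "j \<noteq> 0 \<Longrightarrow> l x \<le> j \<and> l y \<le> j" "j \<le> max (l x) (l y) + 1"
  shows "well_leveled n (set_edge q x y j) l"
  unfolding well_leveled_def
proof (intro conjI allI impI)
  fix u v assume uv: "u < n" "v < n"
  note D = well_leveledD[OF wl uv]
  show "set_edge q x y j u v = set_edge q x y j v u" using D(1) by (auto simp: set_edge_apply)
  assume "set_edge q x y j u v \<noteq> 0"
  then show "l u \<le> set_edge q x y j u v" using D(2) assms by (auto simp: set_edge_apply split: if_splits)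
  show "set_edge q x y j u v \<le> max (l u) (l v) + 1"
    using D(4) assms by (auto simp: set_edge_apply max.commute)
qed (use assms in \<open>auto simp: set_edge_apply well_leveled_def\<close>)

lemma well_leveled_set_level:
  assumes wl: "well_leveled n q l" and "x < n" "i \<le> top_level n"
    and arcs: "\<And>y. y < n \<Longrightarrow> y \<noteq> x \<Longrightarrow> q x y \<noteq> 0 \<Longrightarrow> i \<le> q x y \<and> q x y \<le> max i (l y) + 1"
  shows "well_leveled n q (l(x := i))"
  unfolding well_leveled_def
proof (intro conjI allI impI)
  fix u v assume uv: "u < n" "v < n"
  note D = well_leveledD[OF wl uv]
  show "q u v = q v u" by (rule D(1))
  assume ne: "q u v \<noteq> 0"
  then have "u \<noteq> v" using D(6) by auto
  then show "(l(x := i)) u \<le> q u v" using D(2) arcs[of v] uv ne by auto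
  show "q u v \<le> max ((l(x := i)) u) ((l(x := i)) v) + 1"
    using D(1,4) arcs[of v] arcs[of u] uv ne \<open>u \<noteq> v\<close> by (auto simp: max.commute)
qed (use assms in \<open>auto simp: well_leveled_def\<close>)

lemma potential_set_edge:
  fixes j :: nat
  assumes "x < n" "y < n" "x \<noteq> y" "q x y = q y x"
  defines "d \<equiv> wt j - wt (q x y)"
  shows "potential n c (set_edge q x y j) l s' = potential n c q l s
    + 130 * (edge_potential n j - edge_potential n (q x y))
    + 384 * (node_potential (l x) (c x) (load n q x + d) - node_potential (l x) (c x) (load n q x))
    + 384 * (node_potential (l y) (c y) (load n q y + d) - node_potential (l y) (c y) (load n q y))
    + (real s' - real s)"
proof -
  let ?q = "set_edge q x y j" and ?e = "edge_potential n"
  let ?P = "\<lambda>q x. node_potential (l x) (c x) (load n q x)"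
  have arc: "(\<Sum>u<n. \<Sum>v<n. ?e (set_arc q x y j u v)) =
    (\<Sum>u<n. \<Sum>v<n. ?e (q u v)) + (?e j - ?e (q x y))" if "x < n" "y < n" for q x y
    using sum_fun_upd[OF that(2), of ?e "q x" j]
      sum_fun_upd[OF that(1), of "\<lambda>r. \<Sum>v<n. ?e (r v)" q "(q x)(y := j)"]
    by (simp add: set_arc_def)
  have E: "(\<Sum>u<n. \<Sum>v<n. ?e (?q u v)) = (\<Sum>u<n. \<Sum>v<n. ?e (q u v)) + 2 * (?e j - ?e (q x y))"
    unfolding set_edge_def using assms by (simp add: arc) (simp add: set_arc_def)
  have "(\<Sum>v<n. ?P ?q v) - (\<Sum>v<n. ?P q v) =
    (\<Sum>v<n. (if v = x then ?P ?q x - ?P q x else 0) + (if v = y then ?P ?q y - ?P q y else 0))"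
    unfolding sum_subtractf[symmetric] by (intro sum.cong) (use assms in \<open>auto simp: load_set_edge\<close>)
  also have "\<dots> = (?P ?q x - ?P q x) + (?P ?q y - ?P q y)" using assms by (simp add: sum.distrib)
  finally have "(\<Sum>v<n. ?P ?q v) = (\<Sum>v<n. ?P q v) + (?P ?q x - ?P q x) + (?P ?q y - ?P q y)" by simp
  then show ?thesis unfolding potential_def E using assms by (simp add: load_set_edge)
qed

lemma potential_set_level:
  assumes "x < n"
  shows "potential n c q (l(x := i)) s = potential n c q l s
    + 384 * (node_potential i (c x) (load n q x) - node_potential (l x) (c x) (load n q x))
    - (real i - real (l x))"
proof -
  let ?P = "\<lambda>l x. node_potential (l x) (c x) (load n q x)"
  have "(\<Sum>v<n. ?P (l(x := i)) v) - (\<Sum>v<n. ?P l v) =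
    (\<Sum>v<n. if v = x then ?P (l(x := i)) x - ?P l x else 0)"
    unfolding sum_subtractf[symmetric] by (intro sum.cong) auto
  also have "\<dots> = ?P (l(x := i)) x - ?P l x" using assms by simp
  finally have "(\<Sum>v<n. ?P (l(x := i)) v) = (\<Sum>v<n. ?P l v) + (?P (l(x := i)) x - ?P l x)" by simp
  moreover have "(\<Sum>v<n. real ((l(x := i)) v)) = (\<Sum>v<n. real (l v)) + (real i - real (l x))"
    using sum_fun_upd[OF assms, of real l i] by simp
  ultimately show ?thesis unfolding potential_def by simp
qed

text \<open>An overloaded node stays above the threshold \<open>3 / 8\<close> of the node potential while it
  moves one edge up, so only the other endpoint gains node potential.\<close>

lemma raise_edge:
  assumes wl: "well_leveled n q l" and xy: "x < n" "y < n" and lx: "q x y = l x" "0 < l x"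
    and over: "real (c x) / 2 < load n q x"
  shows "well_leveled n (set_edge q x y (l x + 1)) l"
    and "s' \<le> s + 1 \<Longrightarrow> potential n c (set_edge q x y (l x + 1)) l s' + 1 \<le> potential n c q l s"
proof -
  have ne: "x \<noteq> y" and sym: "q x y = q y x" and ly: "l y \<le> l x"
    using well_leveledD[OF wl xy] lx by auto
  show "well_leveled n (set_edge q x y (l x + 1)) l"
    using ne ly by (intro well_leveled_set_edge wl xy) auto
  assume s: "s' \<le> s + 1"
  have w: "wt (l x + 1) - wt (q x y) = - (wt (l x) / 4)" using lx by (simp add: wt_Suc)
  have "wt (l x) \<le> load n q x" using wt_le_load[OF xy(2), of q x] lx by simp
  then have "load n q x - wt (l x) / 4 \<ge> 3 / 8 * real (c x)" using over by linarith
  then have "node_potential (l x) (c x) (load n q x - wt (l x) / 4) = 0"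
    by (simp add: node_potential_def)
  moreover have "node_potential (l y) (c y) (load n q y - wt (l x) / 4) \<le>
    node_potential (l y) (c y) (load n q y) + 1 / 3"
  proof -
    \<comment> \<open>The far endpoint lies no higher than the index \<open>l x\<close> of the edge,
      so its growth factor is at most \<open>growth (l x)\<close> and the lost quarter of the weight
      costs at most \<open>4 / 3 / 4\<close>.\<close>
    have "growth (l y) * (wt (l x) / 4) \<le> growth (l x) * (wt (l x) / 4)"
      by (intro mult_right_mono growth_mono ly) (simp add: wt_nonneg)
    then show ?thesis using growth_wt[of "l x"] lx(2)
        node_potential_Lipschitz[of "wt (l x) / 4" "l y" "c y" "load n q y"] wt_nonneg[of "l x"]
      by simp
  qed
  moreover have "edge_potential n (l x + 1) - edge_potential n (q x y) = - 1"
    using lx by (simp add: edge_potential_def)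
  ultimately show "potential n c (set_edge q x y (l x + 1)) l s' + 1 \<le> potential n c q l s"
    unfolding potential_set_edge[where s = s and s' = s', OF xy ne sym] w
    using node_potential_nonneg[of "l x" "c x" "load n q x"] s by simp
qed

text \<open>A load above \<open>1 / 2\<close> makes the node potential vanish at both levels, so
  only the level term changes and frees one unit. At the top level, \<open>wt_top\<close>
  contradicts the overload.\<close>

lemma raise_level:
  assumes wl: "well_leveled n q l" and x: "x < n" and cap: "1 \<le> c x"
    and none: "\<And>y. y < n \<Longrightarrow> q x y \<noteq> 0 \<Longrightarrow> q x y \<noteq> l x"
    and over: "real (c x) / 2 < load n q x"
  shows "l x < top_level n" and "well_leveled n q (l(x := l x + 1))"
    and "potential n c q (l(x := l x + 1)) s + 1 \<le> potential n c q l s"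
proof -
  have ge: "l x + 1 \<le> q x y" if "y < n" "q x y \<noteq> 0" for y
    using none[OF that] well_leveledD(2)[OF wl x that] by simp
  show less: "l x < top_level n"
  proof (rule ccontr)
    assume "\<not> l x < top_level n"
    then have "l x = top_level n" using well_leveledD(5)[OF wl x x] by simp
    then have "wt (q x y) \<le> wt (top_level n + 1)" if "y < n" for y
      using ge[OF that] by (cases "q x y = 0") (auto intro: wt_antimono simp: wt_nonneg wt_def)
    then have "load n q x \<le> (\<Sum>y<n. wt (top_level n + 1))"
      unfolding load_def by (intro sum_mono) auto
    then show False using wt_top[of n] over cap by simp
  qed
  show "well_leveled n q (l(x := l x + 1))"
  proof (rule well_leveled_set_level[OF wl x])
    fix y assume y: "y < n" "q x y \<noteq> 0"
    show "l x + 1 \<le> q x y \<and> q x y \<le> max (l x + 1) (l y) + 1"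
      using ge[OF y] well_leveledD(4)[OF wl x y(1)] by auto
  qed (use less in simp)
  have "node_potential i (c x) (load n q x) = 0" for i
    using over by (simp add: node_potential_def)
  then show "potential n c q (l(x := l x + 1)) s + 1 \<le> potential n c q l s"
    unfolding potential_set_level[OF x] by simp
qed

text \<open>The near endpoint stays in the linear range of its node potential, so the gained quarter
  of weight releases exactly \<open>1 / 3\<close>, worth 128. Against 130 for the edge and one push,
  a cost of 3 remains.\<close>

lemma lower_edge:
  assumes wl: "well_leveled n q l" and xy: "x < n" "y < n" and lx: "q x y = l x + 1" "l y < l x"
    and under: "load n q x + wt (l x + 1) / 3 \<le> real (c x) / 3"
  shows "well_leveled n (set_edge q x y (l x)) l"
    and "s' \<le> s + 1 \<Longrightarrow> potential n c (set_edge q x y (l x)) l s' \<le> potential n c q l s + 3"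
proof -
  have ne: "x \<noteq> y" and sym: "q x y = q y x"
    using well_leveledD[OF wl xy] lx by auto
  show "well_leveled n (set_edge q x y (l x)) l"
    using ne lx by (intro well_leveled_set_edge wl xy) auto
  assume s: "s' \<le> s + 1"
  let ?d = "wt (l x) / 4"
  have w: "wt (l x) - wt (q x y) = ?d" and w3: "wt (l x + 1) / 3 = ?d"
    using lx by (simp_all add: wt_Suc)
  have "load n q x + ?d \<le> 3 / 8 * real (c x)" using under w3 by linarith
  then have "node_potential (l x) (c x) (load n q x + ?d) =
    node_potential (l x) (c x) (load n q x) - growth (l x) * ?d"
    unfolding node_potential_def using wt_nonneg[of "l x"] by (simp add: max_def algebra_simps)
  then have "node_potential (l x) (c x) (load n q x + ?d) - node_potential (l x) (c x) (load n q x)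
    = - 1 / 3"
    using growth_wt[of "l x"] lx(2) by simp
  moreover have "node_potential (l y) (c y) (load n q y + ?d) \<le> node_potential (l y) (c y) (load n q y)"
    by (intro node_potential_antimono) (simp add: wt_nonneg)
  moreover have "edge_potential n (l x) - edge_potential n (q x y) = 1"
    using lx by (simp add: edge_potential_def)
  ultimately show "potential n c (set_edge q x y (l x)) l s' \<le> potential n c q l s + 3"
    unfolding potential_set_edge[where s = s and s' = s', OF xy ne sym] w
    using s by simp
qed

text \<open>An edge still at index \<open>l x + 1\<close> is held up by its other endpoint, so its
  index remains legal after the decrement. The 1 on the right is the price of the level
  term.\<close>

lemma lower_level:
  assumes wl: "well_leveled n q l" and x: "x < n" and lx: "0 < l x"
    and none: "\<And>y. y < n \<Longrightarrow> q x y = l x + 1 \<Longrightarrow> l x \<le> l y"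
    and under: "load n q x \<le> real (c x) / 3"
  shows "well_leveled n q (l(x := l x - 1))"
    and "potential n c q (l(x := l x - 1)) s + 4 * growth (l x) * real (c x) \<le> potential n c q l s + 1"
proof -
  obtain i where i: "l x = Suc i" using lx gr0_implies_Suc by blast
  show "well_leveled n q (l(x := l x - 1))"
  proof (rule well_leveled_set_level[OF wl x])
    fix y assume y: "y < n" "q x y \<noteq> 0"
    show "l x - 1 \<le> q x y \<and> q x y \<le> max (l x - 1) (l y) + 1"
      using well_leveledD(2,4)[OF wl x y(1)] y(2) none[OF y(1)] i
      by (cases "q x y = l x + 1") auto
  qed (use well_leveledD(5)[OF wl x x] in simp)
  \<comment> \<open>For \<open>i = 0\<close> the new growth factor is 0, and the inequality holds
    with room.\<close>
  have g: "growth i \<le> 3 / 4 * growth (l x)" by (simp add: i growth_def)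
  let ?X = "3 / 8 * real (c x) - load n q x"
  have X: "real (c x) / 24 \<le> ?X" using under by linarith
  have "growth (l x) * (real (c x) / 24) \<le> growth (l x) * ?X"
    by (intro mult_left_mono X growth_nonneg)
  moreover have "growth i * ?X \<le> 3 / 4 * growth (l x) * ?X"
    using g X by (intro mult_right_mono) auto
  moreover have "max 0 ?X = ?X" using X by simp
  ultimately show "potential n c q (l(x := l x - 1)) s + 4 * growth (l x) * real (c x) \<le> potential n c q l s + 1"
    unfolding potential_set_level[OF x] node_potential_def by (simp add: i)
qed

text \<open>The new edge takes the largest index allowed, hence the lightest weight. Additional load
  only decreases node potentials; the cost is the edge potential, at most \<open>top_level n\<close>
  for each of the two arcs, and two pushes.\<close>

lemma insert_edge:
  assumes wl: "well_leveled n q l" and xy: "x < n" "y < n" "x \<noteq> y" and q: "q x y = 0"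
  defines "j \<equiv> max (l x) (l y) + 1"
  shows "well_leveled n (set_edge q x y j) l"
    and "s' \<le> s + 2 \<Longrightarrow> potential n c (set_edge q x y j) l s' \<le> potential n c q l s
      + 130 * real (top_level n) + 2"
proof -
  have sym: "q x y = q y x" using well_leveledD[OF wl xy(1,2)] by simp
  show "well_leveled n (set_edge q x y j) l"
    by (intro well_leveled_set_edge wl xy) (auto simp: j_def)
  assume s: "s' \<le> s + 2"
  have "0 \<le> wt j - wt (q x y)" by (simp add: q wt_def)
  then have "node_potential i k (W + (wt j - wt (q x y))) \<le> node_potential i k W" for i k W
    by (intro node_potential_antimono) simp
  note this[of "l x" "c x" "load n q x"] this[of "l y" "c y" "load n q y"]
  moreover have "edge_potential n j - edge_potential n (q x y) \<le> real (top_level n)"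
    by (simp add: edge_potential_def q j_def)
  ultimately show "potential n c (set_edge q x y j) l s' \<le> potential n c q l s
      + 130 * real (top_level n) + 2"
    unfolding potential_set_edge[where s = s and s' = s', OF xy sym] using s by simp
qed

text \<open>An edge lies at least as high as its endpoints require, so losing it costs each endpoint
  at most \<open>4 / 3\<close>. Twice \<open>384 * 4 / 3\<close>, and two pushes, make 1026.\<close>

lemma delete_edge:
  assumes wl: "well_leveled n q l" and xy: "x < n" "y < n" "x \<noteq> y" and q: "q x y \<noteq> 0"
  shows "well_leveled n (set_edge q x y 0) l"
    and "s' \<le> s + 2 \<Longrightarrow> potential n c (set_edge q x y 0) l s' \<le> potential n c q l s + 1026"
proof -
  have sym: "q x y = q y x" and lev: "l x \<le> q x y" "l y \<le> q x y"
    and le: "q x y \<le> top_level n + 1"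
    using well_leveledD[OF wl xy(1,2)] q well_leveled_le[OF wl xy(1,2)] by auto
  show "well_leveled n (set_edge q x y 0) l"
    by (intro well_leveled_set_edge wl xy) auto
  assume s: "s' \<le> s + 2"
  have d: "wt 0 - wt (q x y) = - wt (q x y)" by (simp add: wt_def)
  have "node_potential i k (W - wt (q x y)) \<le> node_potential i k W + 4 / 3" if "i \<le> q x y" for i k W
  proof -
    have "growth i * wt (q x y) \<le> growth (q x y) * wt (q x y)"
      by (intro mult_right_mono growth_mono that wt_nonneg)
    then show ?thesis using growth_wt[of "q x y"] q node_potential_Lipschitz[OF wt_nonneg, of i k W "q x y"]
      by simp
  qed
  note this[OF lev(1), of "c x" "load n q x"] this[OF lev(2), of "c y" "load n q y"]
  moreover have "edge_potential n 0 - edge_potential n (q x y) \<le> 0"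
    using le by (simp add: edge_potential_def)
  ultimately show "potential n c (set_edge q x y 0) l s' \<le> potential n c q l s + 1026"
    unfolding potential_set_edge[where s = s and s' = s', OF xy sym] d using s by simp
qed

lemma potential_ge:
  assumes "well_leveled n q l"
  shows "- (\<Sum>x<n. real (l x)) \<le> potential n c q l s"
proof -
  have "0 \<le> edge_potential n (q x y)" if "x < n" "y < n" for x y
    using well_leveled_le[OF assms that] by (simp add: edge_potential_def)
  then have "0 \<le> (\<Sum>x<n. \<Sum>y<n. edge_potential n (q x y))" by (intro sum_nonneg) auto
  moreover have "0 \<le> (\<Sum>x<n. node_potential (l x) (c x) (load n q x))"
    by (intro sum_nonneg node_potential_nonneg)
  ultimately show ?thesis unfolding potential_def by simp
qed

section \<open>Neighbour lists and the stack\<close>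

lemma index_eq_iff:
  fixes x y x' y' n :: nat
  assumes "y < n" "y' < n"
  shows "x * n + y = x' * n + y' \<longleftrightarrow> x = x' \<and> y = y'"
proof
  assume eq: "x * n + y = x' * n + y'"
  have "(x * n + y) mod n = y" "(x' * n + y') mod n = y'" using assms by simp_all
  with eq have "y = y'" by metis
  with eq assms show "x = x' \<and> y = y'" by simp
qed simp

lemma index_less:
  fixes x y k n :: nat
  assumes "x < k" "y < n"
  shows "x * n + y < k * n"
proof -
  have "x * n + y < Suc x * n" using assms by simp
  also have "\<dots> \<le> k * n" using assms by (intro mult_le_mono1) simp
  finally show ?thesis .
qed

text \<open>Node \<open>x\<close> keeps its neighbours with edge index \<open>j\<close> in the cells
  \<open>(j * n + x) * n + i\<close> of \<open>a\<close>, for \<open>i < k (j * n + x)\<close>, and \<open>p (x * n + y)\<close> is the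
  position \<open>i\<close> of \<open>y\<close>.\<close>

definition lists_ok ::
    "nat \<Rightarrow> (nat \<Rightarrow> nat) \<Rightarrow> (nat \<Rightarrow> nat) \<Rightarrow> (nat \<Rightarrow> nat) \<Rightarrow> (nat \<Rightarrow> nat \<Rightarrow> nat) \<Rightarrow> bool" where
  "lists_ok n k a p q \<longleftrightarrow> (\<forall>x<n. k x = 0) \<and>
     (\<forall>x<n. \<forall>j. \<forall>i<k (j * n + x). a ((j * n + x) * n + i) < n \<and>
        q x (a ((j * n + x) * n + i)) = j \<and> p (x * n + a ((j * n + x) * n + i)) = i) \<and>
     (\<forall>x<n. \<forall>y<n. 0 < q x y \<longrightarrow>
        p (x * n + y) < k (q x y * n + x) \<and> a ((q x y * n + x) * n + p (x * n + y)) = y)"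

lemma lists_ok_elem:
  assumes "lists_ok n k a p q" "x < n" "i < k (j * n + x)"
  shows "a ((j * n + x) * n + i) < n" "q x (a ((j * n + x) * n + i)) = j"
    "p (x * n + a ((j * n + x) * n + i)) = i"
  using assms unfolding lists_ok_def by blast+

lemma lists_ok_pos:
  assumes "lists_ok n k a p q" "x < n" "y < n" "0 < q x y"
  shows "p (x * n + y) < k (q x y * n + x)" "a ((q x y * n + x) * n + p (x * n + y)) = y"
  using assms unfolding lists_ok_def by blast+

lemma lists_ok_card:
  assumes ok: "lists_ok n k a p q" and x: "x < n" and j: "0 < j"
  shows "k (j * n + x) = card {y. y < n \<and> q x y = j}"
proof -
  have "bij_betw (\<lambda>i. a ((j * n + x) * n + i)) {..<k (j * n + x)} {y. y < n \<and> q x y = j}"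
    by (rule bij_betw_byWitness[where f' = "\<lambda>y. p (x * n + y)"])
      (use lists_ok_elem[OF ok x] lists_ok_pos[OF ok x] j in auto)
  then show ?thesis by (simp add: bij_betw_same_card[symmetric])
qed

lemma lists_ok_count_le:
  assumes ok: "lists_ok n k a p q" and x: "x < n"
  shows "k (j * n + x) \<le> n"
proof (cases "j = 0")
  case True
  then show ?thesis using ok x by (simp add: lists_ok_def)
next
  case False
  have "card {y. y < n \<and> q x y = j} \<le> card {..<n}" by (intro card_mono) auto
  then show ?thesis using lists_ok_card[OF ok x, of j] False by simp
qed

text \<open>Deletion in constant time: the last entry \<open>z\<close> fills the gap. If
  \<open>z = y\<close> the copy changes nothing that matters, and the stale position of
  \<open>y\<close> is harmless because positions are constrained only for present arcs.\<close>

lemma lists_ok_remove: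
  assumes ok: "lists_ok n k a p q" and xy: "x < n" "y < n" and q: "0 < q x y"
  defines "J \<equiv> q x y * n + x"
  defines "z \<equiv> a (J * n + (k J - 1))"
  shows "lists_ok n (k(J := k J - 1)) (a(J * n + p (x * n + y) := z))
    (p(x * n + z := p (x * n + y))) (set_arc q x y 0)"
proof -
  let ?i = "p (x * n + y)"
  note pos = lists_ok_pos[OF ok xy q, folded J_def]
  have kn: "k (j * n + u) \<le> n" if "u < n" for j u using lists_ok_count_le[OF ok that] .
  have last: "k J - 1 < k J" using pos by simp
  have z: "z < n" "q x z = q x y" "p (x * n + z) = k J - 1"
    using lists_ok_elem[OF ok xy(1) last[unfolded J_def]] by (simp_all add: J_def z_def)
  have zy: "z = y \<longleftrightarrow> ?i = k J - 1" using z pos z_def by metis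
  have i_n: "?i < n" using pos(1) kn[OF xy(1), of "q x y"] J_def by simp
  have k': "(k(J := k J - 1)) (j * n + u) = (if j = q x y \<and> u = x then k J - 1 else k (j * n + u))"
    if "u < n" for j u using that xy by (simp add: J_def index_eq_iff)
  have a': "(a(J * n + ?i := z)) ((j * n + u) * n + i) =
      (if j = q x y \<and> u = x \<and> i = ?i then z else a ((j * n + u) * n + i))"
    if "u < n" "i < n" for j u i
    using that xy i_n by (simp add: J_def index_eq_iff)
  have p': "(p(x * n + z := ?i)) (u * n + v) = (if u = x \<and> v = z then ?i else p (u * n + v))"
    if "v < n" for u v using that z by (simp add: index_eq_iff)
  have q': "set_arc q x y 0 u v = (if u = x \<and> v = y then 0 else q u v)" for u v
    by (simp add: set_arc_def)
  show ?thesis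
    unfolding lists_ok_def
  proof (intro conjI allI impI)
    fix u assume "u < n"
    then show "(k(J := k J - 1)) u = 0" using k'[of u 0] q ok by (simp add: lists_ok_def)
  next
    fix u j i
    assume u: "u < n" and i: "i < (k(J := k J - 1)) (j * n + u)"
    then have ik: "i < k (j * n + u)" using k'[OF u, of j] J_def by (auto split: if_splits)
    then have i_less: "i < n" using kn[OF u, of j] by simp
    let ?w = "a ((j * n + u) * n + i)"
    note e = lists_ok_elem[OF ok u ik]
    have *: "(a(J * n + ?i := z)) ((j * n + u) * n + i) < n \<and>
      set_arc q x y 0 u ((a(J * n + ?i := z)) ((j * n + u) * n + i)) = j \<and>
      (p(x * n + z := ?i)) (u * n + (a(J * n + ?i := z)) ((j * n + u) * n + i)) = i"
    proof (cases "j = q x y \<and> u = x")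
      case True
      then have i': "i < k J - 1" using i k'[OF u, of j] by simp
      show ?thesis
      proof (cases "i = ?i")
        case True
        then show ?thesis using \<open>j = q x y \<and> u = x\<close> i' z zy xy
          by (simp add: a' i_n p' q' del: fun_upd_apply One_nat_def)
      next
        case False
        have "?w \<noteq> y" "?w \<noteq> z" using False e z i' \<open>j = q x y \<and> u = x\<close> by auto
        then show ?thesis using False e by (simp add: a'[OF u i_less] p' q' del: fun_upd_apply One_nat_def)
      qed
    next
      case False
      then have "\<not> (u = x \<and> ?w = y)" "\<not> (u = x \<and> ?w = z)" using e z by auto
      then show ?thesis using False e
        by (cases "u = x") (auto simp: a' u xy i_less p' q' simp del: fun_upd_apply One_nat_def)
    qed
    from * show "(a(J * n + ?i := z)) ((j * n + u) * n + i) < n" by blast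
    from * show "set_arc q x y 0 u ((a(J * n + ?i := z)) ((j * n + u) * n + i)) = j" by blast
    from * show "(p(x * n + z := ?i)) (u * n + (a(J * n + ?i := z)) ((j * n + u) * n + i)) = i" by blast
  next
    fix u v assume uv: "u < n" "v < n" and q0: "0 < set_arc q x y 0 u v"
    then have ne: "\<not> (u = x \<and> v = y)" and qv: "set_arc q x y 0 u v = q u v" "0 < q u v"
      by (auto simp: q' split: if_splits)
    note e = lists_ok_pos[OF ok uv qv(2)]
    have pn: "p (u * n + v) < n" using e(1) kn[OF uv(1), of "q u v"] by simp
    have *: "(p(x * n + z := ?i)) (u * n + v) < (k(J := k J - 1)) (q u v * n + u) \<and>
      (a(J * n + ?i := z)) ((q u v * n + u) * n + (p(x * n + z := ?i)) (u * n + v)) = v"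
    proof (cases "u = x \<and> v = z")
      case True
      then have "?i \<noteq> k J - 1" using ne zy by auto
      then show ?thesis using True z pos i_n xy by (simp add: k' p' a' del: fun_upd_apply One_nat_def)
    next
      case F: False
      show ?thesis
      proof (cases "q u v = q x y \<and> u = x")
        case True
        then have "p (x * n + v) \<noteq> k J - 1" "p (x * n + v) \<noteq> ?i" 
          using F ne e pos uv z_def J_def by auto
        moreover have "p (x * n + v) < k J" using e(1) True J_def by metis
        ultimately have "p (x * n + v) < k J - 1" by linarith
        then show ?thesis using True F e uv pn \<open>p (x * n + v) \<noteq> ?i\<close>
          by (simp add: k' p' a' del: fun_upd_apply One_nat_def)
      next
        case False
        then show ?thesis using F e uv pn
          by (cases "u = x") (auto simp: k' p' a' simp del: fun_upd_apply One_nat_def)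
      qed
    qed
    from * show "(p(x * n + z := ?i)) (u * n + v) < (k(J := k J - 1)) (set_arc q x y 0 u v * n + u)"
      unfolding qv by blast
    from * show "(a(J * n + ?i := z)) ((set_arc q x y 0 u v * n + u) * n + (p(x * n + z := ?i)) (u * n + v)) = v"
      unfolding qv by blast
  qed
qed

text \<open>Since \<open>y\<close> is absent from the list, fewer than \<open>n\<close> entries are
  in use and the new one stays inside the block reserved for this node and index.\<close>

lemma lists_ok_add:
  assumes ok: "lists_ok n k a p q" and xy: "x < n" "y < n" and q: "q x y = 0" and j: "0 < j"
  defines "J \<equiv> j * n + x"
  shows "k J < n"
    and "lists_ok n (k(J := Suc (k J))) (a(J * n + k J := y)) (p(x * n + y := k J)) (set_arc q x y j)"
proof -
  have "{v. v < n \<and> q x v = j} \<subseteq> {..<n} - {y}" using q j by auto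
  then have "card {v. v < n \<and> q x v = j} \<le> card ({..<n} - {y})" by (intro card_mono) auto
  then show less: "k J < n" using lists_ok_card[OF ok xy(1) j] xy(2) J_def by simp
  have kn: "k (j * n + u) \<le> n" if "u < n" for j u using lists_ok_count_le[OF ok that] .
  have k': "(k(J := Suc (k J))) (h * n + u) = (if h = j \<and> u = x then Suc (k J) else k (h * n + u))"
    if "u < n" for h u using that xy by (simp add: J_def index_eq_iff)
  have a': "(a(J * n + k J := y)) ((h * n + u) * n + i) =
      (if h = j \<and> u = x \<and> i = k J then y else a ((h * n + u) * n + i))"
    if "u < n" "i < n" for h u i
    using that xy less by (simp add: J_def index_eq_iff)
  have p': "(p(x * n + y := k J)) (u * n + v) = (if u = x \<and> v = y then k J else p (u * n + v))"
    if "v < n" for u v using that xy by (simp add: index_eq_iff)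
  have q': "set_arc q x y j u v = (if u = x \<and> v = y then j else q u v)" for u v
    by (simp add: set_arc_def)
  show "lists_ok n (k(J := Suc (k J))) (a(J * n + k J := y)) (p(x * n + y := k J)) (set_arc q x y j)"
    unfolding lists_ok_def
  proof (intro conjI allI impI)
    fix u assume "u < n"
    then show "(k(J := Suc (k J))) u = 0" using k'[of u 0] j ok by (simp add: lists_ok_def)
  next
    fix u h i
    assume u: "u < n" and i: "i < (k(J := Suc (k J))) (h * n + u)"
    have i_less: "i < n" using i kn[OF u, of h] less by (auto simp: k'[OF u] simp del: fun_upd_apply One_nat_def split: if_splits)
    have *: "(a(J * n + k J := y)) ((h * n + u) * n + i) < n \<and>
      set_arc q x y j u ((a(J * n + k J := y)) ((h * n + u) * n + i)) = h \<and>
      (p(x * n + y := k J)) (u * n + (a(J * n + k J := y)) ((h * n + u) * n + i)) = i"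
    proof (cases "h = j \<and> u = x \<and> i = k J")
      case True
      then show ?thesis using xy less by (simp add: a' p' q' del: fun_upd_apply One_nat_def)
    next
      case False
      then have ik: "i < k (h * n + u)" using i
        by (auto simp: k'[OF u] simp del: fun_upd_apply One_nat_def split: if_splits) (simp add: J_def)
      note e = lists_ok_elem[OF ok u ik]
      \<comment> \<open>Lists of index 0 are empty, so a listed neighbour has a positive index and
        differs from \<open>y\<close>.\<close>
      have "h \<noteq> 0" using ik u ok unfolding lists_ok_def by (cases h) auto
      then have "\<not> (u = x \<and> a ((h * n + u) * n + i) = y)" using e q by auto
      then show ?thesis using False e by (auto simp: a'[OF u i_less] p' q' simp del: fun_upd_apply One_nat_def)
    qed
    from * show "(a(J * n + k J := y)) ((h * n + u) * n + i) < n" by blast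
    from * show "set_arc q x y j u ((a(J * n + k J := y)) ((h * n + u) * n + i)) = h" by blast
    from * show "(p(x * n + y := k J)) (u * n + (a(J * n + k J := y)) ((h * n + u) * n + i)) = i" by blast
  next
    fix u v assume uv: "u < n" "v < n" and q0: "0 < set_arc q x y j u v"
    have *: "(p(x * n + y := k J)) (u * n + v) < (k(J := Suc (k J))) (set_arc q x y j u v * n + u) \<and>
      (a(J * n + k J := y)) ((set_arc q x y j u v * n + u) * n + (p(x * n + y := k J)) (u * n + v)) = v"
    proof (cases "u = x \<and> v = y")
      case True
      then show ?thesis using xy less by (simp add: q' k' p' a' del: fun_upd_apply One_nat_def)
    next
      case False
      then have qv: "set_arc q x y j u v = q u v" "0 < q u v" using q0 by (auto simp: q' split: if_splits)
      note e = lists_ok_pos[OF ok uv qv(2)]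
      have pn: "p (u * n + v) < n" using e(1) kn[OF uv(1), of "q u v"] by simp
      have "p (u * n + v) < k J" if "q u v = j" "u = x" using e that J_def by simp
      then show ?thesis using False e uv pn unfolding qv(1)
        by (auto simp: k' p' a' simp del: fun_upd_apply One_nat_def)
    qed
    from * show "(p(x * n + y := k J)) (u * n + v) < (k(J := Suc (k J))) (set_arc q x y j u v * n + u)" by blast
    from * show "(a(J * n + k J := y)) ((set_arc q x y j u v * n + u) * n + (p(x * n + y := k J)) (u * n + v)) = v" by blast
  qed
qed

text \<open>Bijectivity excludes duplicates, so the height never exceeds \<open>n\<close> and stays
  within the word bound.\<close>

definition stack_ok :: "nat \<Rightarrow> (nat \<Rightarrow> nat) \<Rightarrow> nat \<Rightarrow> (nat \<Rightarrow> nat) \<Rightarrow> bool" where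
  "stack_ok n s h f \<longleftrightarrow> bij_betw s {..<h} {v. v < n \<and> f v \<noteq> 0}"

lemma stack_ok_push:
  assumes ok: "stack_ok n s h f" and x: "x < n" "f x = 0"
  shows "h < n" and "stack_ok n (s(h := x)) (h + 1) (f(x := 1))"
proof -
  have "card {..<h} = card {v. v < n \<and> f v \<noteq> 0}"
    using ok unfolding stack_ok_def by (rule bij_betw_same_card)
  moreover have "card {v. v < n \<and> f v \<noteq> 0} \<le> card ({..<n} - {x})" using x by (intro card_mono) auto
  ultimately show "h < n" using x by simp
  have "bij_betw (s(h := x)) {..<h} {v. v < n \<and> f v \<noteq> 0}"
    using ok unfolding stack_ok_def by (subst bij_betw_cong[of _ _ s]) auto
  then have "bij_betw (s(h := x)) ({..<h} \<union> {h}) ({v. v < n \<and> f v \<noteq> 0} \<union> {(s(h := x)) h})"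
    using x by (intro notIn_Un_bij_betw) auto
  moreover have "{..<h} \<union> {h} = {..<h + 1}" by auto
  moreover have "{v. v < n \<and> f v \<noteq> 0} \<union> {(s(h := x)) h} = {v. v < n \<and> (f(x := 1)) v \<noteq> 0}"
    using x by auto
  ultimately show "stack_ok n (s(h := x)) (h + 1) (f(x := 1))"
    unfolding stack_ok_def by metis
qed

lemma stack_ok_top:
  assumes "stack_ok n s h f" "h \<noteq> 0"
  shows "s (h - 1) < n" "f (s (h - 1)) \<noteq> 0"
  using bij_betwE[OF assms(1)[unfolded stack_ok_def]] assms(2) by auto

lemma stack_ok_pop:
  assumes ok: "stack_ok n s h f" and h: "h \<noteq> 0"
  shows "stack_ok n s (h - 1) (f(s (h - 1) := 0))"
proof -
  have "bij_betw s ({..<h} - {h - 1}) ({v. v < n \<and> f v \<noteq> 0} - {s (h - 1)})"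
    using ok h unfolding stack_ok_def
    by (intro bij_betw_DiffI) (auto simp: bij_betw_def)
  moreover have "{..<h} - {h - 1} = {..<h - 1}" using h by auto
  moreover have "{v. v < n \<and> f v \<noteq> 0} - {s (h - 1)} = {v. v < n \<and> (f(s (h - 1) := 0)) v \<noteq> 0}" by auto
  ultimately show ?thesis unfolding stack_ok_def by metis
qed

section \<open>Primitive operations\<close>

abbreviation var :: "string \<Rightarrow> expr" where "var a \<equiv> Read a (Const 0)"
abbreviation assign :: "string \<Rightarrow> expr \<Rightarrow> com" where "assign a e \<equiv> Write a (Const 0) e"
abbreviation add_expr :: "expr \<Rightarrow> expr \<Rightarrow> expr" (infixl \<open>[+]\<close> 65) where "e [+] e' \<equiv> Bin Plus e e'"
abbreviation sub_expr :: "expr \<Rightarrow> expr \<Rightarrow> expr" (infixl \<open>[-]\<close> 65) where "e [-] e' \<equiv> Bin Minus e e'"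
abbreviation mul_expr :: "expr \<Rightarrow> expr \<Rightarrow> expr" (infixl \<open>[*]\<close> 70) where "e [*] e' \<equiv> Bin Times e e'"
abbreviation less_expr :: "expr \<Rightarrow> expr \<Rightarrow> expr" (infix \<open>[<]\<close> 50) where "e [<] e' \<equiv> Bin Less e e'"
abbreviation seq_com :: "com \<Rightarrow> com \<Rightarrow> com" (infixr \<open>;;\<close> 40) where "p ;; q \<equiv> Seq p q"

text \<open>
  Arrays: \<open>q\<close> edge indices (by ordered pair), \<open>l\<close> node levels, \<open>W\<close> scaled loads, \<open>k\<close>, \<open>a\<close>, \<open>p\<close> the
  neighbour lists, \<open>s\<close> the stack of nodes to be examined with height \<open>S\<close> and membership flags
  \<open>f\<close>, \<open>t\<close> the scaled weight of each index, \<open>D\<close> the scaled weight 1.  The entry \<open>u * n + v\<close> of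
  \<open>num\<close> and \<open>den\<close> is kept for both orders of the endpoints.
\<close>

definition push :: "string \<Rightarrow> com" where
  "push X = Cond (Read ''f'' (var X)) Skip
     (Write ''s'' (var ''S'') (var X) ;;
      assign ''S'' (var ''S'' [+] Const 1) ;;
      Write ''f'' (var X) (Const 1))"

text \<open>The order matters: the count is decreased first, so that it addresses the last entry,
  and the index is cleared only after the list and the load have been adjusted with its old
  value.\<close>

definition remove_arc :: "string \<Rightarrow> string \<Rightarrow> com" where
  "remove_arc X Y =
     (assign ''i'' (var X [*] var ''n'' [+] var Y) ;;
      assign ''j'' (Read ''q'' (var ''i'') [*] var ''n'' [+] var X) ;;
      Write ''k'' (var ''j'') (Read ''k'' (var ''j'') [-] Const 1) ;;
      assign ''z'' (Read ''a'' (var ''j'' [*] var ''n'' [+] Read ''k'' (var ''j''))) ;;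
      Write ''a'' (var ''j'' [*] var ''n'' [+] Read ''p'' (var ''i'')) (var ''z'') ;;
      Write ''p'' (var X [*] var ''n'' [+] var ''z'') (Read ''p'' (var ''i'')) ;;
      Write ''W'' (var X) (Read ''W'' (var X) [-] Read ''t'' (Read ''q'' (var ''i''))) ;;
      Write ''q'' (var ''i'') (Const 0) ;;
      push X)"

definition add_arc :: "string \<Rightarrow> string \<Rightarrow> com" where
  "add_arc X Y =
     (assign ''i'' (var X [*] var ''n'' [+] var Y) ;;
      assign ''j'' (var ''h'' [*] var ''n'' [+] var X) ;;
      Write ''a'' (var ''j'' [*] var ''n'' [+] Read ''k'' (var ''j'')) (var Y) ;;
      Write ''p'' (var ''i'') (Read ''k'' (var ''j'')) ;;
      Write ''k'' (var ''j'') (Read ''k'' (var ''j'') [+] Const 1) ;;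
      Write ''q'' (var ''i'') (var ''h'') ;;
      Write ''num'' (var ''i'') (Read ''t'' (var ''h'')) ;;
      Write ''den'' (var ''i'') (var ''D'') ;;
      Write ''W'' (var X) (Read ''W'' (var X) [+] Read ''t'' (var ''h'')) ;;
      push X)"

definition arc_footprint :: "string list" where
  "arc_footprint = [''i'', ''j'', ''z'', ''k'', ''a'', ''p'', ''W'', ''q'', ''num'', ''den'', ''s'', ''S'', ''f'']"

text \<open>Pairs outside the node range are cut off, because the address \<open>x * n + y\<close>
  is injective only for \<open>y < n\<close>.\<close>

definition arcs :: "nat \<Rightarrow> memory \<Rightarrow> nat \<Rightarrow> nat \<Rightarrow> nat" where
  "arcs n m x y = (if x < n \<and> y < n then m ''q'' (x * n + y) else 0)"

text \<open>The last clause is the reason for the stack: a node may violate its balance only while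
  it is flagged. Numerators and denominators are constrained at present edges only, so deletions
  leave them as they are.\<close>

definition represents :: "nat \<Rightarrow> (nat \<Rightarrow> nat) \<Rightarrow> memory \<Rightarrow> bool" where
  "represents n c m \<longleftrightarrow>
     m ''n'' 0 = n \<and> (\<forall>x<n. m ''c'' x = c x) \<and>
     lists_ok n (m ''k'') (m ''a'') (m ''p'') (arcs n m) \<and>
     (\<forall>x<n. m ''W'' x = (\<Sum>y<n. scaled_weight n (arcs n m x y))) \<and>
     (\<forall>x<n. \<forall>y<n. arcs n m x y \<noteq> 0 \<longrightarrow>
        m ''num'' (x * n + y) = scaled_weight n (arcs n m x y) \<and>
        m ''den'' (x * n + y) = unit_weight n) \<and>
     (\<forall>x<n. \<forall>y<n. arcs n m x y \<le> top_level n + 1) \<and>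
     (\<forall>x<n. m ''l'' x \<le> top_level n) \<and>
     stack_ok n (m ''s'') (m ''S'' 0) (m ''f'') \<and>
     (\<forall>x<n. m ''f'' x = 0 \<longrightarrow> calm (c x) (load n (arcs n m) x) (m ''l'' x))"

text \<open>Kept apart from \<open>represents\<close> because the tables are rebuilt at every
  update: the initial memory lacks them, and nothing relies on them between updates.\<close>

definition tables :: "nat \<Rightarrow> memory \<Rightarrow> bool" where
  "tables n m \<longleftrightarrow> m ''D'' 0 = unit_weight n \<and>
     (\<forall>q. 1 \<le> q \<and> q \<le> top_level n + 1 \<longrightarrow> m ''t'' q = scaled_weight n q)"

lemma representsD:
  assumes "represents n c m"
  shows "m ''n'' 0 = n" "\<And>x. x < n \<Longrightarrow> m ''c'' x = c x"
    "lists_ok n (m ''k'') (m ''a'') (m ''p'') (arcs n m)"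
    "\<And>x. x < n \<Longrightarrow> m ''W'' x = (\<Sum>y<n. scaled_weight n (arcs n m x y))"
    "\<And>x y. x < n \<Longrightarrow> y < n \<Longrightarrow> arcs n m x y \<noteq> 0 \<Longrightarrow>
        m ''num'' (x * n + y) = scaled_weight n (arcs n m x y)"
    "\<And>x y. x < n \<Longrightarrow> y < n \<Longrightarrow> arcs n m x y \<noteq> 0 \<Longrightarrow> m ''den'' (x * n + y) = unit_weight n"
    "\<And>x y. x < n \<Longrightarrow> y < n \<Longrightarrow> arcs n m x y \<le> top_level n + 1"
    "\<And>x. x < n \<Longrightarrow> m ''l'' x \<le> top_level n"
    "stack_ok n (m ''s'') (m ''S'' 0) (m ''f'')"
    "\<And>x. x < n \<Longrightarrow> m ''f'' x = 0 \<Longrightarrow> calm (c x) (load n (arcs n m) x) (m ''l'' x)"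
  using assms unfolding represents_def by blast+

lemma arcs_update:
  assumes "x < n" "y < n" "m' ''q'' = (m ''q'')(x * n + y := j)"
  shows "arcs n m' = set_arc (arcs n m) x y j"
  using assms by (auto simp: fun_eq_iff arcs_def set_arc_def index_eq_iff)

text \<open>Stated additively, since the loads are natural numbers and subtraction would be
  truncated.\<close>

lemma sum_scaled_weight_set_arc:
  assumes "x < n" "y < n"
  shows "(\<Sum>v<n. scaled_weight n (set_arc q x y j u v)) + (if u = x then scaled_weight n (q x y) else 0) =
    (\<Sum>v<n. scaled_weight n (q u v)) + (if u = x then scaled_weight n j else 0)"
proof -
  have "real ((\<Sum>v<n. scaled_weight n (set_arc q x y j u v)) + (if u = x then scaled_weight n (q x y) else 0)) =
    real ((\<Sum>v<n. scaled_weight n (q u v)) + (if u = x then scaled_weight n j else 0))"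
    using sum_fun_upd[OF assms(2), of "\<lambda>i. real (scaled_weight n i)" "q x" j] by (simp add: set_arc_def)
  then show ?thesis using of_nat_eq_iff by blast
qed

text \<open>The three bounds cover list numbers and levels, loads, and the doubling variable of the
  table construction. Addresses into the neighbour lists occur only inside expressions and are never
  stored, so they may exceed \<open>R\<close>.\<close>

locale matching_ram = word_ram b R for b R +
  fixes n :: nat and c :: "nat \<Rightarrow> nat"
  assumes cap: "\<And>v. v < n \<Longrightarrow> 1 \<le> c v"
    and small: "(top_level n + 2) * (n + 1) < R" "unit_weight n * (n + 1) < R" "2 ^ log_bound n < R"
begin

lemma index_fits:
  assumes "i \<le> top_level n + 1" "x < n"
  shows "i * n + x < R"
proof -
  have "i * n + x < (top_level n + 2) * n" using assms by (intro index_less) auto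
  also have "\<dots> \<le> (top_level n + 2) * (n + 1)" by simp
  finally show ?thesis using small(1) by simp
qed

lemma pair_fits:
  assumes "x < n" "y < n"
  shows "x * n + y < R"
proof -
  have 1: "x * n + y < n * n" using assms by (intro index_less)
  have "n \<le> unit_weight n"
  proof -
    have "n \<le> 2 ^ log_bound n" using log_bound_ge[of n] by simp
    also have "\<dots> \<le> 64 ^ log_bound n" by (intro power_mono) auto
    finally show ?thesis by (simp add: unit_weight_def)
  qed
  then have "n * n \<le> unit_weight n * (n + 1)" by (intro mult_le_mono) auto
  then show ?thesis using 1 small(2) by linarith
qed

lemma n_fits: "n < R"
proof -
  have "n < 1 * (n + 1)" by simp
  also have "\<dots> \<le> (top_level n + 2) * (n + 1)" by (intro mult_le_mono1) simp
  finally show ?thesis using small by linarith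
qed

lemma load_eq:
  assumes "represents n c m" "x < n"
  shows "real (m ''W'' x) = real (unit_weight n) * load n (arcs n m) x"
proof -
  have "real (m ''W'' x) = (\<Sum>y<n. real (unit_weight n) * wt (arcs n m x y))"
    using representsD(4)[OF assms] representsD(7)[OF assms]
    by (auto simp: scaled_weight_eq intro!: sum.cong)
  then show ?thesis by (simp add: load_def sum_distrib_left)
qed

definition arc_post :: "memory \<Rightarrow> nat \<Rightarrow> nat \<Rightarrow> nat \<Rightarrow> memory \<Rightarrow> bool" where
  "arc_post m x y j m' \<longleftrightarrow> represents n c m' \<and> tables n m' \<and>
     arcs n m' = set_arc (arcs n m) x y j \<and> (\<forall>A. A \<notin> set arc_footprint \<longrightarrow> m' A = m A) \<and>
     m' ''S'' 0 = m ''S'' 0 + (if m ''f'' x = 0 then 1 else 0) \<and>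
     (\<forall>v. m' ''f'' v = (if v = x \<and> m ''f'' x = 0 then 1 else m ''f'' v))"

text \<open>The effect on positions is part of the conclusion because the later scan must know that
  no neighbour but the former last one has been moved.\<close>

lemma remove_arc_ok:
  assumes m: "bounded R m" "represents n c m" "tables n m"
    and xy: "m X 0 = x" "m Y 0 = y" "x < n" "y < n" "X \<notin> set arc_footprint" "Y \<notin> set arc_footprint"
    and q: "arcs n m x y \<noteq> 0"
  defines "J \<equiv> arcs n m x y * n + x"
  shows "ok (remove_arc X Y) m (\<lambda>t m'. t \<le> 100 \<and> arc_post m x y 0 m' \<and>
    m' ''p'' = (m ''p'')(x * n + m ''a'' (J * n + (m ''k'' J - 1)) := m ''p'' (x * n + y)))"
proof -
  note rep = representsD[OF m(2)]
  have qm: "m ''q'' (x * n + y) = arcs n m x y" using xy by (simp add: arcs_def)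
  have fit: "x * n + y < R" "J < R" unfolding J_def
    using xy rep(7)[of x y] by (auto intro: pair_fits index_fits)
  have nX: "X \<noteq> ''i''" "X \<noteq> ''j''" "X \<noteq> ''z''" "X \<noteq> ''k''" "X \<noteq> ''a''" "X \<noteq> ''p''" "X \<noteq> ''W''" "X \<noteq> ''q''"
    "X \<noteq> ''s''" "X \<noteq> ''S''" "X \<noteq> ''f''" "Y \<noteq> ''i''"
    using xy by (auto simp: arc_footprint_def)
  let ?p = "remove_arc X Y" and ?z = "m ''a'' (J * n + (m ''k'' J - 1))"
  define m' where "m' = result ?p m"
  have fS: "Suc (m ''S'' 0) < R" if "m ''f'' x = 0"
    using stack_ok_push[OF rep(9) xy(3) that] n_fits by simp
  have "fits R ?p m"
    using fit nX xy rep(1) qm fS n_fits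
    by (simp add: remove_arc_def push_def put_def J_def)
  moreover have "straight ?p" by (simp add: remove_arc_def push_def)
  moreover have "max_time ?p \<le> 100" by (simp add: remove_arc_def push_def)
  ultimately have ex: "ok ?p m (\<lambda>t m2. t \<le> 100 \<and> m2 = m')"
    using ok_straight[OF _ m(1), of ?p] unfolding m'_def by (auto elim!: ok_weaken)
  have frame: "m' A = m A" if "A \<notin> set arc_footprint" for A
    using that unfolding m'_def
    by (intro result_frame) (auto simp: remove_arc_def push_def arc_footprint_def)
  have k: "m' ''k'' = (m ''k'')(J := m ''k'' J - 1)"
    and a: "m' ''a'' = (m ''a'')(J * n + m ''p'' (x * n + y) := ?z)"
    and p: "m' ''p'' = (m ''p'')(x * n + ?z := m ''p'' (x * n + y))"
    and W: "m' ''W'' = (m ''W'')(x := m ''W'' x - m ''t'' (arcs n m x y))"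
    and qq: "m' ''q'' = (m ''q'')(x * n + y := 0)"
    and nd: "m' ''num'' = m ''num''" "m' ''den'' = m ''den''"
    and st: "m' ''s'' = (if m ''f'' x = 0 then (m ''s'')(m ''S'' 0 := x) else m ''s'')"
      "m' ''S'' 0 = (if m ''f'' x = 0 then m ''S'' 0 + 1 else m ''S'' 0)"
      "m' ''f'' = (if m ''f'' x = 0 then (m ''f'')(x := 1) else m ''f'')"
    using nX xy(1,2) rep(1) qm unfolding m'_def J_def
    by (simp_all add: remove_arc_def push_def put_def)
  have arcs: "arcs n m' = set_arc (arcs n m) x y 0" using xy(3,4) qq by (rule arcs_update)
  have t: "m ''t'' (arcs n m x y) = scaled_weight n (arcs n m x y)"
    using m(3) q rep(7)[OF xy(3,4)] by (simp add: tables_def)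
  have rep': "represents n c m'"
    unfolding represents_def arcs
  proof (intro conjI)
    show "m' ''n'' 0 = n" "\<forall>x<n. m' ''c'' x = c x" "\<forall>x<n. m' ''l'' x \<le> top_level n"
      using rep(1,2,8) by (simp_all add: frame arc_footprint_def)
    show "lists_ok n (m' ''k'') (m' ''a'') (m' ''p'') (set_arc (arcs n m) x y 0)"
      unfolding k a p J_def using lists_ok_remove[OF rep(3) xy(3,4)] q by simp
    show "\<forall>u<n. m' ''W'' u = (\<Sum>v<n. scaled_weight n (set_arc (arcs n m) x y 0 u v))"
    proof (intro allI impI)
      fix u assume "u < n"
      then show "m' ''W'' u = (\<Sum>v<n. scaled_weight n (set_arc (arcs n m) x y 0 u v))"
        using sum_scaled_weight_set_arc[OF xy(3,4), of "arcs n m" 0 u] rep(4)[of u]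
        by (auto simp: W t scaled_weight_def[of n 0])
    qed
    show "\<forall>u<n. \<forall>v<n. set_arc (arcs n m) x y 0 u v \<noteq> 0 \<longrightarrow>
        m' ''num'' (u * n + v) = scaled_weight n (set_arc (arcs n m) x y 0 u v) \<and>
        m' ''den'' (u * n + v) = unit_weight n"
      using rep(5,6) by (auto simp: nd set_arc_def)
    show "\<forall>u<n. \<forall>v<n. set_arc (arcs n m) x y 0 u v \<le> top_level n + 1"
      using rep(7) by (auto simp: set_arc_def)
    show "stack_ok n (m' ''s'') (m' ''S'' 0) (m' ''f'')"
      using stack_ok_push[OF rep(9) xy(3)] rep(9) by (auto simp: st)
    show "\<forall>u<n. m' ''f'' u = 0 \<longrightarrow> calm (c u) (load n (set_arc (arcs n m) x y 0) u) (m' ''l'' u)"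
      using rep(10) xy by (auto simp: st(3) load_set_arc frame arc_footprint_def split: if_splits)
  qed
  have "tables n m'" using m(3) by (simp add: tables_def frame arc_footprint_def)
  then have "arc_post m x y 0 m'"
    using rep' arcs frame st(2,3) unfolding arc_post_def by auto
  then show ?thesis using ex p by (auto elim!: ok_weaken)
qed

lemma add_arc_ok:
  assumes m: "bounded R m" "represents n c m" "tables n m"
    and xy: "m X 0 = x" "m Y 0 = y" "x < n" "y < n" "X \<notin> set arc_footprint" "Y \<notin> set arc_footprint"
    and q: "arcs n m x y = 0" and h: "m ''h'' 0 = j" "1 \<le> j" "j \<le> top_level n + 1"
  shows "ok (add_arc X Y) m (\<lambda>t m'. t \<le> 100 \<and> arc_post m x y j m' \<and>
    (\<exists>i. m' ''p'' = (m ''p'')(x * n + y := i)))"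
proof -
  note rep = representsD[OF m(2)]
  define J where "J = j * n + x"
  have fit: "x * n + y < R" "J < R" unfolding J_def
    using xy h by (auto intro: pair_fits index_fits)
  have nX: "X \<noteq> ''i''" "X \<noteq> ''j''" "X \<noteq> ''z''" "X \<noteq> ''k''" "X \<noteq> ''a''" "X \<noteq> ''p''" "X \<noteq> ''W''" "X \<noteq> ''q''"
    "X \<noteq> ''s''" "X \<noteq> ''S''" "X \<noteq> ''f''" "X \<noteq> ''num''" "X \<noteq> ''den''" "Y \<noteq> ''i''" "Y \<noteq> ''j''"
    using xy by (auto simp: arc_footprint_def)
  let ?p = "add_arc X Y"
  define m' where "m' = result ?p m"
  have fS: "Suc (m ''S'' 0) < R" if "m ''f'' x = 0"
    using stack_ok_push[OF rep(9) xy(3) that] n_fits by simp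
  have add: "m ''k'' J < n"
    "lists_ok n ((m ''k'')(J := Suc (m ''k'' J))) ((m ''a'')(J * n + m ''k'' J := y))
      ((m ''p'')(x * n + y := m ''k'' J)) (set_arc (arcs n m) x y j)"
    using lists_ok_add[OF rep(3) xy(3,4) q, of j] h unfolding J_def by auto
  have t: "m ''t'' j = scaled_weight n j"
    using m(3) h by (simp add: tables_def)
  have W_sum: "(\<Sum>v<n. scaled_weight n (set_arc (arcs n m) x y j u v)) =
    (if u = x then m ''W'' x + scaled_weight n j else m ''W'' u)" if "u < n" for u
    using sum_scaled_weight_set_arc[OF xy(3,4), of "arcs n m" j u] rep(4)[OF that] q
    by (auto simp: scaled_weight_def[of n 0])
  have le: "set_arc (arcs n m) x y j u v \<le> top_level n + 1" if "u < n" "v < n" for u v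
    using rep(7)[OF that] h by (auto simp: set_arc_def)
  \<comment> \<open>The enlarged load is again a sum of \<open>n\<close> summands of at most one
    unit each, which excludes overflow.\<close>
  have "m ''W'' x + scaled_weight n j \<le> (\<Sum>v<n. unit_weight n)"
    unfolding W_sum[OF xy(3), simplified, symmetric]
    by (intro sum_mono scaled_weight_le le xy) simp
  then have fW: "m ''W'' x + scaled_weight n j < R" using small(2) by (simp add: mult.commute)
  have "fits R ?p m"
    using fit nX xy rep(1) h fS n_fits add(1) fW t
    by (simp add: add_arc_def push_def put_def J_def)
  moreover have "straight ?p" by (simp add: add_arc_def push_def)
  moreover have "max_time ?p \<le> 100" by (simp add: add_arc_def push_def)
  ultimately have ex: "ok ?p m (\<lambda>t m2. t \<le> 100 \<and> m2 = m')"
    using ok_straight[OF _ m(1), of ?p] unfolding m'_def by (auto elim!: ok_weaken)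
  have frame: "m' A = m A" if "A \<notin> set arc_footprint" for A
    using that unfolding m'_def
    by (intro result_frame) (auto simp: add_arc_def push_def arc_footprint_def)
  have k: "m' ''k'' = (m ''k'')(J := Suc (m ''k'' J))"
    and a: "m' ''a'' = (m ''a'')(J * n + m ''k'' J := y)"
    and p: "m' ''p'' = (m ''p'')(x * n + y := m ''k'' J)"
    and W: "m' ''W'' = (m ''W'')(x := m ''W'' x + m ''t'' j)"
    and qq: "m' ''q'' = (m ''q'')(x * n + y := j)"
    and nd: "m' ''num'' = (m ''num'')(x * n + y := m ''t'' j)"
      "m' ''den'' = (m ''den'')(x * n + y := m ''D'' 0)"
    and st: "m' ''s'' = (if m ''f'' x = 0 then (m ''s'')(m ''S'' 0 := x) else m ''s'')"
      "m' ''S'' 0 = (if m ''f'' x = 0 then m ''S'' 0 + 1 else m ''S'' 0)"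
      "m' ''f'' = (if m ''f'' x = 0 then (m ''f'')(x := 1) else m ''f'')"
    using nX xy(1,2) rep(1) h(1) unfolding m'_def J_def
    by (simp_all add: add_arc_def push_def put_def)
  have arcs: "arcs n m' = set_arc (arcs n m) x y j" using xy(3,4) qq by (rule arcs_update)
  have rep': "represents n c m'"
    unfolding represents_def arcs
  proof (intro conjI)
    show "m' ''n'' 0 = n" "\<forall>x<n. m' ''c'' x = c x" "\<forall>x<n. m' ''l'' x \<le> top_level n"
      using rep(1,2,8) by (simp_all add: frame arc_footprint_def)
    show "lists_ok n (m' ''k'') (m' ''a'') (m' ''p'') (set_arc (arcs n m) x y j)"
      unfolding k a p by (rule add(2))
    show "\<forall>u<n. m' ''W'' u = (\<Sum>v<n. scaled_weight n (set_arc (arcs n m) x y j u v))"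
      by (simp add: W t W_sum)
    show "\<forall>u<n. \<forall>v<n. set_arc (arcs n m) x y j u v \<noteq> 0 \<longrightarrow>
        m' ''num'' (u * n + v) = scaled_weight n (set_arc (arcs n m) x y j u v) \<and>
        m' ''den'' (u * n + v) = unit_weight n"
      using rep(5,6) xy(3,4) m(3) by (auto simp: nd t set_arc_def index_eq_iff tables_def)
    show "\<forall>u<n. \<forall>v<n. set_arc (arcs n m) x y j u v \<le> top_level n + 1"
      using le by blast
    show "stack_ok n (m' ''s'') (m' ''S'' 0) (m' ''f'')"
      using stack_ok_push[OF rep(9) xy(3)] rep(9) by (auto simp: st)
    show "\<forall>u<n. m' ''f'' u = 0 \<longrightarrow> calm (c u) (load n (set_arc (arcs n m) x y j) u) (m' ''l'' u)"
      using rep(10) xy by (auto simp: st(3) load_set_arc frame arc_footprint_def split: if_splits)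
  qed
  have "tables n m'" using m(3) by (simp add: tables_def frame arc_footprint_def)
  then have "arc_post m x y j m'"
    using rep' arcs frame st(2,3) unfolding arc_post_def by auto
  then show ?thesis using ex p by (auto elim!: ok_weaken)
qed

end

section \<open>Moving an edge between index lists\<close>

definition move :: com where
  "move = (remove_arc ''x'' ''y'' ;; remove_arc ''y'' ''x'' ;; add_arc ''x'' ''y'' ;; add_arc ''y'' ''x'')"

lemma arcs_cong: "m' ''q'' = m ''q'' \<Longrightarrow> arcs n m' = arcs n m"
  by (simp add: arcs_def fun_eq_iff)

lemma represents_frame:
  assumes "\<forall>A \<in> {''n'', ''c'', ''k'', ''a'', ''p'', ''W'', ''q'', ''num'', ''den'', ''l'', ''s'', ''S'', ''f''}.
    m' A = m A"
  shows "represents n c m' \<longleftrightarrow> represents n c m"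
  using assms arcs_cong[of m' m n] by (simp add: represents_def)

lemma tables_frame: "m' ''D'' = m ''D'' \<Longrightarrow> m' ''t'' = m ''t'' \<Longrightarrow> tables n m' \<longleftrightarrow> tables n m"
  by (simp add: tables_def)

context matching_ram
begin

lemma arc_postD:
  assumes "arc_post m x y j m'"
  shows "represents n c m'" "tables n m'" "arcs n m' = set_arc (arcs n m) x y j"
    "\<And>A. A \<notin> set arc_footprint \<Longrightarrow> m' A = m A"
    "m' ''S'' 0 = m ''S'' 0 + (if m ''f'' x = 0 then 1 else 0)"
    "\<And>v. m' ''f'' v = (if v = x \<and> m ''f'' x = 0 then 1 else m ''f'' v)"
  using assms unfolding arc_post_def by blast+

text \<open>The node \<open>x\<close> is already on the stack, so only \<open>y\<close> can be
  pushed, and at most once. The last clause preserves the progress of a scan over the list of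
  \<open>x\<close>.\<close>

lemma move_ok:
  assumes m: "bounded R m" "represents n c m" "tables n m"
    and xy: "m ''x'' 0 = x" "m ''y'' 0 = y" "x < n" "y < n" "x \<noteq> y"
    and q: "arcs n m x y \<noteq> 0" "arcs n m y x \<noteq> 0"
    and h: "m ''h'' 0 = j" "1 \<le> j" "j \<le> top_level n + 1" and f: "m ''f'' x \<noteq> 0"
  defines "J \<equiv> arcs n m x y * n + x"
  shows "ok move m (\<lambda>t m'. t \<le> 400 \<and> represents n c m' \<and> tables n m' \<and>
    arcs n m' = set_edge (arcs n m) x y j \<and> (\<forall>A. A \<notin> set arc_footprint \<longrightarrow> m' A = m A) \<and>
    m' ''S'' 0 \<le> m ''S'' 0 + 1 \<and> m' ''f'' x \<noteq> 0 \<and>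
    (\<forall>w<n. w \<noteq> y \<longrightarrow> w \<noteq> m ''a'' (J * n + (m ''k'' J - 1)) \<longrightarrow> m' ''p'' (x * n + w) = m ''p'' (x * n + w)))"
proof -
  let ?z = "m ''a'' (J * n + (m ''k'' J - 1))"
  have fp: "''x'' \<notin> set arc_footprint" "''y'' \<notin> set arc_footprint" "''h'' \<notin> set arc_footprint"
    by (simp_all add: arc_footprint_def)
  have cnt: "m ''p'' (x * n + y) < m ''k'' J"
    using lists_ok_pos(1)[OF representsD(3)[OF m(2)] xy(3,4)] q unfolding J_def by simp
  have z: "?z < n"
    using lists_ok_elem(1)[OF representsD(3)[OF m(2)] xy(3), of "m ''k'' J - 1" "arcs n m x y"] cnt
    unfolding J_def by simp
  obtain t1 m1 where 1: "exec b (remove_arc ''x'' ''y'') m t1 m1" "bounded R m1" "t1 \<le> 100"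
    "arc_post m x y 0 m1" "m1 ''p'' = (m ''p'')(x * n + ?z := m ''p'' (x * n + y))"
    using remove_arc_ok[OF m xy(1-4) fp(1,2) q(1)] unfolding ok_def J_def by blast
  note a1 = arc_postD[OF 1(4)]
  have v1: "m1 ''x'' 0 = x" "m1 ''y'' 0 = y" "m1 ''h'' 0 = j" "arcs n m1 y x \<noteq> 0"
    using xy h q a1(4)[OF fp(1)] a1(4)[OF fp(2)] a1(4)[OF fp(3)] by (simp_all add: a1(3) set_arc_def)
  obtain t2 m2 i2 w2 where 2: "exec b (remove_arc ''y'' ''x'') m1 t2 m2" "bounded R m2" "t2 \<le> 100"
    "arc_post m1 y x 0 m2" "m2 ''p'' = (m1 ''p'')(y * n + w2 := i2)"
    and w2: "w2 = m1 ''a'' ((arcs n m1 y x * n + y) * n + (m1 ''k'' (arcs n m1 y x * n + y) - 1))"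
    using remove_arc_ok[OF 1(2) a1(1,2) v1(2,1) xy(4,3) fp(2,1) v1(4)] unfolding ok_def by blast
  have w2n: "w2 < n"
    using lists_ok_elem(1)[OF representsD(3)[OF a1(1)] xy(4), of "m1 ''k'' (arcs n m1 y x * n + y) - 1" "arcs n m1 y x"]
      lists_ok_pos(1)[OF representsD(3)[OF a1(1)] xy(4,3)] v1(4) unfolding w2 by simp
  note a2 = arc_postD[OF 2(4)]
  have v2: "m2 ''x'' 0 = x" "m2 ''y'' 0 = y" "m2 ''h'' 0 = j" "arcs n m2 x y = 0"
    using xy v1 a2(4)[OF fp(1)] a2(4)[OF fp(2)] a2(4)[OF fp(3)] by (simp_all add: a2(3) a1(3) set_arc_def)
  obtain t3 m3 i3 where 3: "exec b (add_arc ''x'' ''y'') m2 t3 m3" "bounded R m3" "t3 \<le> 100"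
    "arc_post m2 x y j m3" "m3 ''p'' = (m2 ''p'')(x * n + y := i3)"
    using add_arc_ok[OF 2(2) a2(1,2) v2(1,2) xy(3,4) fp(1,2) v2(4,3) h(2,3)] unfolding ok_def by blast
  note a3 = arc_postD[OF 3(4)]
  have v3: "m3 ''x'' 0 = x" "m3 ''y'' 0 = y" "m3 ''h'' 0 = j" "arcs n m3 y x = 0"
    using xy v2 a3(4)[OF fp(1)] a3(4)[OF fp(2)] a3(4)[OF fp(3)] by (simp_all add: a3(3) a2(3) set_arc_def)
  obtain t4 m4 i4 where 4: "exec b (add_arc ''y'' ''x'') m3 t4 m4" "bounded R m4" "t4 \<le> 100"
    "arc_post m3 y x j m4" "m4 ''p'' = (m3 ''p'')(y * n + x := i4)"
    using add_arc_ok[OF 3(2) a3(1,2) v3(2,1) xy(4,3) fp(2,1) v3(4,3) h(2,3)] unfolding ok_def by blast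
  note a4 = arc_postD[OF 4(4)]
  have "exec b move m (t1 + (t2 + (t3 + t4))) m4"
    unfolding move_def by (intro exec_Seq[OF 1(1)] exec_Seq[OF 2(1)] exec_Seq[OF 3(1)] 4(1))
  moreover have "arcs n m4 = set_edge (arcs n m) x y j"
    unfolding a4(3) a3(3) a2(3) a1(3) set_edge_def using xy(5) by (auto simp: set_arc_def fun_eq_iff)
  moreover have "m4 ''S'' 0 \<le> m ''S'' 0 + 1" "m4 ''f'' x \<noteq> 0"
    using f xy(5) by (simp_all add: a4(5,6) a3(5,6) a2(5,6) a1(5,6))
  moreover have "m4 ''p'' (x * n + w) = m ''p'' (x * n + w)" if "w < n" "w \<noteq> y" "w \<noteq> ?z" for w
    using that xy z w2n by (simp add: 4(5) 3(5) 2(5) 1(5) index_eq_iff)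
  moreover have "m4 A = m A" if "A \<notin> set arc_footprint" for A
    using a1(4)[OF that] a2(4)[OF that] a3(4)[OF that] a4(4)[OF that] by simp
  ultimately show ?thesis unfolding ok_def using a4(1,2) 1(3) 2(3) 3(3) 4(2,3)
    by (intro exI[of _ "t1 + (t2 + (t3 + t4))"] exI[of _ m4]) auto
qed

end

section \<open>Lowering a node by scanning one index list\<close>

definition scan_body :: com where
  "scan_body =
     ((assign ''e'' (var ''e'' [-] Const 1) ;;
       assign ''y'' (Read ''a'' (((var ''h'' [+] Const 1) [*] var ''n'' [+] var ''x'') [*] var ''n'' [+] var ''e''))) ;;
      Cond (Read ''l'' (var ''y'') [<] var ''h'') move Skip)"

definition lower :: com where
  "lower =
     ((assign ''h'' (Read ''l'' (var ''x'')) ;;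
       assign ''e'' (Read ''k'' ((var ''h'' [+] Const 1) [*] var ''n'' [+] var ''x''))) ;;
      While (var ''e'') scan_body ;;
      Write ''l'' (var ''x'') (Read ''l'' (var ''x'') [-] Const 1))"

context matching_ram
begin

definition energy :: "memory \<Rightarrow> real" where
  "energy m = potential n c (arcs n m) (m ''l'') (m ''S'' 0)"

definition leveled :: "edge set \<Rightarrow> memory \<Rightarrow> bool" where
  "leveled G m \<longleftrightarrow> support (arcs n m) = G \<and> represents n c m \<and> tables n m \<and> well_leveled n (arcs n m) (m ''l'')"

text \<open>The scan runs from the end of the list: deletion fills the gap with the last entry,
  which has been examined by then, so every edge still to be lowered sits before the cursor. The
  load inequality reserves \<open>wt (l x + 1) / 3\<close> for each entry left, exactly the gain
  from lowering one edge.\<close>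

definition scan_inv :: "edge set \<Rightarrow> (nat \<Rightarrow> nat) \<Rightarrow> nat \<Rightarrow> memory \<Rightarrow> bool" where
  "scan_inv G l x m \<longleftrightarrow> leveled G m \<and> m ''l'' = l \<and> m ''x'' 0 = x \<and> m ''h'' 0 = l x \<and> m ''f'' x \<noteq> 0 \<and>
     m ''e'' 0 \<le> card {y. y < n \<and> arcs n m x y = l x + 1} \<and>
     load n (arcs n m) x + real (m ''e'' 0) * (wt (l x + 1) / 3) \<le> real (c x) / 3 \<and>
     (\<forall>y<n. arcs n m x y = l x + 1 \<longrightarrow> l y < l x \<longrightarrow> m ''p'' (x * n + y) < m ''e'' 0)"

text \<open>Used only to make the loops halt; the amortized bound rests on the sharper
  \<open>energy_settled_ge\<close>.\<close>

lemma energy_ge: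
  assumes "leveled G m"
  shows "- real (n * top_level n) \<le> energy m"
proof -
  have wl: "well_leveled n (arcs n m) (m ''l'')" using assms by (simp add: leveled_def)
  have "(\<Sum>x<n. real (m ''l'' x)) \<le> (\<Sum>x<n. real (top_level n))"
    by (intro sum_mono) (use well_leveledD(5)[OF wl] in auto)
  then show ?thesis using potential_ge[OF wl, of c "m ''S'' 0"] by (simp add: energy_def)
qed

lemma scan_body_ok:
  assumes m: "bounded R m" "scan_inv G l x m" and e: "m ''e'' 0 \<noteq> 0" and x: "x < n" "0 < l x"
  shows "ok scan_body m (\<lambda>t m'. scan_inv G l x m' \<and> t \<le> 450 \<and>
    m' ''e'' 0 = m ''e'' 0 - 1 \<and> energy m' \<le> energy m + 3)"
proof -
  note I = m(2)[unfolded scan_inv_def]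
  have rep: "represents n c m" and tab: "tables n m" and wl: "well_leveled n (arcs n m) l"
    using I by (auto simp: leveled_def)
  note lists = representsD(3)[OF rep]
  define J where "J = (l x + 1) * n + x"
  define y where "y = m ''a'' (J * n + (m ''e'' 0 - 1))"
  have kJ: "m ''k'' J = card {y. y < n \<and> arcs n m x y = l x + 1}"
    using lists_ok_card[OF lists x(1), of "l x + 1"] unfolding J_def by simp
  then have "m ''e'' 0 \<le> m ''k'' J" using I by simp
  then have ek: "m ''e'' 0 - 1 < m ''k'' J" using e by linarith
  have y: "y < n" "arcs n m x y = l x + 1" "m ''p'' (x * n + y) = m ''e'' 0 - 1"
    using lists_ok_elem[OF lists x(1) ek[unfolded J_def]] by (simp_all add: y_def J_def)
  have xy: "x \<noteq> y" "arcs n m y x = l x + 1" using well_leveledD(1,6)[OF wl x(1) y(1)] y(2) by auto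
  define pre where "pre = (assign ''e'' (var ''e'' [-] Const 1) ;;
       assign ''y'' (Read ''a'' (((var ''h'' [+] Const 1) [*] var ''n'' [+] var ''x'') [*] var ''n'' [+] var ''e'')))"
  define m1 where "m1 = result pre m"
  have m1_eq: "m1 = put ''y'' 0 y (put ''e'' 0 (m ''e'' 0 - 1) m)"
    using I representsD(1)[OF rep] unfolding m1_def pre_def y_def J_def by (simp add: put_def)
  have "ok pre m (\<lambda>t m'. t \<le> max_time pre \<and> m' = m1)"
    unfolding m1_def by (intro ok_straight m) (simp_all add: pre_def)
  moreover have "max_time pre \<le> 40" by (simp add: pre_def)
  ultimately obtain t1 where 1: "exec b pre m t1 m1" "bounded R m1" "t1 \<le> 40"
    unfolding ok_def by force
  have rep1: "represents n c m1" using rep by (subst represents_frame[of m1 m]) (auto simp: m1_eq put_def)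
  have tab1: "tables n m1" using tab by (subst tables_frame[of m1 m]) (auto simp: m1_eq put_def)
  have arcs1: "arcs n m1 = arcs n m" by (rule arcs_cong) (simp add: m1_eq put_def)
  have v1: "m1 ''x'' 0 = x" "m1 ''y'' 0 = y" "m1 ''h'' 0 = l x" "m1 ''f'' = m ''f''" "m1 ''l'' = l"
    "m1 ''S'' = m ''S''" "m1 ''p'' = m ''p''" "m1 ''a'' = m ''a''" "m1 ''k'' = m ''k''"
    "m1 ''e'' 0 = m ''e'' 0 - 1"
    using I by (simp_all add: m1_eq put_def)
  have lx: "l x \<le> top_level n" using well_leveledD(5)[OF wl x(1) x(1)] .
  have en: "energy m = potential n c (arcs n m) l (m ''S'' 0)" using I by (simp add: energy_def)
  let ?Q = "\<lambda>t m'. scan_inv G l x m' \<and> t + t1 \<le> 450 \<and> m' ''e'' 0 = m ''e'' 0 - 1 \<and> energy m' \<le> energy m + 3"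
  have "ok (Cond (Read ''l'' (var ''y'') [<] var ''h'') move Skip) m1 ?Q"
  proof (rule ok_Cond[OF 1(2)])
    assume "ev m1 (Read ''l'' (var ''y'') [<] var ''h'') \<noteq> 0"
    then have ly: "l y < l x" using v1 by (auto split: if_splits)
    have "ok move m1 (\<lambda>t m'. t \<le> 400 \<and> represents n c m' \<and> tables n m' \<and>
      arcs n m' = set_edge (arcs n m1) x y (l x) \<and> (\<forall>A. A \<notin> set arc_footprint \<longrightarrow> m' A = m1 A) \<and>
      m' ''S'' 0 \<le> m1 ''S'' 0 + 1 \<and> m' ''f'' x \<noteq> 0 \<and>
      (\<forall>w<n. w \<noteq> y \<longrightarrow> w \<noteq> m1 ''a'' (J * n + (m1 ''k'' J - 1)) \<longrightarrow> m' ''p'' (x * n + w) = m1 ''p'' (x * n + w)))"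
      using move_ok[OF 1(2) rep1 tab1 v1(1,2) x(1) y(1) xy(1), of "l x"] y(2) xy(2) x(2) lx I
      unfolding arcs1 v1 J_def by simp
    then show "ok move m1 (\<lambda>t. ?Q (1 + expr_time (Read ''l'' (var ''y'') [<] var ''h'') + t))"
    proof (rule ok_weaken)
      fix t :: nat and m'
      assume P: "t \<le> 400 \<and> represents n c m' \<and> tables n m' \<and>
        arcs n m' = set_edge (arcs n m1) x y (l x) \<and> (\<forall>A. A \<notin> set arc_footprint \<longrightarrow> m' A = m1 A) \<and>
        m' ''S'' 0 \<le> m1 ''S'' 0 + 1 \<and> m' ''f'' x \<noteq> 0 \<and>
        (\<forall>w<n. w \<noteq> y \<longrightarrow> w \<noteq> m1 ''a'' (J * n + (m1 ''k'' J - 1)) \<longrightarrow> m' ''p'' (x * n + w) = m1 ''p'' (x * n + w))"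
      have arcs': "arcs n m' = set_edge (arcs n m) x y (l x)" using P arcs1 by simp
      have v': "m' ''l'' = l" "m' ''x'' 0 = x" "m' ''h'' 0 = l x" "m' ''e'' 0 = m ''e'' 0 - 1"
        using P v1 by (simp_all add: arc_footprint_def)
      have load_le: "load n (arcs n m) x + wt (l x + 1) / 3 \<le> real (c x) / 3"
      proof -
        have "1 * (wt (l x + 1) / 3) \<le> real (m ''e'' 0) * (wt (l x + 1) / 3)"
          using e by (intro mult_right_mono) (auto simp: wt_nonneg)
        then show ?thesis using I by simp
      qed
      note low = lower_edge[where c = c, OF wl x(1) y(1,2) ly load_le]
      have "load n (arcs n m') x = load n (arcs n m) x + wt (l x + 1) / 3"
        unfolding arcs' load_set_edge[OF x(1) y(1) xy(1)] using y(2) x(2) wt_Suc[of "l x"] by simp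
      moreover have "real (m ''e'' 0) = real (m' ''e'' 0) + 1" using v'(4) e by simp
      ultimately have ld: "load n (arcs n m') x + real (m' ''e'' 0) * (wt (l x + 1) / 3) \<le> real (c x) / 3"
        using I by (simp add: algebra_simps)
      have "{w. w < n \<and> arcs n m' x w = l x + 1} = {w. w < n \<and> arcs n m x w = l x + 1} - {y}"
        using xy(1) by (auto simp: arcs' set_edge_apply)
      then have cd: "m' ''e'' 0 \<le> card {w. w < n \<and> arcs n m' x w = l x + 1}"
        using I y v'(4) by (simp add: card_Diff_singleton diff_le_mono)
      have pp: "m' ''p'' (x * n + w) < m' ''e'' 0" if w: "w < n" "arcs n m' x w = l x + 1" "l w < l x" for w
      proof -
        have w': "w \<noteq> y" "arcs n m x w = l x + 1" using w xy(1) by (auto simp: arcs' set_edge_apply split: if_splits)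
        have less: "m ''p'' (x * n + w) < m ''e'' 0" using I w w' by blast
        have aw: "m ''a'' (J * n + m ''p'' (x * n + w)) = w"
          using lists_ok_pos(2)[OF lists x(1) w(1)] w'(2) unfolding J_def by simp
        have ne: "m ''p'' (x * n + w) \<noteq> m ''e'' 0 - 1" using aw w'(1) y_def by auto
        \<comment> \<open>The deletion moves the last entry, whose position is at least that of
          \<open>y\<close>. A pending \<open>w\<close> sits strictly before \<open>y\<close>, so its
          position is untouched.\<close>
        have "w \<noteq> m ''a'' (J * n + (m ''k'' J - 1))"
        proof
          assume "w = m ''a'' (J * n + (m ''k'' J - 1))"
          then have "m ''p'' (x * n + w) = m ''k'' J - 1"
            using lists_ok_elem(3)[OF lists x(1), of "m ''k'' J - 1" "l x + 1"] ek unfolding J_def by simp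
          then show False using less ne ek by linarith
        qed
        then have "m' ''p'' (x * n + w) = m ''p'' (x * n + w)" using P w w' v1 by simp
        then show ?thesis using less ne v'(4) by linarith
      qed
      have "well_leveled n (arcs n m') (m' ''l'')" unfolding arcs' v' by (rule low(1))
      moreover have "support (arcs n m') = G"
        unfolding arcs' using I y(2) xy(2) x(2) by (subst support_set_edge) (auto simp: leveled_def)
      ultimately have "scan_inv G l x m'" unfolding scan_inv_def leveled_def using P v' ld cd pp by simp
      moreover have "energy m' \<le> energy m + 3"
        unfolding energy_def[of m'] en arcs' v' using P v1 by (intro low(2)) simp
      ultimately show "?Q (1 + expr_time (Read ''l'' (var ''y'') [<] var ''h'') + t) m'"
        using P v' 1(3) by simp
    qed
  next
    assume "ev m1 (Read ''l'' (var ''y'') [<] var ''h'') = 0"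
    then have ly: "\<not> l y < l x" using v1 by (auto split: if_splits)
    have "m ''p'' (x * n + w) < m ''e'' 0 - 1" if w: "w < n" "arcs n m x w = l x + 1" "l w < l x" for w
    proof -
      have "m ''a'' (J * n + m ''p'' (x * n + w)) = w"
        using lists_ok_pos(2)[OF lists x(1) w(1)] w(2) unfolding J_def by simp
      then have "m ''p'' (x * n + w) \<noteq> m ''e'' 0 - 1" using ly w(3) y_def by auto
      moreover have "m ''p'' (x * n + w) < m ''e'' 0" using I w by blast
      ultimately show ?thesis by linarith
    qed
    moreover have "real (m ''e'' 0 - 1) * (wt (l x + 1) / 3) \<le> real (m ''e'' 0) * (wt (l x + 1) / 3)"
      by (intro mult_right_mono) (auto simp: wt_nonneg)
    moreover have "m ''e'' 0 - 1 \<le> card {y. y < n \<and> arcs n m x y = l x + 1}"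
      using ek kJ by simp
    ultimately have "scan_inv G l x m1"
      unfolding scan_inv_def leveled_def arcs1 using rep1 tab1 wl I v1 by (simp add: leveled_def)
    moreover have "energy m1 = energy m" by (simp add: energy_def arcs1 v1 I)
    ultimately show "ok Skip m1 (\<lambda>t. ?Q (1 + expr_time (Read ''l'' (var ''y'') [<] var ''h'') + t))"
      using exec_Skip[of b m1] 1(2,3) v1 unfolding ok_def by (intro exI[of _ 1] exI[of _ m1]) simp
  qed simp_all
  then obtain t2 m2 where 2: "exec b (Cond (Read ''l'' (var ''y'') [<] var ''h'') move Skip) m1 t2 m2"
    "bounded R m2" "?Q t2 m2" unfolding ok_def by blast
  have "exec b scan_body m (t1 + t2) m2"
    unfolding scan_body_def by (rule exec_Seq[OF 1(1)[unfolded pre_def] 2(1)])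
  then show ?thesis unfolding ok_def using 2 by (intro exI[of _ "t1 + t2"] exI[of _ m2]) (simp add: add.commute)
qed

end

section \<open>Restoring balance\<close>

context matching_ram
begin

text \<open>The node must be flagged, since a new level may destroy its calmness.\<close>

lemma represents_set_level:
  assumes rep: "represents n c m" and "x < n" "m ''f'' x \<noteq> 0" "i \<le> top_level n"
  shows "represents n c (put ''l'' x i m)"
proof -
  have "arcs n (put ''l'' x i m) = arcs n m" by (rule arcs_cong) (simp add: put_def)
  then show ?thesis using assms unfolding represents_def by (simp add: put_def)
qed

text \<open>The final decrement frees \<open>4 * growth (l x) * c x\<close>, while the scan used at
  most \<open>4 * N\<close>, a quarter of this. At least 3 units are left for the level term and the
  fixed costs.\<close>

lemma lower_ok:
  assumes m: "bounded R m" "leveled G m" and x: "m ''x'' 0 = x" "x < n" "m ''f'' x \<noteq> 0" "0 < m ''l'' x"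
    and under: "load n (arcs n m) x < real (c x) / 4"
  shows "ok lower m (\<lambda>t m'. leveled G m' \<and> real t + 1000 * energy m' \<le> 1000 * energy m - 900)"
proof -
  define l where "l = m ''l''"
  have rep: "represents n c m" and tab: "tables n m" and wl: "well_leveled n (arcs n m) l"
    using m by (auto simp: leveled_def l_def)
  note lists = representsD(3)[OF rep]
  define N where "N = card {y. y < n \<and> arcs n m x y = l x + 1}"
  have kN: "m ''k'' ((l x + 1) * n + x) = N"
    using lists_ok_card[OF lists x(2), of "l x + 1"] by (simp add: N_def)
  have Nwt: "real N * wt (l x + 1) \<le> load n (arcs n m) x"
    unfolding N_def by (rule card_wt_le_load)
  define pre where "pre = (assign ''h'' (Read ''l'' (var ''x'')) ;;
       assign ''e'' (Read ''k'' ((var ''h'' [+] Const 1) [*] var ''n'' [+] var ''x'')))"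
  define m1 where "m1 = result pre m"
  have m1_eq: "m1 = put ''e'' 0 N (put ''h'' 0 (l x) m)"
    using x kN representsD(1)[OF rep] unfolding m1_def pre_def by (simp add: put_def l_def)
  have "ok pre m (\<lambda>t m'. t \<le> max_time pre \<and> m' = m1)"
    unfolding m1_def by (intro ok_straight m) (simp_all add: pre_def)
  moreover have "max_time pre \<le> 40" by (simp add: pre_def)
  ultimately obtain t1 where 1: "exec b pre m t1 m1" "bounded R m1" "t1 \<le> 40"
    unfolding ok_def by force
  have rep1: "represents n c m1" using rep by (subst represents_frame[of m1 m]) (auto simp: m1_eq put_def)
  have tab1: "tables n m1" using tab by (subst tables_frame[of m1 m]) (auto simp: m1_eq put_def)
  have arcs1: "arcs n m1 = arcs n m" by (rule arcs_cong) (simp add: m1_eq put_def)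
  have v1: "m1 ''x'' 0 = x" "m1 ''h'' 0 = l x" "m1 ''e'' 0 = N" "m1 ''f'' = m ''f''" "m1 ''l'' = l"
    "m1 ''p'' = m ''p''" "m1 ''S'' = m ''S''"
    using x by (simp_all add: m1_eq put_def l_def)
  have "m ''p'' (x * n + y) < N" if "y < n" "arcs n m x y = l x + 1" for y
    using lists_ok_pos(1)[OF lists x(2) that(1)] that(2) kN by simp
  \<comment> \<open>The \<open>N\<close> edges weigh at most the whole load, so even lowering all of
    them gives at most \<open>4 / 3\<close> of a load below \<open>c x / 4\<close>.\<close>
  moreover have "load n (arcs n m) x + real N * (wt (l x + 1) / 3) \<le> real (c x) / 3"
    using Nwt under by simp
  ultimately have inv1: "scan_inv G l x m1"
    unfolding scan_inv_def leveled_def arcs1 using rep1 tab1 v1 wl x m(2) by (simp add: N_def leveled_def)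
  \<comment> \<open>Each pending entry carries 4 units: up to 3 for the energy added by its move,
    and one, worth 1000 steps, for its round.\<close>
  let ?f = "\<lambda>m. 1000 * (energy m + 4 * real (m ''e'' 0))"
  have "ok (While (var ''e'') scan_body) m1
    (\<lambda>t m'. scan_inv G l x m' \<and> ev m' (var ''e'') = 0 \<and> real t + ?f m' \<le> ?f m1 + real (1 + expr_time (var ''e'')))"
  proof (rule ok_While[where B = "- 1000 * real (n * top_level n)"])
    fix m assume I: "bounded R m" "scan_inv G l x m" "ev m (var ''e'') \<noteq> 0"
    then have e: "m ''e'' 0 \<noteq> 0" by simp
    have "ok scan_body m (\<lambda>t m'. scan_inv G l x m' \<and> t \<le> 450 \<and>
      m' ''e'' 0 = m ''e'' 0 - 1 \<and> energy m' \<le> energy m + 3)"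
      using I(1,2) e x(2,4) by (intro scan_body_ok) (auto simp: l_def)
    then show "ok scan_body m (\<lambda>t m'. scan_inv G l x m' \<and> real (1 + expr_time (var ''e'') + t) + ?f m' \<le> ?f m)"
      by (rule ok_weaken) (use e in auto)
  next
    fix m assume "scan_inv G l x m"
    then have "- real (n * top_level n) \<le> energy m" by (intro energy_ge[of G]) (simp add: scan_inv_def)
    then show "- 1000 * real (n * top_level n) \<le> ?f m" by simp
  qed (use 1 inv1 in auto)
  then obtain t2 m2 where 2: "exec b (While (var ''e'') scan_body) m1 t2 m2" "bounded R m2"
    "scan_inv G l x m2" "m2 ''e'' 0 = 0" "real t2 + ?f m2 \<le> ?f m1 + 3"
    unfolding ok_def by auto
  note I2 = 2(3)[unfolded scan_inv_def]
  have wl2: "well_leveled n (arcs n m2) l" using I2 by (auto simp: leveled_def)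
  have lx: "l x \<le> top_level n" using well_leveledD(5)[OF wl x(2) x(2)] .
  have none: "l x \<le> l y" if "y < n" "arcs n m2 x y = l x + 1" for y
  proof (rule ccontr)
    assume "\<not> l x \<le> l y"
    moreover have "\<forall>y<n. arcs n m2 x y = l x + 1 \<longrightarrow> l y < l x \<longrightarrow> m2 ''p'' (x * n + y) < m2 ''e'' 0"
      using I2 by blast
    ultimately show False using that 2(4) by (simp add: not_le)
  qed
  have under2: "load n (arcs n m2) x \<le> real (c x) / 3" using I2 2(4) by simp
  have lx0: "0 < l x" using x by (simp add: l_def)
  note low = lower_level[where c = c, OF wl2 x(2) lx0 none under2]
  define m3 where "m3 = put ''l'' x (l x - 1) m2"
  have 3: "exec b (Write ''l'' (var ''x'') (Read ''l'' (var ''x'') [-] Const 1)) m2 8 m3"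
  proof -
    have "ev m2 (Read ''l'' (var ''x'') [-] Const 1) = l x - 1" "ev m2 (var ''x'') = x" using I2 by simp_all
    then show ?thesis using exec_Write[of b "''l''" "var ''x''" "Read ''l'' (var ''x'') [-] Const 1" m2] 2(2)
      by (simp add: eval_eq_ev m3_def eval_nat_numeral del: eval.simps ev.simps)
  qed
  have b3: "bounded R m3" unfolding m3_def using 2(2) I2
    by (intro bounded_put) (auto simp: bounded_def less_imp_diff_less)
  have arcs3: "arcs n m3 = arcs n m2" by (rule arcs_cong) (simp add: m3_def put_def)
  have l3: "m3 ''l'' = l(x := l x - 1)" "m3 ''S'' = m2 ''S''" using I2 by (simp_all add: m3_def put_def)
  have "represents n c m3" unfolding m3_def
    using I2 x(2) lx by (intro represents_set_level) (auto simp: leveled_def)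
  moreover have "tables n m3" using I2 tables_frame[of m3 m2 n] by (simp add: m3_def put_def leveled_def)
  ultimately have lev3: "leveled G m3" using low(1) I2 by (simp add: leveled_def arcs3 l3)
  have e3: "energy m3 + 4 * growth (l x) * real (c x) \<le> energy m2 + 1"
    using low(2)[of "m2 ''S'' 0"] I2 by (simp add: energy_def arcs3 l3)
  have gwt: "growth (l x) * wt (l x + 1) = 1" using growth_wt[of "l x"] lx0 by (simp add: wt_Suc)
  have "real N = growth (l x) * (real N * wt (l x + 1))" using gwt by (simp add: algebra_simps)
  also have "\<dots> \<le> growth (l x) * (real (c x) / 4)"
    using Nwt under by (intro mult_left_mono growth_nonneg) simp
  finally have N4: "4 * real N \<le> growth (l x) * real (c x)" by simp
  have "1 \<le> growth (l x)" using lx0 by (simp add: growth_def)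
  then have "1 * 1 \<le> growth (l x) * real (c x)" using cap[OF x(2)] by (intro mult_mono) auto
  moreover have "energy m1 = energy m" by (simp add: energy_def arcs1 v1 l_def)
  ultimately have "real (t1 + (t2 + 8)) + 1000 * energy m3 \<le> 1000 * energy m - 900"
    using e3 N4 1(3) 2(4,5) v1(3) by simp
  moreover have "exec b lower m (t1 + (t2 + 8)) m3"
    unfolding lower_def by (intro exec_Seq[OF 1(1)[unfolded pre_def]] exec_Seq[OF 2(1)] 3)
  ultimately show ?thesis using lev3 b3 unfolding ok_def by blast
qed

text \<open>Loads are exact multiples of the unit, so cross-multiplied integer tests decide the real
  comparisons without rounding.\<close>

lemma overloaded_iff:
  assumes "leveled G m" "x < n"
  shows "m ''c'' x * m ''D'' 0 < 2 * m ''W'' x \<longleftrightarrow> real (c x) / 2 < load n (arcs n m) x"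
    and "4 * m ''W'' x < m ''c'' x * m ''D'' 0 \<longleftrightarrow> load n (arcs n m) x < real (c x) / 4"
proof -
  have rep: "represents n c m" and D: "m ''D'' 0 = unit_weight n"
    using assms by (auto simp: leveled_def tables_def)
  have pos: "0 < real (unit_weight n)" by (simp add: unit_weight_def)
  note W = load_eq[OF rep assms(2)]
  have "m ''c'' x * m ''D'' 0 < 2 * m ''W'' x \<longleftrightarrow> real (m ''c'' x * m ''D'' 0) < real (2 * m ''W'' x)"
    by (rule of_nat_less_iff[symmetric])
  also have "\<dots> \<longleftrightarrow> real (unit_weight n) * real (c x) < real (unit_weight n) * (2 * load n (arcs n m) x)"
    using representsD(2)[OF rep assms(2)] D W by (simp add: algebra_simps)
  also have "\<dots> \<longleftrightarrow> real (c x) / 2 < load n (arcs n m) x"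
    unfolding mult_less_cancel_left_pos[OF pos] by auto
  finally show "m ''c'' x * m ''D'' 0 < 2 * m ''W'' x \<longleftrightarrow> real (c x) / 2 < load n (arcs n m) x" .
  have "4 * m ''W'' x < m ''c'' x * m ''D'' 0 \<longleftrightarrow> real (4 * m ''W'' x) < real (m ''c'' x * m ''D'' 0)"
    by (rule of_nat_less_iff[symmetric])
  also have "\<dots> \<longleftrightarrow> real (unit_weight n) * (4 * load n (arcs n m) x) < real (unit_weight n) * real (c x)"
    using representsD(2)[OF rep assms(2)] D W by (simp add: algebra_simps)
  also have "\<dots> \<longleftrightarrow> load n (arcs n m) x < real (c x) / 4"
    unfolding mult_less_cancel_left_pos[OF pos] by auto
  finally show "4 * m ''W'' x < m ''c'' x * m ''D'' 0 \<longleftrightarrow> load n (arcs n m) x < real (c x) / 4" .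
qed

end

section \<open>Raising a node and choosing the next repair step\<close>

definition raise_one :: com where
  "raise_one =
     ((assign ''h'' (Read ''l'' (var ''x'') [+] Const 1) ;;
       assign ''y'' (Read ''a'' ((Read ''l'' (var ''x'') [*] var ''n'' [+] var ''x'') [*] var ''n''
         [+] (Read ''k'' (Read ''l'' (var ''x'') [*] var ''n'' [+] var ''x'') [-] Const 1)))) ;;
      move)"

definition repair_top :: com where
  "repair_top =
     (assign ''x'' (Read ''s'' (var ''S'' [-] Const 1)) ;;
      Cond (Read ''c'' (var ''x'') [*] var ''D'' [<] Const 2 [*] Read ''W'' (var ''x''))
        (Cond (Read ''k'' (Read ''l'' (var ''x'') [*] var ''n'' [+] var ''x''))
          raise_one
          (Write ''l'' (var ''x'') (Read ''l'' (var ''x'') [+] Const 1)))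
        (Cond ((Const 0 [<] Read ''l'' (var ''x'')) [*]
              (Const 4 [*] Read ''W'' (var ''x'') [<] Read ''c'' (var ''x'') [*] var ''D''))
          lower
          (assign ''S'' (var ''S'' [-] Const 1) ;; Write ''f'' (var ''x'') (Const 0))))"

context matching_ram
begin

lemma level_fits: "i \<le> top_level n \<Longrightarrow> i + 1 < R"
proof -
  assume "i \<le> top_level n"
  then have "i + 1 < (top_level n + 2) * 1" by simp
  also have "\<dots> \<le> (top_level n + 2) * (n + 1)" by (intro mult_le_mono2) simp
  finally show ?thesis using small(1) by simp
qed

lemma raise_one_ok:
  assumes m: "bounded R m" "leveled G m" and x: "m ''x'' 0 = x" "x < n" "m ''f'' x \<noteq> 0"
    and over: "real (c x) / 2 < load n (arcs n m) x"
    and ne: "m ''k'' (m ''l'' x * n + x) \<noteq> 0"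
  shows "ok raise_one m (\<lambda>t m'. leveled G m' \<and> t \<le> 450 \<and> energy m' + 1 \<le> energy m)"
proof -
  define l where "l = m ''l''"
  have rep: "represents n c m" and tab: "tables n m" and wl: "well_leveled n (arcs n m) l"
    using m by (auto simp: leveled_def l_def)
  note lists = representsD(3)[OF rep]
  define J where "J = l x * n + x"
  define y where "y = m ''a'' (J * n + (m ''k'' J - 1))"
  have "m ''k'' J - 1 < m ''k'' J" using ne by (simp add: J_def l_def)
  then have y: "y < n" "arcs n m x y = l x"
    using lists_ok_elem[OF lists x(2), of "m ''k'' J - 1" "l x"] by (simp_all add: y_def J_def)
  \<comment> \<open>Lists of index 0 are empty, so an overloaded node of level 0 always takes the
    branch that raises its level instead.\<close>
  have lx0: "0 < l x"
  proof (rule ccontr)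
    assume "\<not> 0 < l x"
    then show False using lists x(2) ne by (simp add: lists_ok_def l_def)
  qed
  have xy: "x \<noteq> y" "arcs n m y x = l x" using well_leveledD(1,6)[OF wl x(2) y(1)] y(2) lx0 by auto
  have lx: "l x \<le> top_level n" using well_leveledD(5)[OF wl x(2) x(2)] .
  define pre where "pre = (assign ''h'' (Read ''l'' (var ''x'') [+] Const 1) ;;
       assign ''y'' (Read ''a'' ((Read ''l'' (var ''x'') [*] var ''n'' [+] var ''x'') [*] var ''n''
         [+] (Read ''k'' (Read ''l'' (var ''x'') [*] var ''n'' [+] var ''x'') [-] Const 1))))"
  define m1 where "m1 = result pre m"
  have m1_eq: "m1 = put ''y'' 0 y (put ''h'' 0 (l x + 1) m)"
    using x representsD(1)[OF rep] unfolding m1_def pre_def y_def J_def by (simp add: put_def l_def)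
  have "l x + 1 < R" by (rule level_fits[OF lx])
  then have "ok pre m (\<lambda>t m'. t \<le> max_time pre \<and> m' = m1)"
    unfolding m1_def by (intro ok_straight m) (simp_all add: pre_def x l_def)
  moreover have "max_time pre \<le> 45" by (simp add: pre_def)
  ultimately obtain t1 where 1: "exec b pre m t1 m1" "bounded R m1" "t1 \<le> 45"
    unfolding ok_def by force
  have rep1: "represents n c m1" using rep by (subst represents_frame[of m1 m]) (auto simp: m1_eq put_def)
  have tab1: "tables n m1" using tab by (subst tables_frame[of m1 m]) (auto simp: m1_eq put_def)
  have arcs1: "arcs n m1 = arcs n m" by (rule arcs_cong) (simp add: m1_eq put_def)
  have v1: "m1 ''x'' 0 = x" "m1 ''y'' 0 = y" "m1 ''h'' 0 = l x + 1" "m1 ''f'' = m ''f''" "m1 ''l'' = l"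
    "m1 ''S'' = m ''S''"
    using x by (simp_all add: m1_eq put_def l_def)
  obtain t2 m2 where 2: "exec b move m1 t2 m2" "bounded R m2" "t2 \<le> 400" "represents n c m2" "tables n m2"
    "arcs n m2 = set_edge (arcs n m) x y (l x + 1)" "\<forall>A. A \<notin> set arc_footprint \<longrightarrow> m2 A = m1 A"
    "m2 ''S'' 0 \<le> m ''S'' 0 + 1"
    using move_ok[OF 1(2) rep1 tab1 v1(1,2) x(2) y(1) xy(1), of "l x + 1"] y(2) xy(2) lx0 lx v1 x(3)
    unfolding ok_def arcs1 by auto
  have l2: "m2 ''l'' = l" using 2(7) v1 by (simp add: arc_footprint_def)
  note up = raise_edge[where c = c, OF wl x(2) y lx0 over]
  have "energy m2 + 1 \<le> energy m"
    unfolding energy_def l2 2(6) l_def[symmetric] using 2(8) by (rule up(2))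
  moreover have "support (arcs n m2) = G"
    unfolding 2(6) using m(2) y(2) xy(2) lx0 by (subst support_set_edge) (auto simp: leveled_def)
  then have "leveled G m2" unfolding leveled_def l2 using up(1) 2 by simp
  moreover have "exec b raise_one m (t1 + t2) m2"
    unfolding raise_one_def by (intro exec_Seq[OF 1(1)[unfolded pre_def]] 2(1))
  ultimately show ?thesis unfolding ok_def using 1(3) 2(2,3)
    by (intro exI[of _ "t1 + t2"] exI[of _ m2]) simp
qed

text \<open>The node stays on the stack until it is calm. A raised edge, a raised level or a pop
  frees at least one unit, worth 1000 steps, of which half is to spare; lowering pays for its own
  scan.\<close>

lemma repair_top_ok:
  assumes m: "bounded R m" "leveled G m" and S: "m ''S'' 0 \<noteq> 0"
  shows "ok repair_top m (\<lambda>t m'. leveled G m' \<and> real t + 1000 * energy m' \<le> 1000 * energy m - 500)"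
proof -
  define x where "x = m ''s'' (m ''S'' 0 - 1)"
  have x: "x < n" "m ''f'' x \<noteq> 0"
    using stack_ok_top[OF representsD(9)] m(2) S by (auto simp: leveled_def x_def)
  define m1 where "m1 = put ''x'' 0 x m"
  have 1: "exec b (assign ''x'' (Read ''s'' (var ''S'' [-] Const 1))) m 7 m1"
    using exec_Write[of b "''x''" "Const 0" "Read ''s'' (var ''S'' [-] Const 1)" m] m(1)
    by (simp add: eval_eq_ev m1_def x_def eval_nat_numeral del: eval.simps)
  have b1: "bounded R m1" unfolding m1_def using m(1) by (intro bounded_put) (auto simp: x_def bounded_def)
  have arcs1: "arcs n m1 = arcs n m" by (rule arcs_cong) (simp add: m1_def put_def)
  have v1: "m1 ''x'' 0 = x" "m1 ''f'' = m ''f''" "m1 ''l'' = m ''l''" "m1 ''S'' = m ''S''" "m1 ''s'' = m ''s''"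
    by (simp_all add: m1_def put_def)
  have lev1: "leveled G m1"
    using m(2) represents_frame[of m1 m] tables_frame[of m1 m n] unfolding leveled_def arcs1
    by (simp add: m1_def put_def)
  have e1: "energy m1 = energy m" by (simp add: energy_def arcs1 v1)
  have rep1: "represents n c m1" and wl1: "well_leveled n (arcs n m1) (m1 ''l'')"
    using lev1 by (auto simp: leveled_def)
  note n1 = representsD(1)[OF rep1]
  let ?Q = "\<lambda>t m'. leveled G m' \<and> real t + 7 + 1000 * energy m' \<le> 1000 * energy m - 500"
  let ?over = "Read ''c'' (var ''x'') [*] var ''D'' [<] Const 2 [*] Read ''W'' (var ''x'')"
  let ?up = "Cond (Read ''k'' (Read ''l'' (var ''x'') [*] var ''n'' [+] var ''x'')) raise_one
          (Write ''l'' (var ''x'') (Read ''l'' (var ''x'') [+] Const 1))"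
  let ?low = "Cond ((Const 0 [<] Read ''l'' (var ''x'')) [*]
              (Const 4 [*] Read ''W'' (var ''x'') [<] Read ''c'' (var ''x'') [*] var ''D''))
          lower
          (assign ''S'' (var ''S'' [-] Const 1) ;; Write ''f'' (var ''x'') (Const 0))"
  have "ok (Cond ?over ?up ?low) m1 ?Q"
  proof (rule ok_Cond[OF b1])
    assume "ev m1 ?over \<noteq> 0"
    then have "m1 ''c'' x * m1 ''D'' 0 < 2 * m1 ''W'' x" using v1(1) by (auto split: if_splits)
    then have over: "real (c x) / 2 < load n (arcs n m1) x" using overloaded_iff(1)[OF lev1 x(1)] by simp
    show "ok ?up m1 (\<lambda>t. ?Q (1 + expr_time ?over + t))"
    proof (rule ok_Cond[OF b1])
      assume "ev m1 (Read ''k'' (Read ''l'' (var ''x'') [*] var ''n'' [+] var ''x'')) \<noteq> 0"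
      then have "m1 ''k'' (m1 ''l'' x * n + x) \<noteq> 0" using v1(1) n1 by simp
      from raise_one_ok[OF b1 lev1 v1(1) x(1) _ over this] x(2) v1(2)
      have "ok raise_one m1 (\<lambda>t m'. leveled G m' \<and> t \<le> 450 \<and> energy m' + 1 \<le> energy m1)" by simp
      then show "ok raise_one m1 (\<lambda>t. ?Q (1 + expr_time ?over +
          (1 + expr_time (Read ''k'' (Read ''l'' (var ''x'') [*] var ''n'' [+] var ''x'')) + t)))"
        by (rule ok_weaken) (auto simp: e1)
    next
      assume "ev m1 (Read ''k'' (Read ''l'' (var ''x'') [*] var ''n'' [+] var ''x'')) = 0"
      then have k0: "m1 ''k'' (m1 ''l'' x * n + x) = 0" using v1(1) n1 by simp
      have none: "arcs n m1 x y \<noteq> m1 ''l'' x" if "y < n" "arcs n m1 x y \<noteq> 0" for y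
        using lists_ok_pos(1)[OF representsD(3)[OF rep1] x(1) that(1)] that(2) k0 by auto
      note up = raise_level[where c = c, OF wl1 x(1) cap[OF x(1)] none over]
      define m2 where "m2 = put ''l'' x (m1 ''l'' x + 1) m1"
      have "exec b (Write ''l'' (var ''x'') (Read ''l'' (var ''x'') [+] Const 1)) m1 8 m2"
        using exec_Write[of b "''l''" "var ''x''" "Read ''l'' (var ''x'') [+] Const 1" m1] b1 v1(1)
        by (simp add: eval_eq_ev m2_def eval_nat_numeral del: eval.simps)
      moreover have "bounded R m2" unfolding m2_def using b1 level_fits[of "m1 ''l'' x"] up(1)
        by (intro bounded_put) auto
      moreover have arcs2: "arcs n m2 = arcs n m1" by (rule arcs_cong) (simp add: m2_def put_def)
      moreover have l2: "m2 ''l'' = (m1 ''l'')(x := m1 ''l'' x + 1)" "m2 ''S'' = m1 ''S''"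
        by (simp_all add: m2_def put_def)
      moreover have "represents n c m2" unfolding m2_def
        using rep1 x up(1) v1 by (intro represents_set_level) auto
      moreover have "tables n m2" using lev1 tables_frame[of m2 m1 n] by (simp add: m2_def put_def leveled_def)
      moreover have "energy m2 + 1 \<le> energy m1" using up(3)[of "m1 ''S'' 0"] by (simp add: energy_def arcs2 l2)
      ultimately show "ok (Write ''l'' (var ''x'') (Read ''l'' (var ''x'') [+] Const 1)) m1
        (\<lambda>t. ?Q (1 + expr_time ?over + (1 + expr_time (Read ''k'' (Read ''l'' (var ''x'') [*] var ''n'' [+] var ''x'')) + t)))"
        using up(2) e1 lev1 unfolding ok_def leveled_def by (intro exI[of _ 8] exI[of _ m2]) simp
    qed simp_all
  next
    assume "ev m1 ?over = 0"
    then have "\<not> m1 ''c'' x * m1 ''D'' 0 < 2 * m1 ''W'' x" using v1(1) by (auto split: if_splits)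
    then have nover: "load n (arcs n m1) x \<le> real (c x) / 2" using overloaded_iff(1)[OF lev1 x(1)] by simp
    let ?under = "(Const 0 [<] Read ''l'' (var ''x'')) [*]
              (Const 4 [*] Read ''W'' (var ''x'') [<] Read ''c'' (var ''x'') [*] var ''D'')"
    show "ok ?low m1 (\<lambda>t. ?Q (1 + expr_time ?over + t))"
    proof (rule ok_Cond[OF b1])
      assume "ev m1 ?under \<noteq> 0"
      then have "0 < m1 ''l'' x" "4 * m1 ''W'' x < m1 ''c'' x * m1 ''D'' 0"
        using v1(1) by (auto split: if_splits)
      then have "ok lower m1 (\<lambda>t m'. leveled G m' \<and> real t + 1000 * energy m' \<le> 1000 * energy m1 - 900)"
        using overloaded_iff(2)[OF lev1 x(1)] x v1 by (intro lower_ok[OF b1 lev1]) auto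
      then show "ok lower m1 (\<lambda>t. ?Q (1 + expr_time ?over + (1 + expr_time ?under + t)))"
        by (rule ok_weaken) (auto simp: e1)
    next
      assume "ev m1 ?under = 0"
      then have "m1 ''l'' x = 0 \<or> \<not> 4 * m1 ''W'' x < m1 ''c'' x * m1 ''D'' 0"
        using v1(1) by (auto split: if_splits)
      then have calm: "calm (c x) (load n (arcs n m1) x) (m1 ''l'' x)"
        using overloaded_iff(2)[OF lev1 x(1)] nover by (auto simp: calm_def)
      let ?pop = "assign ''S'' (var ''S'' [-] Const 1) ;; Write ''f'' (var ''x'') (Const 0)"
      define m2 where "m2 = put ''f'' x 0 (put ''S'' 0 (m ''S'' 0 - 1) m1)"
      have res: "result ?pop m1 = m2" using v1 by (simp add: m2_def put_def)
      have "ok ?pop m1 (\<lambda>t m'. t \<le> max_time ?pop \<and> m' = m2)"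
        unfolding res[symmetric] by (intro ok_straight b1) simp_all
      then have ex: "ok ?pop m1 (\<lambda>t m'. t \<le> 20 \<and> m' = m2)" by (rule ok_weaken) simp
      have arcs2: "arcs n m2 = arcs n m1" by (rule arcs_cong) (simp add: m2_def put_def)
      have st: "stack_ok n (m1 ''s'') (m ''S'' 0 - 1) ((m1 ''f'')(x := 0))"
        using stack_ok_pop[OF representsD(9)[OF rep1]] S v1 by (simp add: x_def)
      have "represents n c m2"
        using rep1 st calm unfolding represents_def arcs2 by (simp add: m2_def put_def)
      moreover have "tables n m2" using lev1 tables_frame[of m2 m1 n] by (simp add: m2_def put_def leveled_def)
      ultimately have "leveled G m2" using lev1 by (simp add: leveled_def arcs2) (simp add: m2_def put_def)
      moreover have "energy m2 + 1 = energy m1"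
        unfolding energy_def arcs2 potential_def using S v1 by (simp add: m2_def put_def)
      ultimately show "ok ?pop m1 (\<lambda>t. ?Q (1 + expr_time ?over + (1 + expr_time ?under + t)))"
        using ex e1 by (auto elim!: ok_weaken)
    qed simp_all
  qed simp_all
  then obtain t2 m2 where 2: "exec b (Cond ?over ?up ?low) m1 t2 m2" "bounded R m2" "?Q t2 m2"
    unfolding ok_def by blast
  have "exec b repair_top m (7 + t2) m2" unfolding repair_top_def by (rule exec_Seq[OF 1 2(1)])
  then show ?thesis unfolding ok_def using 2 by (intro exI[of _ "7 + t2"] exI[of _ m2]) simp
qed

lemma repair_ok:
  assumes m: "bounded R m" "leveled G m"
  shows "ok (While (var ''S'') repair_top) m
    (\<lambda>t m'. leveled G m' \<and> m' ''S'' 0 = 0 \<and> real t + 1000 * energy m' \<le> 1000 * energy m + 3)"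
proof -
  have "ok (While (var ''S'') repair_top) m (\<lambda>t m'. leveled G m' \<and> ev m' (var ''S'') = 0 \<and>
    real t + 1000 * energy m' \<le> 1000 * energy m + real (1 + expr_time (var ''S'')))"
  proof (rule ok_While[where B = "- 1000 * real (n * top_level n)"])
    fix m assume "bounded R m" "leveled G m" "ev m (var ''S'') \<noteq> 0"
    then have "ok repair_top m (\<lambda>t m'. leveled G m' \<and> real t + 1000 * energy m' \<le> 1000 * energy m - 500)"
      by (intro repair_top_ok) auto
    then show "ok repair_top m (\<lambda>t m'. leveled G m' \<and>
        real (1 + expr_time (var ''S'') + t) + 1000 * energy m' \<le> 1000 * energy m)"
      by (rule ok_weaken) auto
  next
    fix m assume "leveled G m"
    from energy_ge[OF this] show "- 1000 * real (n * top_level n) \<le> 1000 * energy m" by simp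
  qed (use m in auto)
  then show ?thesis by (rule ok_weaken) auto
qed

end

section \<open>Processing an update\<close>

text \<open>Recomputing the tables at every update costs \<open>O(log n)\<close> and avoids a preprocessing phase.\<close>

definition init :: com where
  "init =
     ((assign ''r'' (Const 1) ;; assign ''D'' (Const 1) ;; assign ''L'' (Const 0)) ;;
      While (var ''r'' [<] var ''n'' [+] var ''n'')
        (assign ''r'' (var ''r'' [+] var ''r'') ;;
         assign ''D'' (Const 64 [*] var ''D'') ;;
         assign ''L'' (var ''L'' [+] Const 3)) ;;
      (Write ''t'' (Const 1) (var ''D'') ;; assign ''o'' (Const 1)) ;;
      While (var ''o'' [<] var ''L'' [+] Const 1)
        (Write ''t'' (var ''o'' [+] Const 1) (Bin Divide (Read ''t'' (var ''o'') [*] Const 3) (Const 4)) ;;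
         assign ''o'' (var ''o'' [+] Const 1)))"

definition insert_com :: com where
  "insert_com =
     (Cond (Read ''l'' (var ''u'') [<] Read ''l'' (var ''v''))
        (assign ''h'' (Read ''l'' (var ''v'') [+] Const 1))
        (assign ''h'' (Read ''l'' (var ''u'') [+] Const 1)) ;;
      add_arc ''u'' ''v'' ;; add_arc ''v'' ''u'')"

definition delete_com :: com where
  "delete_com = (remove_arc ''u'' ''v'' ;; remove_arc ''v'' ''u'')"

definition matching_program :: com where
  "matching_program =
     (init ;; Cond (var ''op'') insert_com delete_com ;; While (var ''S'') repair_top)"

definition init_footprint :: "string list" where
  "init_footprint = [''r'', ''D'', ''L'', ''t'', ''o'']"

context matching_ram
begin

lemma init_ok:
  assumes m: "bounded R m" "m ''n'' 0 = n"
  shows "ok init m (\<lambda>t m'. tables n m' \<and> (\<forall>A. A \<notin> set init_footprint \<longrightarrow> m' A = m A) \<and>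
    t \<le> 60 * (top_level n + 1))"
proof -
  let ?K = "log_bound n"
  let ?pre = "assign ''r'' (Const 1) ;; assign ''D'' (Const 1) ;; assign ''L'' (Const 0)"
  let ?body1 = "assign ''r'' (var ''r'' [+] var ''r'') ;;
         assign ''D'' (Const 64 [*] var ''D'') ;;
         assign ''L'' (var ''L'' [+] Const 3)"
  let ?e1 = "var ''r'' [<] var ''n'' [+] var ''n''"
  let ?mid = "Write ''t'' (Const 1) (var ''D'') ;; assign ''o'' (Const 1)"
  let ?body2 = "Write ''t'' (var ''o'' [+] Const 1) (Bin Divide (Read ''t'' (var ''o'') [*] Const 3) (Const 4)) ;;
         assign ''o'' (var ''o'' [+] Const 1)"
  let ?e2 = "var ''o'' [<] var ''L'' [+] Const 1"
  let ?frame = "\<lambda>m'. \<forall>A. A \<notin> set init_footprint \<longrightarrow> m' A = m A"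
  have frame_n: "m' ''n'' 0 = n" if "?frame m'" for m' using that m(2) by (simp add: init_footprint_def)
  define m1 where "m1 = result ?pre m"
  have "ok ?pre m (\<lambda>t m'. t \<le> max_time ?pre \<and> m' = m1)"
    unfolding m1_def by (intro ok_straight m) simp_all
  then obtain t1 where 1: "exec b ?pre m t1 m1" "bounded R m1" "t1 \<le> 9" unfolding ok_def by auto
  define I1 where "I1 = (\<lambda>m'. ?frame m' \<and> (\<exists>j\<le>?K. m' ''r'' 0 = 2 ^ j \<and> m' ''D'' 0 = 64 ^ j \<and> m' ''L'' 0 = 3 * j))"
  have frame1: "?frame m1" unfolding m1_def init_footprint_def by (simp add: put_def)
  then have I1: "I1 m1" unfolding I1_def by (intro conjI exI[of _ 0]) (simp_all add: m1_def put_def)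
  have R3: "3 * ?K < R" using level_fits[of "3 * ?K"] by (simp add: top_level_def)
  have R64: "64 ^ ?K < R" using small(2) by (simp add: unit_weight_def)
  \<comment> \<open>A round takes 28 steps and increases \<open>L\<close> by 3, so 10 steps per unit
    of \<open>L\<close> suffice.\<close>
  have "ok (While ?e1 ?body1) m1 (\<lambda>t m'. I1 m' \<and> ev m' ?e1 = 0 \<and>
    real t + (10 * (3 * real ?K - real (m' ''L'' 0))) \<le> 10 * (3 * real ?K - real (m1 ''L'' 0)) + real (1 + expr_time ?e1))"
  proof (rule ok_While[where B = 0])
    fix m' assume b': "bounded R m'" and I: "I1 m'" and ne: "ev m' ?e1 \<noteq> 0"
    then obtain j where j: "j \<le> ?K" "m' ''r'' 0 = 2 ^ j" "m' ''D'' 0 = 64 ^ j" "m' ''L'' 0 = 3 * j" and fr: "?frame m'"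
      unfolding I1_def by blast
    have "2 ^ j < 2 * n" using ne frame_n[OF fr] j(2) by (auto split: if_splits)
    then have jK: "Suc j \<le> ?K" using j(1) log_bound_ge[of n] by (metis Suc_leI le_neq_implies_less not_le)
    have b64: "(64 :: nat) * 64 ^ j \<le> 64 ^ ?K" using power_increasing[OF jK, of "64 :: nat"] by simp
    have b2: "(2 :: nat) ^ j + 2 ^ j \<le> 2 ^ ?K" using power_increasing[OF jK, of "2 :: nat"] by simp
    have "ok ?body1 m' (\<lambda>t m2. t \<le> max_time ?body1 \<and> m2 = result ?body1 m')"
      using b' b2 b64 jK j R3 R64 small(3) by (intro ok_straight) (simp_all add: put_def)
    then show "ok ?body1 m' (\<lambda>t m2. I1 m2 \<and>
      real (1 + expr_time ?e1 + t) + (10 * (3 * real ?K - real (m2 ''L'' 0))) \<le> 10 * (3 * real ?K - real (m' ''L'' 0)))"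
    proof (rule ok_weaken)
      fix t m2 assume P: "t \<le> max_time ?body1 \<and> m2 = result ?body1 m'"
      have "?frame m2" using P fr by (simp add: init_footprint_def put_def)
      then have "I1 m2" unfolding I1_def using P j jK
        by (intro conjI exI[of _ "Suc j"]) (simp_all add: put_def)
      moreover have "m2 ''L'' 0 = m' ''L'' 0 + 3" using P by (simp add: put_def)
      ultimately show "I1 m2 \<and>
        real (1 + expr_time ?e1 + t) + (10 * (3 * real ?K - real (m2 ''L'' 0))) \<le> 10 * (3 * real ?K - real (m' ''L'' 0))"
        using P by simp
    qed
  next
    fix m' assume "I1 m'"
    then show "0 \<le> 10 * (3 * real ?K - real (m' ''L'' 0))" unfolding I1_def by auto
  qed (use 1 I1 in auto)
  moreover have "m1 ''L'' 0 = 0" by (simp add: m1_def put_def)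
  ultimately obtain t2 m2 where 2: "exec b (While ?e1 ?body1) m1 t2 m2" "bounded R m2" "I1 m2" "ev m2 ?e1 = 0"
    "real t2 + 10 * (3 * real ?K - real (m2 ''L'' 0)) \<le> 30 * real ?K + 9"
    unfolding ok_def by auto
  obtain j where j: "j \<le> ?K" "m2 ''r'' 0 = 2 ^ j" "m2 ''D'' 0 = 64 ^ j" "m2 ''L'' 0 = 3 * j" and fr2: "?frame m2"
    using 2(3) unfolding I1_def by blast
  have "2 * n \<le> 2 ^ j" using 2(4) frame_n[OF fr2] j(2) by (auto split: if_splits)
  \<comment> \<open>The failing test gives \<open>2 * n \<le> 2 ^ j\<close>, and
    \<open>log_bound n\<close> is the least such exponent.\<close>
  then have "j = ?K" using log_bound_le j(1) by (simp add: le_antisym)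
  then have D2: "m2 ''D'' 0 = unit_weight n" and L2: "m2 ''L'' 0 = top_level n"
    using j by (simp_all add: unit_weight_def top_level_def)
  have t2: "real t2 \<le> 10 * real (top_level n) + 9" using 2(5) L2 by (simp add: top_level_def)
  define m3 where "m3 = result ?mid m2"
  have "ok ?mid m2 (\<lambda>t m'. t \<le> max_time ?mid \<and> m' = m3)"
    unfolding m3_def by (intro ok_straight 2(2)) simp_all
  then obtain t3 where 3: "exec b ?mid m2 t3 m3" "bounded R m3" "t3 \<le> 10" unfolding ok_def by auto
  define I2 where "I2 = (\<lambda>m'. ?frame m' \<and> m' ''D'' 0 = unit_weight n \<and> m' ''L'' 0 = top_level n \<and>
    1 \<le> m' ''o'' 0 \<and> m' ''o'' 0 \<le> top_level n + 1 \<and>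
    (\<forall>q. 1 \<le> q \<and> q \<le> m' ''o'' 0 \<longrightarrow> m' ''t'' q = scaled_weight n q))"
  have "?frame m3" using fr2 unfolding m3_def init_footprint_def by (simp add: put_def)
  then have I2: "I2 m3" unfolding I2_def using D2 L2
    by (auto simp: m3_def put_def scaled_weight_1[simplified])
  have o3: "m3 ''o'' 0 = 1" by (simp add: m3_def put_def)
  have "ok (While ?e2 ?body2) m3 (\<lambda>t m'. I2 m' \<and> ev m' ?e2 = 0 \<and>
    real t + (30 * (real (top_level n) + 1 - real (m' ''o'' 0))) \<le>
    30 * (real (top_level n) + 1 - real (m3 ''o'' 0)) + real (1 + expr_time ?e2))"
  proof (rule ok_While[where B = 0])
    fix m' assume b': "bounded R m'" and I: "I2 m'" and ne: "ev m' ?e2 \<noteq> 0"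
    let ?o = "m' ''o'' 0"
    have o: "?o \<le> top_level n" "1 \<le> ?o" using ne I by (auto simp: I2_def split: if_splits)
    have t: "m' ''t'' ?o * 3 div 4 = scaled_weight n (Suc ?o)" using I o scaled_weight_Suc[OF o(2,1)] by (simp add: I2_def)
    have "scaled_weight n (Suc ?o) \<le> unit_weight n" using o by (intro scaled_weight_le) simp
    then have "scaled_weight n (Suc ?o) < R" using small(2) by simp
    then have "ok ?body2 m' (\<lambda>t m2. t \<le> max_time ?body2 \<and> m2 = result ?body2 m')"
      using b' t level_fits[OF o(1)] by (intro ok_straight) (simp_all add: put_def)
    then show "ok ?body2 m' (\<lambda>t m2. I2 m2 \<and>
      real (1 + expr_time ?e2 + t) + (30 * (real (top_level n) + 1 - real (m2 ''o'' 0))) \<le>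
      30 * (real (top_level n) + 1 - real (m' ''o'' 0)))"
    proof (rule ok_weaken)
      fix t' m2 assume P: "t' \<le> max_time ?body2 \<and> m2 = result ?body2 m'"
      have "?frame m2" using P I by (simp add: I2_def init_footprint_def put_def)
      moreover have tt: "m2 ''t'' = (m' ''t'')(Suc ?o := scaled_weight n (Suc ?o))" "m2 ''o'' 0 = Suc ?o"
        "m2 ''D'' = m' ''D''" "m2 ''L'' = m' ''L''"
        using P t by (simp_all add: put_def)
      ultimately have "I2 m2" unfolding I2_def using I o by (auto simp: I2_def le_Suc_eq)
      then show "I2 m2 \<and>
        real (1 + expr_time ?e2 + t') + (30 * (real (top_level n) + 1 - real (m2 ''o'' 0))) \<le>
        30 * (real (top_level n) + 1 - real (m' ''o'' 0))"
        using P tt(2) by simp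
    qed
  next
    fix m' assume "I2 m'"
    then show "0 \<le> 30 * (real (top_level n) + 1 - real (m' ''o'' 0))" unfolding I2_def by auto
  qed (use 3 I2 in auto)
  then obtain t4 m4 where 4: "exec b (While ?e2 ?body2) m3 t4 m4" "bounded R m4" "I2 m4" "ev m4 ?e2 = 0"
    "real t4 + 30 * (real (top_level n) + 1 - real (m4 ''o'' 0)) \<le> 30 * real (top_level n) + 8"
    unfolding ok_def using o3 by auto
  have "m4 ''o'' 0 = top_level n + 1" using 4(3,4) by (auto simp: I2_def split: if_splits)
  then have "tables n m4" "?frame m4" "real t4 \<le> 30 * real (top_level n) + 8"
    using 4(3,5) by (simp_all add: I2_def tables_def)
  moreover have "exec b init m (t1 + (t2 + (t3 + t4))) m4"
    unfolding init_def by (intro exec_Seq[OF 1(1)] exec_Seq[OF 2(1)] exec_Seq[OF 3(1)] 4(1))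
  moreover have "real (t1 + (t2 + (t3 + t4))) \<le> real (60 * (top_level n + 1))"
    using 1(3) t2 3(3) calculation(3) by simp
  then have "t1 + (t2 + (t3 + t4)) \<le> 60 * (top_level n + 1)" by (simp only: of_nat_le_iff)
  ultimately show ?thesis unfolding ok_def using 4(2) by blast
qed

lemma insert_com_ok:
  assumes m: "bounded R m" "leveled G m" and uv: "m ''u'' 0 = u" "m ''v'' 0 = v" "u < n" "v < n" "u \<noteq> v"
    and q: "arcs n m u v = 0"
  shows "ok insert_com m (\<lambda>t m'. leveled (insert {u, v} G) m' \<and> t \<le> 230 \<and>
    energy m' \<le> energy m + 130 * real (top_level n) + 2)"
proof -
  define l where "l = m ''l''"
  define j where "j = max (l u) (l v) + 1"
  have rep: "represents n c m" and tab: "tables n m" and wl: "well_leveled n (arcs n m) l"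
    using m by (auto simp: leveled_def l_def)
  have fp: "''u'' \<notin> set arc_footprint" "''v'' \<notin> set arc_footprint" "''h'' \<notin> set arc_footprint"
    "''l'' \<notin> set arc_footprint"
    by (simp_all add: arc_footprint_def)
  have le: "max (l u) (l v) \<le> top_level n" using well_leveledD(5)[OF wl] uv by simp
  then have j: "1 \<le> j" "j \<le> top_level n + 1" "l u + 1 < R" "l v + 1 < R"
    using level_fits[of "l u"] level_fits[of "l v"] by (auto simp: j_def)
  let ?pre = "Cond (Read ''l'' (var ''u'') [<] Read ''l'' (var ''v''))
        (assign ''h'' (Read ''l'' (var ''v'') [+] Const 1))
        (assign ''h'' (Read ''l'' (var ''u'') [+] Const 1))"
  define m1 where "m1 = result ?pre m"
  have m1_eq: "m1 = put ''h'' 0 j m" unfolding m1_def j_def using uv by (auto simp: l_def max_def)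
  have "ok ?pre m (\<lambda>t m'. t \<le> max_time ?pre \<and> m' = m1)"
    unfolding m1_def using j uv by (intro ok_straight m) (auto simp: l_def)
  then obtain t1 where 1: "exec b ?pre m t1 m1" "bounded R m1" "t1 \<le> 30" unfolding ok_def by auto
  have rep1: "represents n c m1" using rep by (subst represents_frame[of m1 m]) (auto simp: m1_eq put_def)
  have tab1: "tables n m1" using tab by (subst tables_frame[of m1 m]) (auto simp: m1_eq put_def)
  have arcs1: "arcs n m1 = arcs n m" by (rule arcs_cong) (simp add: m1_eq put_def)
  have v1: "m1 ''u'' 0 = u" "m1 ''v'' 0 = v" "m1 ''h'' 0 = j" "m1 ''l'' = l" "m1 ''S'' = m ''S''"
    and q1: "arcs n m1 u v = 0"
    using uv q unfolding arcs1 by (simp_all add: m1_eq put_def l_def)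
  obtain t2 m2 where 2: "exec b (add_arc ''u'' ''v'') m1 t2 m2" "bounded R m2" "t2 \<le> 100" "arc_post m1 u v j m2"
    using add_arc_ok[OF 1(2) rep1 tab1 v1(1,2) uv(3,4) fp(1,2) q1 v1(3) j(1,2)] unfolding ok_def by blast
  note a2 = arc_postD[OF 2(4)]
  have "arcs n m v u = 0" using well_leveledD(1)[OF wl uv(3,4)] q by simp
  then have v2: "m2 ''u'' 0 = u" "m2 ''v'' 0 = v" "m2 ''h'' 0 = j" "arcs n m2 v u = 0"
    using uv v1 a2(4)[OF fp(1)] a2(4)[OF fp(2)] a2(4)[OF fp(3)] by (simp_all add: a2(3) arcs1 set_arc_def)
  obtain t3 m3 where 3: "exec b (add_arc ''v'' ''u'') m2 t3 m3" "bounded R m3" "t3 \<le> 100" "arc_post m2 v u j m3"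
    using add_arc_ok[OF 2(2) a2(1,2) v2(2,1) uv(4,3) fp(2,1) v2(4,3) j(1,2)] unfolding ok_def by blast
  note a3 = arc_postD[OF 3(4)]
  have arcs3: "arcs n m3 = set_edge (arcs n m) u v j" unfolding a3(3) a2(3) arcs1 set_edge_def ..
  have v3: "m3 ''l'' = l" "m3 ''S'' 0 \<le> m ''S'' 0 + 2"
    using v1 a2(4)[OF fp(4)] a3(4)[OF fp(4)] a2(5) a3(5) by (simp_all split: if_splits)
  note ins = insert_edge[OF wl uv(3-5) q, folded j_def]
  have "support (arcs n m3) = insert {u, v} G"
    unfolding arcs3 using m(2) j(1) by (subst support_insert_edge) (auto simp: leveled_def)
  then have "leveled (insert {u, v} G) m3" using a3(1,2) ins(1) unfolding leveled_def v3 by (simp add: arcs3)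
  moreover have "energy m3 \<le> energy m + 130 * real (top_level n) + 2"
    unfolding energy_def v3 arcs3 l_def[symmetric] by (rule ins(2)[OF v3(2)])
  moreover have "exec b insert_com m (t1 + (t2 + t3)) m3"
    unfolding insert_com_def by (intro exec_Seq[OF 1(1)] exec_Seq[OF 2(1)] 3(1))
  ultimately show ?thesis unfolding ok_def using 1(3) 2(3) 3(2,3)
    by (intro exI[of _ "t1 + (t2 + t3)"] exI[of _ m3]) simp
qed

lemma delete_com_ok:
  assumes m: "bounded R m" "leveled G m" and uv: "m ''u'' 0 = u" "m ''v'' 0 = v" "u < n" "v < n" "u \<noteq> v"
    and q: "arcs n m u v \<noteq> 0"
  shows "ok delete_com m (\<lambda>t m'. leveled (G - {{u, v}}) m' \<and> t \<le> 200 \<and> energy m' \<le> energy m + 1026)"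
proof -
  define l where "l = m ''l''"
  have rep: "represents n c m" and tab: "tables n m" and wl: "well_leveled n (arcs n m) l"
    using m by (auto simp: leveled_def l_def)
  have fp: "''u'' \<notin> set arc_footprint" "''v'' \<notin> set arc_footprint" "''l'' \<notin> set arc_footprint"
    by (simp_all add: arc_footprint_def)
  obtain t2 m2 where 2: "exec b (remove_arc ''u'' ''v'') m t2 m2" "bounded R m2" "t2 \<le> 100" "arc_post m u v 0 m2"
    using remove_arc_ok[OF m(1) rep tab uv(1-4) fp(1,2) q] unfolding ok_def by blast
  note a2 = arc_postD[OF 2(4)]
  have "arcs n m v u \<noteq> 0" using well_leveledD(1)[OF wl uv(3,4)] q by simp
  then have v2: "m2 ''u'' 0 = u" "m2 ''v'' 0 = v" "arcs n m2 v u \<noteq> 0"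
    using uv a2(4)[OF fp(1)] a2(4)[OF fp(2)] by (simp_all add: a2(3) set_arc_def)
  obtain t3 m3 where 3: "exec b (remove_arc ''v'' ''u'') m2 t3 m3" "bounded R m3" "t3 \<le> 100" "arc_post m2 v u 0 m3"
    using remove_arc_ok[OF 2(2) a2(1,2) v2(2,1) uv(4,3) fp(2,1) v2(3)] unfolding ok_def by blast
  note a3 = arc_postD[OF 3(4)]
  have arcs3: "arcs n m3 = set_edge (arcs n m) u v 0" unfolding a3(3) a2(3) set_edge_def ..
  have v3: "m3 ''l'' = l" "m3 ''S'' 0 \<le> m ''S'' 0 + 2"
    using a2(4)[OF fp(3)] a3(4)[OF fp(3)] a2(5) a3(5) by (simp_all add: l_def split: if_splits)
  note del = delete_edge[OF wl uv(3-5) q]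
  have "support (arcs n m3) = G - {{u, v}}"
    unfolding arcs3 support_delete_edge using m(2) by (simp add: leveled_def)
  then have "leveled (G - {{u, v}}) m3" using a3(1,2) del(1) unfolding leveled_def v3 by (simp add: arcs3)
  moreover have "energy m3 \<le> energy m + 1026"
    unfolding energy_def v3 arcs3 l_def[symmetric] by (rule del(2)[OF v3(2)])
  moreover have "exec b delete_com m (t2 + t3) m3"
    unfolding delete_com_def by (intro exec_Seq[OF 2(1)] 3(1))
  ultimately show ?thesis unfolding ok_def using 2(3) 3(2,3)
    by (intro exI[of _ "t2 + t3"] exI[of _ m3]) simp
qed

text \<open>The state between updates: an empty stack, so that all nodes are calm.\<close>

definition settled :: "edge set \<Rightarrow> memory \<Rightarrow> bool" where
  "settled G m \<longleftrightarrow> support (arcs n m) = G \<and> represents n c m \<and>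
     well_leveled n (arcs n m) (m ''l'') \<and> m ''S'' 0 = 0"

lemma support_iff:
  assumes "settled G m"
  shows "{u, v} \<in> G \<longleftrightarrow> arcs n m u v \<noteq> 0"
proof
  assume "arcs n m u v \<noteq> 0"
  then show "{u, v} \<in> G" using assms unfolding settled_def support_def by blast
next
  assume "{u, v} \<in> G"
  then obtain x y where xy: "{u, v} = {x, y}" "arcs n m x y \<noteq> 0"
    using assms unfolding settled_def support_def by blast
  then have "x < n" "y < n" by (auto simp: arcs_def split: if_splits)
  then have "arcs n m y x \<noteq> 0" using assms xy(2) well_leveledD(1) unfolding settled_def by metis
  then show "arcs n m u v \<noteq> 0" using xy unfolding doubleton_eq_iff by metis
qed

text \<open>A deposit of \<open>1026 * (top_level n + 1)\<close> units covers both kinds of update.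
  At 1000 steps per unit, the rest of the constant 1030000 pays for rebuilding the tables and for
  the update itself.\<close>

lemma update_ok:
  assumes m: "bounded R m" "settled G m" and valid: "valid_update n G x"
  shows "\<exists>t m'. exec b matching_program (deliver x m) t m' \<and> bounded R m' \<and> settled (apply_update x G) m' \<and>
    real t + 1000 * energy m' \<le> 1000 * energy m + 1030000 * (real (top_level n) + 1)"
proof -
  obtain u v where uv: "u < n" "v < n" "u \<noteq> v" and x: "x = Insert u v \<and> {u, v} \<notin> G \<or> x = Delete u v \<and> {u, v} \<in> G"
    using valid by (cases x) auto
  define m0 where "m0 = deliver x m"
  have v0: "m0 ''u'' 0 = u" "m0 ''v'' 0 = v" "m0 ''op'' 0 = (if x = Insert u v then 1 else 0)"
    and fr0: "A \<notin> {''u'', ''v'', ''op''} \<Longrightarrow> m0 A = m A" for A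
    using x by (auto simp: m0_def put_def)
  have R1: "1 < R" "0 < R" using R_gt by auto
  have b0: "bounded R m0"
    using x uv n_fits R1 m(1) unfolding m0_def by (auto intro!: bounded_put)
  have rep: "represents n c m" using m(2) by (simp add: settled_def)
  have n0: "m0 ''n'' 0 = n" using representsD(1)[OF rep] fr0 by simp
  obtain t1 m1 where 1: "exec b init m0 t1 m1" "bounded R m1" "tables n m1"
    "\<forall>A. A \<notin> set init_footprint \<longrightarrow> m1 A = m0 A" "t1 \<le> 60 * (top_level n + 1)"
    using init_ok[OF b0 n0] unfolding ok_def by blast
  have fr1: "m1 A = m A" if "A \<notin> set init_footprint" "A \<notin> {''u'', ''v'', ''op''}" for A
    using 1(4) fr0[OF that(2)] that(1) by simp
  have v1: "m1 ''u'' 0 = u" "m1 ''v'' 0 = v" "m1 ''op'' 0 = (if x = Insert u v then 1 else 0)"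
    "m1 ''l'' = m ''l''" "m1 ''S'' = m ''S''" "m1 ''q'' = m ''q''"
    using 1(4) v0 fr1 by (simp_all add: init_footprint_def)
  have arcs1: "arcs n m1 = arcs n m" using v1(6) by (rule arcs_cong)
  have "represents n c m1" using m(2) represents_frame[of m1 m n c] fr1 by (simp add: settled_def init_footprint_def)
  then have lev1: "leveled G m1" using m(2) 1(3) by (simp add: settled_def leveled_def arcs1 v1)
  have e1: "energy m1 = energy m" by (simp add: energy_def arcs1 v1)
  have "ok (Cond (var ''op'') insert_com delete_com) m1 (\<lambda>t m'. leveled (apply_update x G) m' \<and> t \<le> 240 \<and>
    energy m' \<le> energy m + 1026 * (real (top_level n) + 1))"
  proof (rule ok_Cond[OF 1(2)])
    assume "ev m1 (var ''op'') \<noteq> 0"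
    then have ins: "x = Insert u v" "{u, v} \<notin> G" using v1(3) x by (auto split: if_splits)
    then have "arcs n m1 u v = 0" using support_iff[OF m(2)] by (simp add: arcs1)
    from insert_com_ok[OF 1(2) lev1 v1(1,2) uv this] e1 ins
    show "ok insert_com m1 (\<lambda>t m'. leveled (apply_update x G) m' \<and> 1 + expr_time (var ''op'') + t \<le> 240 \<and>
      energy m' \<le> energy m + 1026 * (real (top_level n) + 1))"
      by (elim ok_weaken) auto
  next
    assume "ev m1 (var ''op'') = 0"
    then have del: "x = Delete u v" "{u, v} \<in> G" using v1(3) x by (auto split: if_splits)
    then have "arcs n m1 u v \<noteq> 0" using support_iff[OF m(2)] by (simp add: arcs1)
    from delete_com_ok[OF 1(2) lev1 v1(1,2) uv this] e1 del
    show "ok delete_com m1 (\<lambda>t m'. leveled (apply_update x G) m' \<and> 1 + expr_time (var ''op'') + t \<le> 240 \<and>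
      energy m' \<le> energy m + 1026 * (real (top_level n) + 1))"
      by (elim ok_weaken) auto
  qed simp_all
  then obtain t2 m2 where 2: "exec b (Cond (var ''op'') insert_com delete_com) m1 t2 m2" "bounded R m2"
    "leveled (apply_update x G) m2" "t2 \<le> 240" "energy m2 \<le> energy m + 1026 * (real (top_level n) + 1)"
    unfolding ok_def by blast
  obtain t3 m3 where 3: "exec b (While (var ''S'') repair_top) m2 t3 m3" "bounded R m3"
    "leveled (apply_update x G) m3" "m3 ''S'' 0 = 0" "real t3 + 1000 * energy m3 \<le> 1000 * energy m2 + 3"
    using repair_ok[OF 2(2,3)] unfolding ok_def by blast
  have "exec b matching_program m0 (t1 + (t2 + t3)) m3"
    unfolding matching_program_def by (intro exec_Seq[OF 1(1)] exec_Seq[OF 2(1)] 3(1))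
  moreover have "settled (apply_update x G) m3" using 3(3,4) by (simp add: settled_def leveled_def)
  moreover have "real t1 \<le> 60 * (real (top_level n) + 1)" using 1(5) of_nat_mono[OF 1(5), where 'a = real] by simp
  then have "real (t1 + (t2 + t3)) + 1000 * energy m3 \<le> 1000 * energy m + 1030000 * (real (top_level n) + 1)"
    using 2(4,5) 3(5) by simp
  ultimately show ?thesis using 3(2) unfolding m0_def by blast
qed

end

section \<open>The maintained matching\<close>

lemma node_weight_eq:
  assumes "\<And>e. e \<in> E \<Longrightarrow> \<exists>u v. u < n \<and> v < n \<and> u \<noteq> v \<and> e = {u, v}"
  shows "node_weight E w v = (\<Sum>e | e \<in> E \<and> v \<in> e. w e)"
  unfolding node_weight_def
proof (rule sum.reindex_bij_betw[where h = "\<lambda>u. {u, v}" and g = w])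
  have "{e. e \<in> E \<and> v \<in> e} \<subseteq> (\<lambda>u. {u, v}) ` {u. {u, v} \<in> E}"
  proof
    fix e assume e: "e \<in> {e. e \<in> E \<and> v \<in> e}"
    then obtain x y where "e = {x, y}" using assms by blast
    then have "e = {y, v} \<or> e = {x, v}" using e by auto
    then show "e \<in> (\<lambda>u. {u, v}) ` {u. {u, v} \<in> E}" using e by auto
  qed
  then show "bij_betw (\<lambda>u. {u, v}) {u. {u, v} \<in> E} {e. e \<in> E \<and> v \<in> e}"
    by (auto simp: bij_betw_def inj_on_def doubleton_eq_iff)
qed

text \<open>The weighted handshake identity.\<close>

lemma sum_node_weight:
  assumes E: "\<And>e. e \<in> E \<Longrightarrow> \<exists>u v. u < n \<and> v < n \<and> u \<noteq> v \<and> e = {u, v}" and fin: "finite E"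
  shows "(\<Sum>v<n. node_weight E w v) = 2 * (\<Sum>e\<in>E. w e)"
proof -
  have "(\<Sum>v<n. node_weight E w v) = (\<Sum>v<n. \<Sum>e | e \<in> E \<and> v \<in> e. w e)"
    using node_weight_eq[OF E] by simp
  also have "\<dots> = (\<Sum>e\<in>E. \<Sum>v | v \<in> {..<n} \<and> v \<in> e. w e)"
    using fin by (intro sum.swap_restrict) auto
  also have "\<dots> = (\<Sum>e\<in>E. 2 * w e)"
  proof (rule sum.cong)
    fix e assume "e \<in> E"
    then obtain u v where "u < n" "v < n" "u \<noteq> v" "e = {u, v}" using E by blast
    then have "{v. v \<in> {..<n} \<and> v \<in> e} = {u, v}" "u \<noteq> v" by auto
    then show "(\<Sum>v | v \<in> {..<n} \<and> v \<in> e. w e) = 2 * w e" by simp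
  qed simp
  finally show ?thesis by (simp add: sum_distrib_left)
qed

text \<open>Every edge of a \<open>b\<close>-matching has weight 1 or an endpoint loaded to a quarter of its capacity.\<close>

lemma max_b_matching_size_le:
  assumes E: "\<And>e. e \<in> E \<Longrightarrow> \<exists>u v. u < n \<and> v < n \<and> u \<noteq> v \<and> e = {u, v}" and fin: "finite E"
    and w: "\<And>e. e \<in> E \<Longrightarrow> 0 \<le> w e"
    and slack: "\<And>u v. {u, v} \<in> E \<Longrightarrow> node_weight E w u < real (c u) / 4 \<Longrightarrow>
      node_weight E w v < real (c v) / 4 \<Longrightarrow> w {u, v} = 1"
  shows "real (max_b_matching_size n c E) \<le> 9 * (\<Sum>e\<in>E. w e)"
proof -
  let ?W = "node_weight E w"
  define T where "T = {v. v < n \<and> real (c v) / 4 \<le> ?W v}"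
  have W_nonneg: "0 \<le> ?W v" for v unfolding node_weight_def by (intro sum_nonneg) (simp add: w)
  have bound: "real (card M) \<le> 9 * (\<Sum>e\<in>E. w e)" if M: "b_matching n c E M" for M
  proof -
    have ME: "M \<subseteq> E" and finM: "finite M" using M fin by (auto simp: b_matching_def intro: finite_subset)
    let ?F = "{e \<in> M. w e = 1}"
    have "M \<subseteq> ?F \<union> (\<Union>v\<in>T. {e \<in> M. v \<in> e})"
    proof
      fix e assume e: "e \<in> M"
      then obtain u v where uv: "u < n" "v < n" "e = {u, v}" using E ME by blast
      then show "e \<in> ?F \<union> (\<Union>v\<in>T. {e \<in> M. v \<in> e})"
        using slack[of u v] e ME by (cases "u \<in> T \<or> v \<in> T") (auto simp: T_def not_le)
    qed
    then have "card M \<le> card (?F \<union> (\<Union>v\<in>T. {e \<in> M. v \<in> e}))" using finM by (intro card_mono) (auto simp: T_def)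
    also have "\<dots> \<le> card ?F + card (\<Union>v\<in>T. {e \<in> M. v \<in> e})" by (rule card_Un_le)
    also have "card (\<Union>v\<in>T. {e \<in> M. v \<in> e}) \<le> (\<Sum>v\<in>T. card {e \<in> M. v \<in> e})"
      by (rule card_UN_le) (simp add: T_def)
    also have "\<dots> \<le> (\<Sum>v\<in>T. c v)" using M by (intro sum_mono) (simp add: b_matching_def T_def)
    finally have "real (card M) \<le> real (card ?F) + (\<Sum>v\<in>T. real (c v))"
      by (simp flip: of_nat_add of_nat_sum)
    also have "real (card ?F) = (\<Sum>e\<in>?F. w e)" by simp
    also have "\<dots> \<le> (\<Sum>e\<in>E. w e)" using ME fin w by (intro sum_mono2) auto
    also have "(\<Sum>v\<in>T. real (c v)) \<le> (\<Sum>v\<in>T. 4 * ?W v)" by (intro sum_mono) (simp add: T_def)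
    also have "\<dots> \<le> (\<Sum>v<n. 4 * ?W v)" using W_nonneg by (intro sum_mono2) (auto simp: T_def)
    \<comment> \<open>The factor 4 of the load threshold is doubled by the handshake identity; the
      edges of weight 1 contribute the ninth share.\<close>
    also have "\<dots> = 8 * (\<Sum>e\<in>E. w e)" using sum_node_weight[OF E fin, of w] by (simp flip: sum_distrib_left)
    finally show ?thesis by simp
  qed
  have "{M. b_matching n c E M} \<subseteq> Pow E" by (auto simp: b_matching_def)
  then have "finite {M. b_matching n c E M}" using fin by (meson finite_Pow_iff finite_subset)
  moreover have "b_matching n c E {}" by (simp add: b_matching_def)
  ultimately have "max_b_matching_size n c E \<in> card ` {M. b_matching n c E M}"
    unfolding max_b_matching_size_def by (intro Max_in) auto
  then show ?thesis using bound by auto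
qed

section \<open>Sequences of updates\<close>

lemma run_snoc:
  "run b p m us t1 m1 \<Longrightarrow> exec b p (deliver x m1) t2 m2 \<Longrightarrow> run b p m (us @ [x]) (t1 + t2) m2"
proof (induction us arbitrary: m t1)
  case (Cons y us)
  then obtain s1 k s2 where "exec b p (deliver y m) s1 k" "run b p k us s2 m1" "t1 = s1 + s2" by auto
  moreover from this Cons have "run b p k (us @ [x]) (s2 + t2) m2" by blast
  ultimately show ?case by (auto simp: add.assoc)
qed auto

lemma graph_after_snoc: "graph_after (us @ [x]) = apply_update x (graph_after us)"
  by (simp add: graph_after_def)

lemma valid_updates_snoc:
  assumes "valid_updates n (us @ [x])"
  shows "valid_updates n us" "valid_update n (graph_after us) x"
proof -
  show "valid_updates n us" unfolding valid_updates_def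
  proof (intro allI impI)
    fix i assume "i < length us"
    then show "valid_update n (graph_after (take i us)) (us ! i)"
      using assms[unfolded valid_updates_def, rule_format, of i] by (simp add: nth_append)
  qed
  show "valid_update n (graph_after us) x"
    using assms[unfolded valid_updates_def, rule_format, of "length us"] by simp
qed

lemma graph_after_card: "finite (graph_after us) \<and> card (graph_after us) \<le> length us"
proof (induction us rule: rev_induct)
  case Nil
  then show ?case by (simp add: graph_after_def)
next
  case (snoc x us)
  show ?case
  proof (cases x)
    case (Insert u v)
    then show ?thesis using snoc card_insert_le_m1[of "Suc (length us)" "graph_after us" "{u, v}"]
      by (simp add: graph_after_snoc)
  next
    case (Delete u v)
    then show ?thesis using snoc card_Diff1_le[of "graph_after us" "{u, v}"]
      by (simp add: graph_after_snoc)
  qed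
qed

context matching_ram
begin

text \<open>Memory that is zero apart from \<open>n\<close> and the capacities is already a legal
  state: empty lists, an empty stack, and all nodes calm at level 0 with load 0. So no preprocessing
  has to be charged.\<close>

lemma initial_ok:
  assumes "\<And>v. v < n \<Longrightarrow> c v \<le> n"
  shows "bounded R (initial_memory n c)" "settled {} (initial_memory n c)" "energy (initial_memory n c) = 0"
proof -
  let ?m = "initial_memory n c"
  show "bounded R ?m" using assms n_fits by (auto simp: bounded_def initial_memory_def intro: le_less_trans)
  have arcs: "arcs n ?m = (\<lambda>_ _. 0)" by (simp add: arcs_def initial_memory_def fun_eq_iff)
  have z: "?m ''k'' = (\<lambda>_. 0)" "?m ''a'' = (\<lambda>_. 0)" "?m ''p'' = (\<lambda>_. 0)" "?m ''W'' = (\<lambda>_. 0)" "?m ''l'' = (\<lambda>_. 0)"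
    "?m ''s'' = (\<lambda>_. 0)" "?m ''S'' = (\<lambda>_. 0)" "?m ''f'' = (\<lambda>_. 0)" "?m ''n'' 0 = n" "\<forall>x<n. ?m ''c'' x = c x"
    by (simp_all add: initial_memory_def fun_eq_iff)
  have load0: "load n (\<lambda>_ _. 0) x = 0" for x by (simp add: load_def wt_def)
  have "represents n c ?m"
    unfolding represents_def arcs z using z(10)
    by (simp add: lists_ok_def scaled_weight_def stack_ok_def bij_betw_def calm_def load0)
  then show "settled {} ?m" by (simp add: settled_def arcs z well_leveled_def support_def)
  show "energy ?m = 0"
    by (simp add: energy_def arcs z potential_def edge_potential_def node_potential_def growth_def)
qed

lemma run_ok:
  assumes "\<And>v. v < n \<Longrightarrow> c v \<le> n" and "valid_updates n us"
  shows "\<exists>t m. run b matching_program (initial_memory n c) us t m \<and> bounded R m \<and>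
    settled (graph_after us) m \<and>
    real t + 1000 * energy m \<le> 1030000 * (real (top_level n) + 1) * real (length us)"
  using assms(2)
proof (induction us rule: rev_induct)
  case Nil
  then show ?case using initial_ok[OF assms(1)] by (simp add: graph_after_def)
next
  case (snoc x us)
  note valid = valid_updates_snoc[OF snoc.prems]
  from snoc.IH[OF valid(1)] obtain t m where IH: "run b matching_program (initial_memory n c) us t m"
    "bounded R m" "settled (graph_after us) m"
    "real t + 1000 * energy m \<le> 1030000 * (real (top_level n) + 1) * real (length us)" by blast
  from update_ok[OF IH(2,3) valid(2)] obtain t' m' where 1: "exec b matching_program (deliver x m) t' m'"
    "bounded R m'" "settled (apply_update x (graph_after us)) m'"
    "real t' + 1000 * energy m' \<le> 1000 * energy m + 1030000 * (real (top_level n) + 1)" by blast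
  have "real (t + t') + 1000 * energy m' \<le> 1030000 * (real (top_level n) + 1) * real (length (us @ [x]))"
    using IH(4) 1(4) by (simp add: algebra_simps)
  then show ?case using run_snoc[OF IH(1) 1(1)] 1(2,3) unfolding graph_after_snoc by blast
qed

section \<open>Reading the matching off a settled memory\<close>

lemma settled_calm:
  assumes "settled G m" "x < n"
  shows "calm (c x) (load n (arcs n m) x) (m ''l'' x)"
proof -
  have rep: "represents n c m" and "m ''S'' 0 = 0" using assms by (auto simp: settled_def)
  then have "bij_betw (m ''s'') {..<0} {v. v < n \<and> m ''f'' v \<noteq> 0}"
    using representsD(9)[OF rep] by (simp add: stack_ok_def)
  then have "m ''f'' x = 0" using assms(2) by (auto simp: bij_betw_def)
  then show ?thesis by (rule representsD(10)[OF rep assms(2)])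
qed

lemma settled_edge:
  assumes "settled G m" "e \<in> G"
  obtains u v where "u < n" "v < n" "u \<noteq> v" "e = {u, v}" "arcs n m u v \<noteq> 0"
proof -
  obtain u v where uv: "e = {u, v}" "arcs n m u v \<noteq> 0"
    using assms unfolding settled_def support_def by blast
  then have "u < n" "v < n" by (auto simp: arcs_def split: if_splits)
  moreover from this have "u \<noteq> v" using uv(2) assms well_leveledD(6)[of n "arcs n m" "m ''l''" u v]
    by (auto simp: settled_def)
  ultimately show ?thesis using uv that by blast
qed

text \<open>The energy may be negative, and a deficit of order \<open>n * top_level n\<close> could
  not be charged to a short sequence of updates. The number of edges can, being at most the number
  of updates.\<close>

lemma energy_settled_ge:
  assumes G: "settled G m" "finite G"
  shows "- (2 * real (top_level n) * real (card G)) \<le> energy m"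
proof -
  have wl: "well_leveled n (arcs n m) (m ''l'')" using G by (simp add: settled_def)
  have fin: "finite e" if "e \<in> G" for e using settled_edge[OF G(1) that] by auto
  have "x \<in> \<Union>G" if "x < n" "m ''l'' x \<noteq> 0" for x
  proof -
    have "0 < load n (arcs n m) x"
      using settled_calm[OF G(1) that(1)] that(2) cap[OF that(1)] by (simp add: calm_def)
    then have "(\<Sum>y<n. wt (arcs n m x y)) \<noteq> 0" by (simp add: load_def)
    then obtain y where "wt (arcs n m x y) \<noteq> 0" by (rule sum.not_neutral_contains_not_neutral)
    then have "arcs n m x y \<noteq> 0" by (rule contrapos_nn) (simp add: wt_def)
    then have "{x, y} \<in> G" using support_iff[OF G(1)] by blast
    then show ?thesis by blast
  qed
  then have "(\<Sum>x<n. m ''l'' x) = (\<Sum>x\<in>{..<n} \<inter> \<Union>G. m ''l'' x)"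
    by (intro sum.mono_neutral_right) auto
  also have "\<dots> \<le> (\<Sum>x\<in>{..<n} \<inter> \<Union>G. top_level n)" by (intro sum_mono) (use well_leveledD(5)[OF wl] in auto)
  also have "\<dots> \<le> card (\<Union>G) * top_level n"
    using fin G(2) by (simp add: card_mono)
  also have "card (\<Union>G) \<le> (\<Sum>e\<in>G. card e)" by (rule card_Union_le_sum_card)
  also have "(\<Sum>e\<in>G. card e) = (\<Sum>e\<in>G. 2)"
    by (rule sum.cong) (auto elim!: settled_edge[OF G(1)])
  finally have "(\<Sum>x<n. m ''l'' x) \<le> 2 * top_level n * card G" by (simp add: mult_ac)
  then have "real (\<Sum>x<n. m ''l'' x) \<le> real (2 * top_level n * card G)" by (rule of_nat_mono)
  then show ?thesis using potential_ge[OF wl, of c "m ''S'' 0"] by (simp add: energy_def)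
qed

lemma settled_weight:
  assumes G: "settled G m" and q: "arcs n m u v \<noteq> 0"
  shows "stored_weight n m {u, v} = wt (arcs n m u v)"
proof -
  have rep: "represents n c m" and wl: "well_leveled n (arcs n m) (m ''l'')" using G by (auto simp: settled_def)
  have uv: "u < n" "v < n" using q by (auto simp: arcs_def split: if_splits)
  have pos: "0 < real (unit_weight n)" by (simp add: unit_weight_def)
  have *: "real (m ''num'' (x * n + y)) / real (m ''den'' (x * n + y)) = wt (arcs n m x y)"
    if "x < n" "y < n" "arcs n m x y \<noteq> 0" for x y
    using representsD(5,6)[OF rep that] scaled_weight_eq[OF representsD(7)[OF rep that(1,2)]] pos by simp
  have sym: "arcs n m u v = arcs n m v u" using well_leveledD(1)[OF wl uv] .
  show ?thesis
  proof (cases "u \<le> v")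
    case True
    then show ?thesis using *[OF uv q] by (simp add: stored_weight_def)
  next
    case False
    then show ?thesis using *[OF uv(2,1)] q sym by (simp add: stored_weight_def)
  qed
qed

lemma settled_node_weight:
  assumes G: "settled G m" and v: "v < n"
  shows "node_weight G (stored_weight n m) v = load n (arcs n m) v"
proof -
  have wl: "well_leveled n (arcs n m) (m ''l'')" using G by (simp add: settled_def)
  have "node_weight G (stored_weight n m) v = (\<Sum>u | arcs n m u v \<noteq> 0. wt (arcs n m u v))"
    unfolding node_weight_def using support_iff[OF G] settled_weight[OF G] by (intro sum.cong) auto
  also have "\<dots> = (\<Sum>u<n. wt (arcs n m u v))"
    by (intro sum.mono_neutral_left) (auto simp: arcs_def wt_def split: if_splits)
  also have "\<dots> = load n (arcs n m) v"
    unfolding load_def using well_leveledD(1)[OF wl _ v] by (intro sum.cong) auto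
  finally show ?thesis .
qed

lemma settled_output:
  assumes G: "settled G m" "finite G"
  defines "w \<equiv> stored_weight n m"
  shows "\<And>e. e \<in> G \<Longrightarrow> 0 \<le> w e \<and> w e \<le> 1" "\<And>v. v < n \<Longrightarrow> node_weight G w v \<le> real (c v) / 2"
    "\<And>u v. {u, v} \<in> G \<Longrightarrow> node_weight G w u < real (c u) / 4 \<Longrightarrow>
      node_weight G w v < real (c v) / 4 \<Longrightarrow> w {u, v} = 1"
    "real (max_b_matching_size n c G) \<le> 9 * (\<Sum>e\<in>G. w e)"
proof -
  have wl: "well_leveled n (arcs n m) (m ''l'')" using G by (simp add: settled_def)
  show w01: "0 \<le> w e \<and> w e \<le> 1" if e: "e \<in> G" for e
  proof -
    obtain u v where "e = {u, v}" "arcs n m u v \<noteq> 0" using settled_edge[OF G(1) e] by blast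
    then have "w e = wt (arcs n m u v)" using settled_weight[OF G(1)] by (simp add: w_def)
    then show ?thesis by (simp add: wt_nonneg wt_le_1)
  qed
  show "node_weight G w v \<le> real (c v) / 2" if "v < n" for v
    using settled_calm[OF G(1) that] settled_node_weight[OF G(1) that] by (simp add: calm_def w_def)
  show slack: "w {u, v} = 1" if uv: "{u, v} \<in> G" "node_weight G w u < real (c u) / 4"
    "node_weight G w v < real (c v) / 4" for u v
  proof -
    have q: "arcs n m u v \<noteq> 0" using support_iff[OF G(1)] uv(1) by blast
    then have n: "u < n" "v < n" by (auto simp: arcs_def split: if_splits)
    have "m ''l'' u = 0" "m ''l'' v = 0"
      using uv settled_calm[OF G(1)] settled_node_weight[OF G(1)] n by (force simp: calm_def w_def)+
    then have "arcs n m u v = 1" using well_leveledD(4)[OF wl n] q by simp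
    then show ?thesis using settled_weight[OF G(1) q] by (simp add: w_def wt_def)
  qed
  show "real (max_b_matching_size n c G) \<le> 9 * (\<Sum>e\<in>G. w e)"
  proof (rule max_b_matching_size_le)
    show "\<exists>u v. u < n \<and> v < n \<and> u \<noteq> v \<and> e = {u, v}" if "e \<in> G" for e
      using settled_edge[OF G(1) that] by blast
  qed (use w01 slack G(2) in auto)
qed

end

section \<open>Word length, number of levels and the final bound\<close>

lemma two_power_log_bound_less: "2 ^ log_bound n < 4 * (n + 2)"
proof (cases "n = 0")
  case True
  then have "log_bound n = 0" using log_bound_le[of n 0] by simp
  then show ?thesis by simp
qed (use log_bound_less[of n] in simp)

text \<open>With \<open>N = n + 2\<close>, the most demanding bound is the one on loads, below
  \<open>N ^ 19\<close>; exponent 24 leaves room and also exceeds the literal 64. Degree 16 then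
  gives \<open>N ^ 384\<close>, hence the word length. This 384 is unrelated to the coefficient in
  \<open>potential\<close>.\<close>

lemma matching_ramI:
  assumes cap: "\<And>v. v < n \<Longrightarrow> 1 \<le> c v" and b: "384 * log 2 (real n + 2) \<le> real b"
  shows "matching_ram b ((n + 2) ^ 24) n c"
proof
  define N where "N = n + 2"
  have N: "2 \<le> N" by (simp add: N_def)
  have pow2: "2 ^ k \<le> N ^ k" for k using N by (intro power_mono) auto
  have "2 ^ 24 \<le> N ^ 24" by (rule pow2)
  then show "64 < (n + 2) ^ 24" by (simp add: N_def)
  have "real (((n + 2) ^ 24) ^ 16) = (real n + 2) powr 384"
    by (simp add: powr_realpow flip: power_mult) (simp add: add.commute)
  also have "\<dots> = 2 powr (384 * log 2 (real n + 2))"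
    by (simp add: powr_def log_def)
  also have "\<dots> \<le> 2 powr real b" using b by (intro powr_mono) auto
  also have "\<dots> = real (2 ^ b)" by (simp add: powr_realpow)
  finally show "((n + 2) ^ 24) ^ 16 \<le> 2 ^ b" by (simp only: of_nat_le_iff)
  show "1 \<le> c v" if "v < n" for v using cap[OF that] .
  have four: "4 * N \<le> N ^ 3" using mult_le_mono1[OF pow2[of 2], of N] by (simp add: power3_eq_cube power2_eq_square)
  have k: "2 ^ log_bound n < N ^ 3" using two_power_log_bound_less[of n] four by (simp add: N_def)
  have mono: "N ^ i \<le> N ^ j" if "i \<le> j" for i j using N that by (intro power_increasing) auto
  show "2 ^ log_bound n < (n + 2) ^ 24"
    unfolding N_def[symmetric] by (rule less_le_trans[OF k mono]) simp
  have "unit_weight n = (2 ^ 6) ^ log_bound n" by (simp add: unit_weight_def)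
  also have "\<dots> = (2 ^ log_bound n) ^ 6" by (simp only: power_mult[symmetric] mult.commute)
  also have "\<dots> \<le> (N ^ 3) ^ 6" using k by (intro power_mono) auto
  finally have "unit_weight n \<le> N ^ 18" by (simp flip: power_mult)
  then have "unit_weight n * (n + 1) < N ^ 18 * N"
    by (intro mult_le_less_imp_less) (auto simp: N_def unit_weight_def)
  also have "\<dots> = N ^ 19" by (simp flip: power_Suc2)
  also have "\<dots> \<le> N ^ 24" by (rule mono) simp
  finally show "unit_weight n * (n + 1) < (n + 2) ^ 24" unfolding N_def .
  have "log_bound n < N ^ 3" by (rule less_trans[OF less_exp k])
  then have "top_level n + 2 \<le> 4 * N ^ 3" unfolding top_level_def by linarith
  also have "\<dots> \<le> N ^ 2 * N ^ 3" using pow2[of 2] by (intro mult_le_mono1) simp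
  finally have "top_level n + 2 \<le> N ^ 5" by (simp flip: power_add)
  then have "(top_level n + 2) * (n + 1) < N ^ 5 * N" using N
    by (intro mult_le_less_imp_less) (auto simp: N_def)
  also have "\<dots> = N ^ 6" by (simp flip: power_Suc2)
  also have "\<dots> \<le> N ^ 24" by (rule mono) simp
  finally show "(top_level n + 2) * (n + 1) < (n + 2) ^ 24" unfolding N_def .
qed

text \<open>By minimality \<open>log_bound n * ln 2\<close> is below \<open>2 * ln 2 + ln n\<close>,
  hence at most \<open>3 * ln n\<close> once \<open>n\<close> is at least 2; three levels per unit
  and the added 1 give 10.\<close>

lemma top_level_le_ln:
  assumes "2 \<le> n"
  shows "real (top_level n) + 1 \<le> 10 / ln 2 * ln (real n)"
proof -
  have ln2: "0 < ln (2 :: real)" "ln 2 \<le> ln (real n)" using assms by auto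
  have "2 ^ log_bound n < 4 * n" using assms by (intro log_bound_less) simp
  then have "real (2 ^ log_bound n) < real (4 * n)" by (simp only: of_nat_less_iff)
  then have "ln (2 ^ log_bound n :: real) < ln (4 * real n)" using assms by (subst ln_less_cancel_iff) auto
  moreover have "ln (4 * real n) = 2 * ln 2 + ln (real n)"
    using assms ln_realpow[of 2 2] by (simp add: ln_mult)
  ultimately have "real (log_bound n) * ln 2 \<le> 3 * ln (real n)" using ln2 by (simp add: ln_realpow)
  then have "(3 * real (log_bound n) + 1) * ln 2 \<le> 10 * ln (real n)" using ln2 by (simp add: algebra_simps)
  then show ?thesis using ln2 by (simp add: top_level_def field_simps)
qed

theorem theorem7:
  fixes \<epsilon> lam \<gamma> :: real
  assumes "0 < \<epsilon>" and "\<epsilon> < 1 / 4" and "lam = 4" and "\<gamma> = 1 + 4 * \<epsilon>"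
  shows "\<exists>(p :: com) (K :: nat) (C :: real) (D :: real).
    \<forall>(n :: nat) (c :: nat \<Rightarrow> nat) (b :: nat) (us :: update list).
      (\<forall>v<n. 1 \<le> c v \<and> c v \<le> n) \<longrightarrow>
      real K * log 2 (real n + 2) \<le> real b \<longrightarrow>
      valid_updates n us \<longrightarrow>
      (\<exists>t m. run b p (initial_memory n c) us t m \<and>
        real t \<le> C * (real (length us) * ln (real n)) \<and>
        (let E = graph_after us; w = stored_weight n m; W = node_weight E w in
          fractional_b_matching n c E w \<and>
          (\<forall>v<n. W v \<le> real (c v) / \<gamma>) \<and>
          (\<forall>u v. {u, v} \<in> E \<longrightarrow> W u < real (c u) / lam \<longrightarrow> W v < real (c v) / lam \<longrightarrow>
             w {u, v} = 1) \<and>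
          real (max_b_matching_size n c E) \<le> D * (\<Sum>e\<in>E. w e)))"
proof -
  have main: "\<exists>t m. run b matching_program (initial_memory n c) us t m \<and>
        real t \<le> 1032000 * (10 / ln 2) * (real (length us) * ln (real n)) \<and>
        (let E = graph_after us; w = stored_weight n m; W = node_weight E w in
          fractional_b_matching n c E w \<and>
          (\<forall>v<n. W v \<le> real (c v) / \<gamma>) \<and>
          (\<forall>u v. {u, v} \<in> E \<longrightarrow> W u < real (c u) / lam \<longrightarrow> W v < real (c v) / lam \<longrightarrow>
             w {u, v} = 1) \<and>
          real (max_b_matching_size n c E) \<le> 9 * (\<Sum>e\<in>E. w e))"
    if c: "\<forall>v<n. 1 \<le> c v \<and> c v \<le> n" and b: "real 384 * log 2 (real n + 2) \<le> real b"
      and valid: "valid_updates n us" for n c b us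
  proof -
    interpret matching_ram b "(n + 2) ^ 24" n c using c b by (intro matching_ramI) auto
    let ?E = "graph_after us"
    have E: "finite ?E" "card ?E \<le> length us" using graph_after_card by auto
    obtain t m where 1: "run b matching_program (initial_memory n c) us t m" "settled ?E m"
      "real t + 1000 * energy m \<le> 1030000 * (real (top_level n) + 1) * real (length us)"
      using run_ok[OF _ valid] c by blast
    note out = settled_output[OF 1(2) E(1)]
    have "real t \<le> 1032000 * (10 / ln 2) * (real (length us) * ln (real n))"
    proof (cases us rule: rev_cases)
      case Nil
      then show ?thesis using 1(1) by simp
    next
      case (snoc vs x)
      then have "valid_update n (graph_after vs) x" using valid valid_updates_snoc(2) by blast
      \<comment> \<open>A valid update needs two distinct nodes, which makes \<open>ln n\<close>
        positive. For the empty sequence both sides of the bound vanish.\<close>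
      then have n: "2 \<le> n" by (cases x) auto
      have "2 * real (top_level n) * real (card ?E) \<le> 2 * (real (top_level n) + 1) * real (length us)"
        using E(2) by (intro mult_mono) auto
      \<comment> \<open>The possible deficit of \<open>2 * top_level n\<close> units per edge, at
        1000 steps each, raises 1030000 to 1032000.\<close>
      then have "real t \<le> 1032000 * ((real (top_level n) + 1) * real (length us))"
        using 1(3) energy_settled_ge[OF 1(2) E(1)] by (simp add: algebra_simps)
      also have "\<dots> \<le> 1032000 * ((10 / ln 2 * ln (real n)) * real (length us))"
        using top_level_le_ln[OF n] by (intro mult_left_mono mult_right_mono) auto
      finally show ?thesis by (simp add: mult_ac)
    qed
    moreover have "fractional_b_matching n c ?E (stored_weight n m)"
      using out(1,2) by (force simp: fractional_b_matching_def)
    moreover have "node_weight ?E (stored_weight n m) v \<le> real (c v) / \<gamma>" if "v < n" for v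
    proof -
      \<comment> \<open>The hypothesis \<open>\<epsilon> < 1 / 4\<close> means
        \<open>\<gamma> < 2\<close>.\<close>
      have "real (c v) / 2 \<le> real (c v) / \<gamma>" using assms by (intro divide_left_mono) auto
      then show ?thesis using out(2)[OF that] by linarith
    qed
    ultimately show ?thesis using 1(1) out(3,4) unfolding Let_def assms(3) by blast
  qed
  show ?thesis
    by (rule exI[of _ matching_program], rule exI[of _ 384], rule exI[of _ "1032000 * (10 / ln 2)"],
        rule exI[of _ 9], intro allI impI, erule (2) main)
qed

end
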